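(* Let $m\ge1$ be an integer and $l_1=l_2=m$. Let $(a,b)\in\mathbb{N}^2$ be coprime, and let $f_{(a,b)}(t)$ be the series obtained from $f_{(a,b)}$ by specializing all variables $s_k$ and $t_l$ to a single variable $t$. Then $f_{(a,b)}(t)$ admits a product factorization $$f_{(a,b)}(t)=\prod_{k\ge1}\Bigl(1-\bigl((-1)^{mab-a^2-b^2}(tx)^a(ty)^b\bigr)^k\Bigr)^{-k\,d(a,b,k)}$$ with integers $d(a,b,k)$.
   Context: Let $R=\mathbb{Q}[[s_1,\dots,s_{m},t_1,\dots,t_{m}]]$ with maximal ideal $\mathfrak m$, and $B=\mathbb{Q}[x^{\pm1},y^{\pm1}]\widehat\otimes R=\mathbb{Q}[x^{\pm1},y^{\pm1}][[s_1,\dots,s_{m},t_1,\dots,t_{m}]]$. For $(a,b)\in\mathbb{Z}^2$ and $f\in 1+x^ay^b\mathbb{Q}[x^ay^b]\widehat\otimes\mathfrak m$ let $T_{(a,b),f}$ be the $R$-linear automorphism of $B$ with $x\mapsto xf^{-b}$, $y\mapsto yf^{a}$. The tropical vertex group $H\subset{\rm Aut}_R(B)$ is the $\mathfrak m$-adic completion of the subgroup generated by all $T_{(a,b),f}$. By Kontsevich–Soibelman there is a unique factorization in $H$ $$T_{(1,0),\prod_{k=1}^{m}(1+s_kx)}\,T_{(0,1),\prod_{l=1}^{m}(1+t_ly)}=\prod_{b/a\text{ decreasing}}T_{(a,b),f_{(a,b)}},$$ the ordered product (composition of maps, $(TS)(z)=T(S(z))$) ranging over all coprime $(a,b)\in\mathbb{N}^2$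 ($0\in\mathbb{N}$), from $(0,1)$ on the left to $(1,0)$ on the right. This defines the series $f_{(a,b)}$. *)

theory Defs
  imports
    "HOL-Library.Poly_Mapping"
    "HOL-Library.Product_Plus"
    "HOL-Library.Cardinality"
    "HOL-Computational_Algebra.Formal_Power_Series"
begin

text \<open>
  Formal power series over \<open>'a\<close> in a family of variables indexed by \<open>'v\<close>: arbitrary
  families of coefficients indexed by the monomials, i.e. by the finitely supported exponent
  vectors \<open>'v \<Rightarrow>\<^sub>0 nat\<close>.
\<close>

typedef ('v, 'a) mps = "UNIV :: (('v \<Rightarrow>\<^sub>0 nat) \<Rightarrow> 'a) set"
  morphisms mps_coeff Abs_mps ..

setup_lifting type_definition_mps

lemma mps_eqI: "(\<And>n. mps_coeff f n = mps_coeff g n) \<Longrightarrow> f = g"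
  by (metis ext mps_coeff_inject)

definition antidiag :: "('v \<Rightarrow>\<^sub>0 nat) \<Rightarrow> (('v \<Rightarrow>\<^sub>0 nat) \<times> ('v \<Rightarrow>\<^sub>0 nat)) set" where
  "antidiag n = {(p, q). p + q = n}"

lemma finite_antidiag [simp]: "finite (antidiag n)"
proof -
  let ?D = "{p. \<exists>q. p + q = n}"
  let ?r = "\<lambda>p. restrict (Poly_Mapping.lookup p) (Poly_Mapping.keys n)"
  have le: "Poly_Mapping.lookup p v \<le> Poly_Mapping.lookup n v" if "p \<in> ?D" for p v
    using that by (auto simp: lookup_add)
  have "?r ` ?D \<subseteq> (\<Pi>\<^sub>E v\<in>Poly_Mapping.keys n. {..Poly_Mapping.lookup n v})"
    using le by auto
  then have "finite (?r ` ?D)"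
    by (rule finite_subset) (auto intro: finite_PiE)
  moreover have "inj_on ?r ?D"
  proof (rule inj_onI)
    fix p p' assume p: "p \<in> ?D" "p' \<in> ?D" and eq: "?r p = ?r p'"
    show "p = p'"
    proof (rule poly_mapping_eqI)
      fix v
      show "Poly_Mapping.lookup p v = Poly_Mapping.lookup p' v"
      proof (cases "v \<in> Poly_Mapping.keys n")
        case True
        then show ?thesis using fun_cong[OF eq, of v] by simp
      next
        case False
        then show ?thesis using le[OF p(1), of v] le[OF p(2), of v] by (simp add: in_keys_iff)
      qed
    qed
  qed
  ultimately have "finite ?D" by (rule finite_imageD)
  moreover have "antidiag n \<subseteq> (\<lambda>p. (p, n - p)) ` ?D"
    by (auto simp: antidiag_def image_iff)
  ultimately show ?thesis by (meson finite_imageI finite_subset)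
qed

instantiation mps :: (type, comm_ring_1) comm_ring_1
begin

lift_definition zero_mps :: "('a, 'b) mps" is "\<lambda>_. 0" .
lift_definition one_mps :: "('a, 'b) mps" is "\<lambda>n. if n = 0 then 1 else 0" .
lift_definition plus_mps :: "('a, 'b) mps \<Rightarrow> ('a, 'b) mps \<Rightarrow> ('a, 'b) mps"
  is "\<lambda>f g n. f n + g n" .
lift_definition minus_mps :: "('a, 'b) mps \<Rightarrow> ('a, 'b) mps \<Rightarrow> ('a, 'b) mps"
  is "\<lambda>f g n. f n - g n" .
lift_definition uminus_mps :: "('a, 'b) mps \<Rightarrow> ('a, 'b) mps"
  is "\<lambda>f n. - f n" .
lift_definition times_mps :: "('a, 'b) mps \<Rightarrow> ('a, 'b) mps \<Rightarrow> ('a, 'b) mps"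
  is "\<lambda>f g n. \<Sum>(p, q)\<in>antidiag n. f p * g q" .

instance
proof
  fix f g h :: "('a, 'b) mps"
  show "f * g * h = f * (g * h)"
  proof transfer
    fix f g h :: "('a \<Rightarrow>\<^sub>0 nat) \<Rightarrow> 'b"
    show "(\<lambda>n. \<Sum>(p, q)\<in>antidiag n. (\<Sum>(u, v)\<in>antidiag p. f u * g v) * h q) =
          (\<lambda>n. \<Sum>(p, q)\<in>antidiag n. f p * (\<Sum>(u, v)\<in>antidiag q. g u * h v))"
    proof
      fix n :: "'a \<Rightarrow>\<^sub>0 nat"
      have "(\<Sum>(p, q)\<in>antidiag n. (\<Sum>(u, v)\<in>antidiag p. f u * g v) * h q) =
            (\<Sum>((p, q), (u, v))\<in>Sigma (antidiag n) (\<lambda>(p, q). antidiag p). f u * g v * h q)"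
        by (subst sum.Sigma[symmetric])
          (auto simp: sum_distrib_right case_prod_unfold intro!: sum.cong)
      also have "\<dots> = (\<Sum>((p, q), (u, v))\<in>Sigma (antidiag n) (\<lambda>(p, q). antidiag q). f p * (g u * h v))"
        by (rule sum.reindex_bij_witness
            [where i = "\<lambda>((p, q), (u, v)). ((p + u, v), (p, u))"
               and j = "\<lambda>((p, q), (u, v)). ((u, v + q), (v, q))"])
          (auto simp: antidiag_def mult.assoc add.assoc)
      also have "\<dots> = (\<Sum>(p, q)\<in>antidiag n. f p * (\<Sum>(u, v)\<in>antidiag q. g u * h v))"
        by (subst sum.Sigma[symmetric])
          (auto simp: sum_distrib_left case_prod_unfold intro!: sum.cong)
      finally show "(\<Sum>(p, q)\<in>antidiag n. (\<Sum>(u, v)\<in>antidiag p. f u * g v) * h q) =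
        (\<Sum>(p, q)\<in>antidiag n. f p * (\<Sum>(u, v)\<in>antidiag q. g u * h v))" .
    qed
  qed
  show "f * g = g * f"
    by transfer (rule ext, rule sum.reindex_bij_witness[where i = prod.swap and j = prod.swap],
      auto simp: antidiag_def add.commute mult.commute)
  show "1 * f = f"
  proof transfer
    fix f :: "('a \<Rightarrow>\<^sub>0 nat) \<Rightarrow> 'b"
    show "(\<lambda>n. \<Sum>(p, q)\<in>antidiag n. (if p = 0 then 1 else 0) * f q) = f"
    proof
      fix n :: "'a \<Rightarrow>\<^sub>0 nat"
      have "(\<Sum>(p, q)\<in>antidiag n. (if p = 0 then 1 else 0) * f q) =
            (\<Sum>z\<in>antidiag n. if z = (0, n) then f n else 0)"
        by (intro sum.cong refl) (auto simp: antidiag_def split: if_splits)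
      then show "(\<Sum>(p, q)\<in>antidiag n. (if p = 0 then 1 else 0) * f q) = f n"
        by simp (simp add: antidiag_def)
    qed
  qed
  show "(f + g) * h = f * h + g * h"
    by transfer (auto simp: algebra_simps sum.distrib case_prod_unfold)
  show "(0 :: ('a, 'b) mps) \<noteq> 1"
    by transfer (auto simp: fun_eq_iff intro!: exI[of _ 0])
qed (rule mps_eqI; simp add: zero_mps.rep_eq plus_mps.rep_eq minus_mps.rep_eq uminus_mps.rep_eq
      add.commute add.left_commute)+

end

lift_definition mps_const :: "'a::zero \<Rightarrow> ('v, 'a) mps" is
  "\<lambda>c n. if n = 0 then c else 0" .

lift_definition mps_var :: "'v \<Rightarrow> ('v, 'a::zero_neq_one) mps" is
  "\<lambda>v n. if n = Poly_Mapping.single v 1 then 1 else 0" .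

definition total_degree :: "('v \<Rightarrow>\<^sub>0 nat) \<Rightarrow> nat" where
  "total_degree n = (\<Sum>v\<in>Poly_Mapping.keys n. Poly_Mapping.lookup n v)"

lemma finite_total_degree_eq: "finite {n :: 'v::finite \<Rightarrow>\<^sub>0 nat. total_degree n = d}"
proof -
  have "Poly_Mapping.lookup n v \<le> total_degree n" for n :: "'v \<Rightarrow>\<^sub>0 nat" and v
    unfolding total_degree_def
    by (cases "v \<in> Poly_Mapping.keys n") (auto intro: member_le_sum simp: in_keys_iff)
  then have "Poly_Mapping.lookup ` {n :: 'v \<Rightarrow>\<^sub>0 nat. total_degree n = d} \<subseteq> (\<Pi>\<^sub>E v\<in>UNIV. {..d})"
    by auto
  then have "finite (Poly_Mapping.lookup ` {n :: 'v \<Rightarrow>\<^sub>0 nat. total_degree n = d})"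
    by (rule finite_subset) (auto intro: finite_PiE)
  then show ?thesis
    by (rule finite_imageD) (rule inj_onI, simp only: poly_mapping.lookup_inject)
qed

text \<open>
  Congruence modulo the \<open>N\<close>-th power of the ideal generated by the (finitely many) variables.
  That power consists exactly of the series without terms of total degree less than \<open>N\<close>.
\<close>

definition mps_cong :: "nat \<Rightarrow> ('v::finite, 'a) mps \<Rightarrow> ('v, 'a) mps \<Rightarrow> bool" where
  "mps_cong N f g \<longleftrightarrow> (\<forall>n. total_degree n < N \<longrightarrow> mps_coeff f n = mps_coeff g n)"

text \<open>Specialization of all variables to a single variable.\<close>

definition mps_diagonal :: "('v::finite, 'a::comm_monoid_add) mps \<Rightarrow> 'a fps" where
  "mps_diagonal f = Abs_fps (\<lambda>d. \<Sum>n | total_degree n = d. mps_coeff f n)"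

text \<open>
  Laurent polynomials in \<open>x\<close>, \<open>y\<close> over the rationals form the group ring of the exponent group
  \<open>int \<times> int\<close>; the multiplication of \<open>\<Rightarrow>\<^sub>0\<close> is convolution.

  The number \<open>m \<ge> 1\<close> of variables of each kind is encoded as \<open>CARD('m)\<close> for a finite type \<open>'m\<close>;
  the variable \<open>s\<^sub>k\<close> has index \<open>Inl k\<close> and \<open>t\<^sub>l\<close> has index \<open>Inr l\<close>.
\<close>

type_synonym laurent = "(int \<times> int) \<Rightarrow>\<^sub>0 rat"
type_synonym 'm B = "('m + 'm, laurent) mps"

definition lx :: laurent where "lx = Poly_Mapping.single (1, 0) 1"
definition ly :: laurent where "ly = Poly_Mapping.single (0, 1) 1"

definition Bx :: "'m B" where "Bx = mps_const lx"
definition By :: "'m B" where "By = mps_const ly"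
definition svar :: "'m \<Rightarrow> 'm B" where "svar k = mps_var (Inl k)"
definition tvar :: "'m \<Rightarrow> 'm B" where "tvar l = mps_var (Inr l)"

text \<open>The subring \<open>R\<close> of \<open>B\<close>: all coefficients are rational constants.\<close>

definition Rsub :: "'m B set" where
  "Rsub = {r. \<forall>n. Poly_Mapping.keys (mps_coeff r n) \<subseteq> {0}}"

definition Aut_R :: "('m B \<Rightarrow> 'm B) set" where
  "Aut_R = {\<phi>. bij \<phi> \<and> (\<forall>u v. \<phi> (u + v) = \<phi> u + \<phi> v) \<and> (\<forall>u v. \<phi> (u * v) = \<phi> u * \<phi> v) \<and>
     (\<forall>r\<in>Rsub. \<phi> r = r)}"

text \<open>
  Integer powers of a unit of a commutative ring.  (The library's \<open>powi\<close> requires a type with a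
  division operation, which the rings used here lack.)
\<close>

definition unit_powi :: "'a::comm_ring_1 \<Rightarrow> int \<Rightarrow> 'a" where
  "unit_powi u k = (if 0 \<le> k then u ^ nat k else (THE v. u * v = 1) ^ nat (- k))"

text \<open>
  The set \<open>1 + x\<^sup>ay\<^sup>b \<rat>[x\<^sup>ay\<^sup>b] \<otimes> \<mm>\<close> (completed tensor product): the constant term in the variables
  \<open>s\<close>, \<open>t\<close> is \<open>1\<close>, and every other coefficient is a polynomial in \<open>x\<^sup>ay\<^sup>b\<close> without constant term
  (of a degree that may depend on the monomial in \<open>s\<close>, \<open>t\<close>).
\<close>

definition slope_series :: "int \<Rightarrow> int \<Rightarrow> 'm B set" where
  "slope_series a b = {f. mps_coeff f 0 = 1 \<and>
     (\<forall>n. n \<noteq> 0 \<longrightarrow> Poly_Mapping.keys (mps_coeff f n) \<subseteq> {(int k * a, int k * b) |k. k \<ge> 1})}"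

text \<open>
  For \<open>f \<in> slope_series a b\<close> there is exactly one such automorphism: every \<open>\<phi> \<in> Aut_R\<close> preserves
  the powers of the ideal generated by the variables, hence is determined by its values
  on \<open>x\<close> and \<open>y\<close>.
\<close>

definition T :: "int \<Rightarrow> int \<Rightarrow> 'm B \<Rightarrow> 'm B \<Rightarrow> 'm B" where
  "T a b f = (THE \<phi>. \<phi> \<in> Aut_R \<and> \<phi> Bx = Bx * unit_powi f (- b) \<and> \<phi> By = By * unit_powi f a)"

text \<open>\<open>b/a > d/c\<close>, with \<open>1/0 = \<infinity>\<close>.\<close>

definition steeper :: "nat \<times> nat \<Rightarrow> nat \<times> nat \<Rightarrow> bool" where
  "steeper = (\<lambda>(a, b) (c, d). b * c > d * a)"

definition comp_list :: "(nat \<Rightarrow> nat \<Rightarrow> 'm B) \<Rightarrow> (nat \<times> nat) list \<Rightarrow> 'm B \<Rightarrow> 'm B" where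
  "comp_list f ps = foldr (\<lambda>(a, b) \<phi>. T (int a) (int b) (f a b) \<circ> \<phi>) ps id"

text \<open>
  \<open>\<Phi>\<close> is the product of the \<open>T\<^bsub>(a,b),f\<^sub>(a,b)\<^esub>\<close> over all coprime \<open>(a,b)\<close>, in the order of decreasing
  slope.  The order type is dense, so the infinite product is the limit of the net of ordered
  products over finite sets of slopes (given as lists sorted by \<open>steeper\<close>), in the topology of
  congruence modulo powers of the maximal ideal.  All finite products lie in the subgroup generated
  by the automorphisms \<open>T\<close>, so convergence to \<open>\<Phi>\<close> in the automorphism group is the same as
  convergence in the completion of that subgroup.
\<close>

definition slope_factorization ::
    "('m::finite B \<Rightarrow> 'm B) \<Rightarrow> (nat \<Rightarrow> nat \<Rightarrow> 'm B) \<Rightarrow> bool" where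
  "slope_factorization \<Phi> f \<longleftrightarrow>
     (\<forall>a b. coprime a b \<longrightarrow> f a b \<in> slope_series (int a) (int b)) \<and>
     (\<forall>N. \<exists>S. finite S \<and> S \<subseteq> {(a, b). coprime a b} \<and>
        (\<forall>ps. S \<subseteq> set ps \<and> set ps \<subseteq> {(a, b). coprime a b} \<and> sorted_wrt steeper ps \<longrightarrow>
          (\<forall>z. mps_cong N (comp_list f ps z) (\<Phi> z))))"

end

theory Submission
  imports Defs Complex_Main
begin

text \<open>
  The exponents are produced by deforming the factorization to a parameter \<open>q\<close> and comparing \<open>q = 1\<close>
  with the roots of unity.

  Specializing all variables to \<open>t\<close> turns the identity into one between automorphisms of the Laurent
  polynomials in \<open>x\<close>, \<open>y\<close> with coefficients in the power series in \<open>t\<close>, and there the factors are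
  determined by their ordered product (\<open>slope_ops_unique\<close>). So it suffices to construct some
  factorization with factors of the required shape.

  In a quantum torus, where \<open>x\<close> and \<open>y\<close> commute up to a power of \<open>q\<close>, each slope \<open>(a, b)\<close> has
  automorphisms that multiply a monomial \<open>x\<^sup>iy\<^sup>j\<close> with \<open>a j - b i = 1\<close> by a series \<open>g(z)\<close> in \<open>z = x\<^sup>ay\<^sup>b\<close>, hence a monomial with \<open>a j - b i = n\<close> by
  \<open>g(z) g(qz) \<dots> g(q\<^sup>n\<^sup>-\<^sup>1z)\<close>. For generic \<open>q\<close>, every automorphism that is the identity to lowest order is
  uniquely an ordered product of these, because the difference of two automorphisms has the leading term of an
  inner derivation, and such a term is known from its value on one monomial
  (\<open>multiplicative_rigid\<close>, \<open>ordered_factorization_exists\<close>). The series \<open>g\<close> obtained from the product of the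
  two given automorphisms therefore have coefficients in \<open>\<int>[q, q\<^sup>-\<^sup>1]\<close>. At \<open>q = 1\<close> they give the classical
  factorization. If \<open>q = \<zeta>\<close> is a primitive \<open>d\<close>-th root of unity, then the \<open>d\<close>-th powers of the monomials
  are central, the automorphisms act on them, and this action is again classical, with
  \<open>\<Prod>\<^bsub>i<d\<^esub> g(\<zeta>\<^sup>iz)\<close> in the place of \<open>g\<close>. The given automorphisms yield the same classical problem as for
  \<open>q = 1\<close>. By uniqueness \<open>\<Prod>\<^bsub>i<d\<^esub> g\<^sub>\<zeta>(\<zeta>\<^sup>iz)\<close> is \<open>g\<^sub>1(z\<^sup>d)\<close>, up to a sign that produces the sign in the
  theorem (\<open>quantum_factorization\<close>).

  Finally write \<open>g = \<Prod>\<^bsub>k\<^esub> \<Prod>\<^bsub>i\<^esub> (1 - q\<^sup>iz\<^sup>k)\<^bsup>r(k,i)\<^esup>\<close> with integers \<open>r(k,i)\<close> and put \<open>R\<^sub>k(q) = \<Sum>\<^bsub>i\<^esub> r(k,i) q\<^sup>i\<close>.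
  The logarithmic derivative of the identity at \<open>\<zeta>\<close> shows, by induction on \<open>k\<close>, that \<open>R\<^sub>k\<close> vanishes at
  all \<open>k\<close>-th roots of unity except \<open>1\<close>. Averaging \<open>R\<^sub>k\<close> over the \<open>k\<close>-th roots of unity shows that \<open>k\<close> divides
  \<open>R\<^sub>k(1)\<close>, which is the exponent of \<open>1 - z\<^sup>k\<close> in \<open>g\<^sub>1\<close> (\<open>product_expansion\<close>). This is the factor \<open>k\<close> in the
  exponents; integrality of the coefficients of \<open>g\<^sub>1\<close> alone would only give integer exponents.
\<close>

unbundle fps_syntax

abbreviation single :: "'k \<Rightarrow> 'a::zero \<Rightarrow> 'k \<Rightarrow>\<^sub>0 'a" where "single \<equiv> Poly_Mapping.single"
abbreviation keys :: "('k \<Rightarrow>\<^sub>0 'a::zero) \<Rightarrow> 'k set" where "keys \<equiv> Poly_Mapping.keys"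
abbreviation lookup :: "('k \<Rightarrow>\<^sub>0 'a::zero) \<Rightarrow> 'k \<Rightarrow> 'a" where "lookup \<equiv> Poly_Mapping.lookup"

section \<open>Integer powers of units\<close>

lemma unit_inverse_eqI: "u * v = 1 \<Longrightarrow> (THE v. u * v = 1) = v" for u v :: "'a::comm_ring_1"
  by (rule the_equality) (auto, metis mult.assoc mult.commute mult.right_neutral)

lemma unit_powi_0 [simp]: "unit_powi u 0 = 1"
  by (simp add: unit_powi_def)

lemma unit_powi_1 [simp]: "unit_powi u 1 = u"
  by (simp add: unit_powi_def)

lemma unit_powi_of_nat [simp]: "unit_powi u (int n) = u ^ n"
  by (simp add: unit_powi_def)

lemma unit_powi_minus_of_nat: "u * v = 1 \<Longrightarrow> unit_powi u (- int n) = v ^ n"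
  by (cases "n = 0") (simp_all add: unit_powi_def unit_inverse_eqI)

lemma unit_powi_Suc:
  fixes u :: "'a::comm_ring_1"
  assumes "u dvd 1"
  shows "unit_powi u (k + 1) = unit_powi u k * u"
proof -
  obtain v where uv: "u * v = 1" using assms by (metis dvdE)
  show ?thesis
  proof (cases "0 \<le> k")
    case True
    then obtain n where "k = int n" by (metis nonneg_int_cases)
    then show ?thesis
      using unit_powi_of_nat[of u "Suc n"] by (simp add: mult.commute add.commute)
  next
    case False
    then obtain n where k: "k = - int (Suc n)"
      by (metis add.commute int_cases not_le of_nat_0_le_iff)
    then have "k + 1 = - int n" by simp
    then have "unit_powi u (k + 1) = v ^ n" using uv by (simp only: unit_powi_minus_of_nat)
    moreover have "unit_powi u k = v ^ Suc n" using uv unfolding k by (rule unit_powi_minus_of_nat)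
    ultimately show ?thesis using uv
      by (metis mult.assoc mult.commute mult_1_right power_Suc)
  qed
qed

text \<open>
  Every family of powers below is identified by this recursion, which avoids calculating with inverses.
\<close>

lemma unit_powi_unique:
  fixes u :: "'a::comm_ring_1"
  assumes u: "u dvd 1" and "B 0 = 1" and Suc: "\<And>k. B (k + 1) = B k * u"
  shows "B k = unit_powi u k"
proof (induction k rule: int_induct[where k = 0])
  case (step2 i)
  have "B (i - 1) * u = unit_powi u (i - 1) * u"
    using step2 Suc[of "i - 1"] unit_powi_Suc[OF u, of "i - 1"] by simp
  moreover obtain v where "u * v = 1" using u by (metis dvdE)
  ultimately show ?case by (metis mult.assoc mult.right_neutral)
qed (use assms in \<open>simp_all add: unit_powi_Suc\<close>)

lemma unit_powi_add:
  fixes u :: "'a::comm_ring_1"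
  assumes "u dvd 1"
  shows "unit_powi u (j + k) = unit_powi u j * unit_powi u k"
proof (induction k rule: int_induct[where k = 0])
  case (step2 i)
  have "unit_powi u (j + (i - 1)) * u = (unit_powi u j * unit_powi u (i - 1)) * u"
    using step2 unit_powi_Suc[OF assms, of "j + (i - 1)"] unit_powi_Suc[OF assms, of "i - 1"]
    by (simp add: mult.assoc algebra_simps)
  moreover obtain v where "u * v = 1" using assms by (metis dvdE)
  ultimately show ?case by (metis mult.assoc mult.right_neutral)
next
  case (step1 i)
  then show ?case
    using unit_powi_Suc[OF assms, of "j + i"] unit_powi_Suc[OF assms, of i]
    by (simp add: mult.assoc add.assoc)
qed simp

lemma unit_powi_dvd_1:
  fixes u :: "'a::comm_ring_1"
  assumes "u dvd 1"
  shows "unit_powi u k dvd 1"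
  using unit_powi_add[OF assms, of k "- k"] by (metis add.right_inverse dvdI unit_powi_0)

lemma unit_powi_hom:
  fixes u :: "'a::comm_ring_1" and h :: "'a \<Rightarrow> 'b::comm_ring_1"
  assumes "u dvd 1" and one: "h 1 = 1" and mult: "\<And>x y. h (x * y) = h x * h y"
  shows "h (unit_powi u k) = unit_powi (h u) k"
proof (rule unit_powi_unique)
  show "h u dvd 1" using assms by (metis dvd_def)
qed (use assms in \<open>simp_all add: unit_powi_Suc\<close>)

lemma unit_powi_mult:
  fixes u :: "'a::comm_ring_1"
  assumes u: "u dvd 1"
  shows "unit_powi u (j * k) = unit_powi (unit_powi u j) k"
proof (rule unit_powi_unique[where B = "\<lambda>k. unit_powi u (j * k)"])
  show "unit_powi u j dvd 1" by (rule unit_powi_dvd_1[OF u])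
qed (simp_all add: algebra_simps unit_powi_add[OF u])

lemma unit_powi_prod:
  fixes u v :: "'a::comm_ring_1"
  assumes u: "u dvd 1" and v: "v dvd 1"
  shows "unit_powi (u * v) k = unit_powi u k * unit_powi v k"
proof (rule sym, rule unit_powi_unique[where B = "\<lambda>k. unit_powi u k * unit_powi v k"])
  show "u * v dvd 1" using mult_dvd_mono[OF u v] by simp
qed (simp_all add: unit_powi_Suc[OF u] unit_powi_Suc[OF v] algebra_simps)

lemma fps_unit:
  fixes f :: "'a::comm_ring_1 fps"
  assumes "f $ 0 = 1"
  shows "f dvd 1"
  using fps_right_inverse[of f 1] assms by (metis dvdI mult_1)

lemma unit_powi_nth_0:
  fixes f :: "'a::comm_ring_1 fps"
  assumes "f $ 0 = 1"
  shows "unit_powi f k $ 0 = 1"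
  using unit_powi_hom[of f "\<lambda>f. f $ 0" k] fps_unit[OF assms] assms
    unit_powi_unique[of "1::'a" "\<lambda>_. 1" k] by simp

lemma unit_powi_one [simp]: "unit_powi 1 k = 1"
  using unit_powi_unique[of "1::'a::comm_ring_1" "\<lambda>_. 1" k] by simp

section \<open>Endomorphisms of a quantum torus\<close>

text \<open>
  A kernel \<open>A\<close> with parameter \<open>m\<close> stands for the linear map
  \<open>e\<^sub>u \<mapsto> \<Sum>\<^bsub>w\<^esub> A u w e\<^bsub>u + m w\<^esub>\<close>. Only finitely many pairs of shifts contribute to a given shift of a composite,
  so no completion is needed. The shifts are multiplied by \<open>m\<close> since the torus has the commutation form
  \<open>m det\<close> but its maps are considered on the finer lattice of all \<open>u\<close>. This is where the \<open>m\<close> factors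
  \<open>1 + s\<^sub>kx\<close> become a single one: its \<open>m\<close>-th power is what acts on the multiples of \<open>m\<close>.
\<close>

type_synonym 'c kernel = "int \<times> int \<Rightarrow> nat \<times> nat \<Rightarrow> 'c"

definition splits :: "'a::comm_monoid_add \<Rightarrow> ('a \<times> 'a) set" where
  "splits w = {(p, r). p + r = w}"

lemma finite_splits_vector [simp]: "finite (splits w)" for w :: "nat \<times> nat"
  by (rule finite_subset[where B = "({..fst w} \<times> {..snd w}) \<times> ({..fst w} \<times> {..snd w})"])
    (auto simp: splits_def)

lemma sum_splits_cong:
  assumes "\<And>p r. p + r = w \<Longrightarrow> f p r = g p r"
  shows "(\<Sum>(p, r)\<in>splits w. f p r) = (\<Sum>(p, r)\<in>splits w. g p r)"
  by (rule sum.cong) (use assms in \<open>auto simp: splits_def\<close>)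

lemma sum_splits_delta_left:
  assumes "finite (splits w)"
  shows "(\<Sum>(p, r)\<in>splits w. if p = 0 then f r else 0) = f w"
proof -
  have "(\<Sum>(p, r)\<in>splits w. if p = 0 then f r else 0) = (\<Sum>z\<in>splits w. if z = (0, w) then f w else 0)"
    by (rule sum.cong) (auto simp only: splits_def mem_Collect_eq prod.case prod.inject add_0 split: prod.splits if_splits)
  then show ?thesis using assms by simp (simp add: splits_def)
qed

lemma sum_splits_delta_right:
  assumes "finite (splits w)"
  shows "(\<Sum>(p, r)\<in>splits w. if r = 0 then f p else 0) = f w"
proof -
  have "(\<Sum>(p, r)\<in>splits w. if r = 0 then f p else 0) = (\<Sum>z\<in>splits w. if z = (w, 0) then f w else 0)"
    by (rule sum.cong) (auto simp only: splits_def mem_Collect_eq prod.case prod.inject add_0_right split: prod.splits if_splits)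
  then show ?thesis using assms by simp (simp add: splits_def)
qed

lemma sum_splits_ends:
  assumes "finite (splits w)" "w \<noteq> 0"
    and zero: "\<And>p r. p + r = w \<Longrightarrow> p \<noteq> 0 \<Longrightarrow> r \<noteq> 0 \<Longrightarrow> f p r = 0"
  shows "(\<Sum>(p, r)\<in>splits w. f p r) = f 0 w + f w 0"
proof -
  have "(\<Sum>(p, r)\<in>splits w. f p r) = (\<Sum>(p, r)\<in>{(0, w), (w, 0)}. f p r)"
  proof (rule sum.mono_neutral_right)
    show "\<forall>z\<in>splits w - {(0, w), (w, 0)}. (case z of (p, r) \<Rightarrow> f p r) = 0"
    proof
      fix z assume z: "z \<in> splits w - {(0, w), (w, 0)}"
      obtain p r where pr: "z = (p, r)" by (cases z)
      from z have "p + r = w" "p \<noteq> 0" "r \<noteq> 0" by (auto simp: splits_def pr)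
      then show "(case z of (p, r) \<Rightarrow> f p r) = 0" using zero by (simp add: pr)
    qed
    show "{(0, w), (w, 0)} \<subseteq> splits w" by (simp add: splits_def)
  qed fact
  then show ?thesis using assms(2) by simp
qed

lemma sum_splits_regroup:
  assumes fin: "\<And>n :: 'a::comm_monoid_add. finite (splits n)"
  shows "(\<Sum>(P, R)\<in>splits w. \<Sum>(p, p')\<in>splits P. \<Sum>(r, r')\<in>splits R. F p p' r r') =
    (\<Sum>(s, s')\<in>splits (w :: 'a). \<Sum>(p, r)\<in>splits s. \<Sum>(p', r')\<in>splits s'. F p p' r r')"
proof -
  have "(\<Sum>(P, R)\<in>splits w. \<Sum>(p, p')\<in>splits P. \<Sum>(r, r')\<in>splits R. F p p' r r') =
      (\<Sum>((P, R), ((p, p'), (r, r')))\<in>Sigma (splits w) (\<lambda>(P, R). splits P \<times> splits R). F p p' r r')"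
    by (subst sum.Sigma[symmetric]) (auto simp: sum.cartesian_product case_prod_unfold fin)
  also have "\<dots> = (\<Sum>((s, s'), ((p, r), (p', r')))\<in>Sigma (splits w) (\<lambda>(s, s'). splits s \<times> splits s'). F p p' r r')"
    by (rule sum.reindex_bij_witness
        [where i = "\<lambda>((s, s'), ((p, r), (p', r'))). ((p + p', r + r'), ((p, p'), (r, r')))"
           and j = "\<lambda>((P, R), ((p, p'), (r, r'))). ((p + r, p' + r'), ((p, r), (p', r')))"])
      (auto simp: splits_def add_ac)
  also have "\<dots> = (\<Sum>(s, s')\<in>splits w. \<Sum>(p, r)\<in>splits s. \<Sum>(p', r')\<in>splits s'. F p p' r r')"
    by (subst sum.Sigma[symmetric]) (auto simp: sum.cartesian_product case_prod_unfold fin)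
  finally show ?thesis .
qed

lemma sum_splits_by_degree:
  fixes F :: "'a::comm_monoid_add \<Rightarrow> 'a \<Rightarrow> 'b::comm_monoid_add" and \<delta> :: "'a \<Rightarrow> nat"
  assumes fin: "\<And>n :: 'a. finite (splits n)" "\<And>k. finite {n. \<delta> n = k}"
    and \<delta>: "\<And>p r. \<delta> (p + r) = \<delta> p + \<delta> r"
  shows "(\<Sum>n | \<delta> n = k. \<Sum>(p, r)\<in>splits n. F p r) = (\<Sum>i=0..k. \<Sum>p | \<delta> p = i. \<Sum>r | \<delta> r = k - i. F p r)"
proof -
  have "(\<Sum>n | \<delta> n = k. \<Sum>(p, r)\<in>splits n. F p r) = (\<Sum>(n, (p, r))\<in>Sigma {n. \<delta> n = k} splits. F p r)"
    by (subst sum.Sigma) (auto simp: fin)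
  also have "\<dots> = (\<Sum>(i, (p, r))\<in>Sigma {0..k} (\<lambda>i. {p. \<delta> p = i} \<times> {r. \<delta> r = k - i}). F p r)"
    by (rule sum.reindex_bij_witness
        [where i = "\<lambda>(i, (p, r)). (p + r, (p, r))" and j = "\<lambda>(n, (p, r)). (\<delta> p, (p, r))"])
      (auto simp: splits_def \<delta>)
  also have "\<dots> = (\<Sum>i=0..k. \<Sum>(p, r)\<in>{p. \<delta> p = i} \<times> {r. \<delta> r = k - i}. F p r)"
    by (subst sum.Sigma) (auto simp: fin)
  finally show ?thesis by (simp add: sum.cartesian_product)
qed

definition deg :: "nat \<times> nat \<Rightarrow> nat" where
  "deg w = fst w + snd w"

lemma deg_add [simp]: "deg (p + r) = deg p + deg r"
  by (simp add: deg_def)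

lemma deg_eq_0_iff [simp]: "deg w = 0 \<longleftrightarrow> w = 0"
  by (auto simp: deg_def prod_eq_iff)

lemma deg_less:
  assumes "p + r = w" "p \<noteq> 0" "r \<noteq> 0"
  shows "deg p < deg w" "deg r < deg w"
proof -
  have "deg p + deg r = deg w" using assms(1) by (metis deg_add)
  moreover have "deg p \<noteq> 0" "deg r \<noteq> 0" using assms by simp_all
  ultimately show "deg p < deg w" "deg r < deg w" by linarith+
qed

lemma deg_0 [simp]: "deg 0 = 0"
  by simp

definition shift :: "nat \<Rightarrow> int \<times> int \<Rightarrow> nat \<times> nat \<Rightarrow> int \<times> int" where
  "shift m u w = (fst u + int m * int (fst w), snd u + int m * int (snd w))"

lemma shift_0 [simp]: "shift m u 0 = u"
  by (simp add: shift_def)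

definition kcomp :: "nat \<Rightarrow> 'c::comm_ring_1 kernel \<Rightarrow> 'c kernel \<Rightarrow> 'c kernel" where
  "kcomp m A B u w = (\<Sum>(p, r)\<in>splits w. B u p * A (shift m u p) r)"

definition id_kernel :: "'c::comm_ring_1 kernel" where
  "id_kernel u w = (if w = 0 then 1 else 0)"

definition unital :: "'c::comm_ring_1 kernel \<Rightarrow> bool" where
  "unital A \<longleftrightarrow> (\<forall>u. A u 0 = 1)"

definition agree :: "nat \<Rightarrow> 'c kernel \<Rightarrow> 'c kernel \<Rightarrow> bool" where
  "agree N A B \<longleftrightarrow> (\<forall>u w. deg w < N \<longrightarrow> A u w = B u w)"

lemma splits_0 [simp]: "splits (0 :: nat \<times> nat) = {(0, 0)}"
  by (auto simp: splits_def prod_eq_iff)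

lemma unitalD: "unital A \<Longrightarrow> A u 0 = 1"
  by (simp only: unital_def)

lemma unital_id_kernel: "unital id_kernel"
  by (simp add: unital_def id_kernel_def)

lemma unital_comp: "unital A \<Longrightarrow> unital B \<Longrightarrow> unital (kcomp m A B)"
  by (simp add: unital_def kcomp_def)

lemma comp_id_left: "kcomp m id_kernel K = K"
proof (intro ext)
  fix u w
  have "kcomp m id_kernel K u w = (\<Sum>(p, r)\<in>splits w. if r = 0 then K u p else 0)"
    unfolding kcomp_def by (rule sum_splits_cong) (simp add: id_kernel_def)
  then show "kcomp m id_kernel K u w = K u w" by (simp only: sum_splits_delta_right finite_splits_vector)
qed

lemma agreeD: "agree N A B \<Longrightarrow> deg w < N \<Longrightarrow> A u w = B u w"
  by (simp only: agree_def)

lemma agree_trans: "agree N A B \<Longrightarrow> agree N B C \<Longrightarrow> agree N A C"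
  by (simp add: agree_def)

lemma agree_sym: "agree N A B \<Longrightarrow> agree N B A"
  by (simp add: agree_def)

lemma agree_comp:
  assumes "agree N A A'" "agree N B B'"
  shows "agree N (kcomp m A B) (kcomp m A' B')"
  unfolding agree_def
proof (intro allI impI)
  fix u w assume w: "deg w < N"
  show "kcomp m A B u w = kcomp m A' B' u w"
    unfolding kcomp_def
  proof (rule sum_splits_cong)
    fix p r assume "p + r = w"
    then have "deg p + deg r = deg w" by (metis deg_add)
    then have "deg p < N" "deg r < N" using w by simp_all
    then show "B u p * A (shift m u p) r = B' u p * A' (shift m u p) r"
      using assms unfolding agree_def by metis
  qed
qed

text \<open>
  Unital kernels form a group that is abelian up to terms of higher degree: to first order a product
  changes by the sum of the changes of its factors.
\<close>

lemma comp_leading: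
  assumes "agree (deg w) A A'" "agree (deg w) B B'"
    and un: "unital A" "unital A'" "unital B" "unital B'" and w: "w \<noteq> 0"
  shows "kcomp m A B u w - kcomp m A' B' u w = (A u w - A' u w) + (B u w - B' u w)"
proof -
  let ?t = "\<lambda>(p, r). B u p * A (shift m u p) r - B' u p * A' (shift m u p) r"
  have "kcomp m A B u w - kcomp m A' B' u w = sum ?t (splits w)"
    by (simp add: kcomp_def sum_subtractf case_prod_unfold)
  also have "\<dots> = ?t (0, w) + ?t (w, 0)"
    unfolding prod.case
  proof (rule sum_splits_ends[OF finite_splits_vector w])
    fix p r assume sum: "p + r = w" and "p \<noteq> 0" "r \<noteq> 0"
    then have "deg p < deg w" "deg r < deg w" by (simp_all add: deg_less)
    then show "B u p * A (shift m u p) r - B' u p * A' (shift m u p) r = 0"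
      by (simp add: agreeD[OF assms(1)] agreeD[OF assms(2)])
  qed
  also have "\<dots> = (A u w - A' u w) + (B u w - B' u w)"
    by (simp add: unitalD un)
  finally show ?thesis .
qed

text \<open>
  A character \<open>E\<close> is the family of powers \<open>E i = q\<^sup>i\<close> of a unit \<open>q\<close>. Working with \<open>E\<close> instead of \<open>q\<close> treats
  all coefficient rings alike and needs no inverses.
\<close>

definition character :: "(int \<Rightarrow> 'c::comm_ring_1) \<Rightarrow> bool" where
  "character E \<longleftrightarrow> E 0 = 1 \<and> (\<forall>i j. E (i + j) = E i * E j)"

text \<open>
  The kernels of ring endomorphisms of the quantum torus, in the basis of normally ordered monomials
  \<open>e\<^sub>u = y\<^sup>jx\<^sup>i\<close> for \<open>u = (i, j)\<close>. There \<open>e\<^sub>u e\<^sub>v = q\<^sup>\<beta> e\<^bsub>u+v\<^esub>\<close>, where \<open>m \<beta>\<close> is the first component of \<open>u\<close>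
  times the second component of \<open>v\<close>. Only the change of \<open>\<beta>\<close> under the shifts by multiples of \<open>m\<close> enters; it is
  the integer in the exponent. Normal ordering keeps all exponents of \<open>q\<close> integral, whereas a symmetric
  normalization would need a square root of \<open>q\<close>.
\<close>

definition multiplicative :: "(int \<Rightarrow> 'c::comm_ring_1) \<Rightarrow> nat \<Rightarrow> 'c kernel \<Rightarrow> bool" where
  "multiplicative E m A \<longleftrightarrow> (\<forall>u u' w. A (u + u') w =
     (\<Sum>(p, r)\<in>splits w. A u p * A u' r *
       E (fst u * int (snd r) + int (fst p) * snd u' + int (m * fst p * snd r))))"

lemma multiplicativeD: "multiplicative E m A \<Longrightarrow> A (u + u') w =
    (\<Sum>(p, r)\<in>splits w. A u p * A u' r *
       E (fst u * int (snd r) + int (fst p) * snd u' + int (m * fst p * snd r)))"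
  unfolding multiplicative_def by blast

lemma multiplicative_id_kernel: "character E \<Longrightarrow> multiplicative E m id_kernel"
  unfolding multiplicative_def
proof (intro allI)
  fix u u' :: "int \<times> int" and w :: "nat \<times> nat" assume E: "character E"
  have "(\<Sum>(p, r)\<in>splits w. id_kernel u p * id_kernel u' r *
       E (fst u * int (snd r) + int (fst p) * snd u' + int (m * fst p * snd r)))
     = (\<Sum>(p, r)\<in>splits w. if p = 0 then id_kernel u' r else 0)"
    using E by (intro sum_splits_cong) (simp add: id_kernel_def character_def)
  also have "\<dots> = id_kernel (u + u') w"
    by (simp only: sum_splits_delta_left finite_splits_vector) (simp add: id_kernel_def)
  finally show "id_kernel (u + u') w = (\<Sum>(p, r)\<in>splits w. id_kernel u p * id_kernel u' r *
       E (fst u * int (snd r) + int (fst p) * snd u' + int (m * fst p * snd r)))" ..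
qed

lemma multiplicative_comp:
  assumes E: "character E" and A: "multiplicative E m A" and B: "multiplicative E m B"
  shows "multiplicative E m (kcomp m A B)"
  unfolding multiplicative_def
proof (intro allI)
  fix u u' :: "int \<times> int" and w :: "nat \<times> nat"
  let ?\<gamma> = "\<lambda>u p u' r. fst u * int (snd r) + int (fst p) * snd u' + int (m * fst p * snd r)"
  have Eadd: "E (i + j) = E i * E j" for i j using E by (simp add: character_def)
  have shift_add: "shift m (u + u') (p + p') = shift m u p + shift m u' p'" for p p'
    by (simp add: shift_def prod_eq_iff algebra_simps)
  have \<gamma>: "E (?\<gamma> u (p + r) u' (p' + r')) = E (?\<gamma> u p u' p') * E (?\<gamma> (shift m u p) r (shift m u' p') r')"
    for p r p' r'
    unfolding Eadd[symmetric] by (rule arg_cong[where f = E]) (simp add: shift_def algebra_simps)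
  let ?F = "\<lambda>p p' r r'. B u p * B u' p' * A (shift m u p) r * A (shift m u' p') r' *
    (E (?\<gamma> u p u' p') * E (?\<gamma> (shift m u p) r (shift m u' p') r'))"
  have "kcomp m A B (u + u') w = (\<Sum>(P, R)\<in>splits w. \<Sum>(p, p')\<in>splits P. \<Sum>(r, r')\<in>splits R. ?F p p' r r')"
    unfolding kcomp_def
  proof (rule sum_splits_cong)
    fix P R
    have "B (u + u') P * A (shift m (u + u') P) R =
      (\<Sum>(p, p')\<in>splits P. B u p * B u' p' * E (?\<gamma> u p u' p') * A (shift m (u + u') P) R)"
      by (simp only: multiplicativeD[OF B] sum_distrib_right case_prod_unfold)
    also have "\<dots> = (\<Sum>(p, p')\<in>splits P. \<Sum>(r, r')\<in>splits R. ?F p p' r r')"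
    proof (rule sum_splits_cong)
      fix p p' assume "p + p' = P"
      then have P: "shift m (u + u') P = shift m u p + shift m u' p'"
        using shift_add by blast
      have A': "A (shift m u p + shift m u' p') R = (\<Sum>(r, r')\<in>splits R. A (shift m u p) r * A (shift m u' p') r' *
          E (?\<gamma> (shift m u p) r (shift m u' p') r'))"
        by (rule multiplicativeD[OF A])
      show "B u p * B u' p' * E (?\<gamma> u p u' p') * A (shift m (u + u') P) R =
        (\<Sum>(r, r')\<in>splits R. ?F p p' r r')"
        unfolding P A' sum_distrib_left case_prod_unfold by (rule sum.cong) (simp_all only: mult_ac)
    qed
    finally show "B (u + u') P * A (shift m (u + u') P) R =
       (\<Sum>(p, p')\<in>splits P. \<Sum>(r, r')\<in>splits R. ?F p p' r r')" .
  qed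
  also have "\<dots> = (\<Sum>(s, s')\<in>splits w. \<Sum>(p, r)\<in>splits s. \<Sum>(p', r')\<in>splits s'. ?F p p' r r')"
    by (rule sum_splits_regroup[OF finite_splits_vector])
  also have "\<dots> = (\<Sum>(s, s')\<in>splits w. kcomp m A B u s * kcomp m A B u' s' * E (?\<gamma> u s u' s'))"
  proof (rule sum_splits_cong)
    fix s s'
    have "kcomp m A B u s * kcomp m A B u' s' * E (?\<gamma> u s u' s') =
      (\<Sum>(p, r)\<in>splits s. \<Sum>(p', r')\<in>splits s'. B u p * A (shift m u p) r * (B u' p' * A (shift m u' p') r') * E (?\<gamma> u s u' s'))"
      unfolding kcomp_def sum_product by (simp add: sum_distrib_right case_prod_unfold)
    also have "\<dots> = (\<Sum>(p, r)\<in>splits s. \<Sum>(p', r')\<in>splits s'. ?F p p' r r')"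
    proof (intro sum_splits_cong)
      fix p r p' r'
      assume "p + r = s" "p' + r' = s'"
      then have s: "s = p + r" "s' = p' + r'" by simp_all
      show "B u p * A (shift m u p) r * (B u' p' * A (shift m u' p') r') * E (?\<gamma> u s u' s') = ?F p p' r r'"
        unfolding s \<gamma> by (simp only: mult_ac)
    qed
    finally show "(\<Sum>(p, r)\<in>splits s. \<Sum>(p', r')\<in>splits s'. ?F p p' r r') =
       kcomp m A B u s * kcomp m A B u' s' * E (?\<gamma> u s u' s')" ..
  qed
  finally show "kcomp m A B (u + u') w = (\<Sum>(s, s')\<in>splits w. kcomp m A B u s * kcomp m A B u' s' * E (?\<gamma> u s u' s'))" .
qed

section \<open>The cocycle of a series\<close>

lemma unit_cancel:
  fixes a b u :: "'a::comm_ring_1"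
  assumes u: "u dvd 1" and eq: "a * u = b * u"
  shows "a = b"
proof -
  obtain v where v: "u * v = 1" using u by (metis dvdE)
  have "a * (u * v) = b * (u * v)" by (simp only: mult.assoc[symmetric] eq)
  then show ?thesis by (simp add: v)
qed

definition twist :: "(int \<Rightarrow> 'c::comm_ring_1) \<Rightarrow> int \<Rightarrow> 'c fps \<Rightarrow> 'c fps" where
  "twist E i g = Abs_fps (\<lambda>n. E (i * int n) * g $ n)"

lemma twist_nth [simp]: "twist E i g $ n = E (i * int n) * g $ n"
  by (simp add: twist_def)

lemma characterD: "character E \<Longrightarrow> E (i + j) = E i * E j"
  by (simp add: character_def)

lemma character_0: "character E \<Longrightarrow> E 0 = 1"
  by (simp add: character_def)

lemma twist_0: "character E \<Longrightarrow> twist E 0 g = g"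
  by (rule fps_ext) (simp add: character_0)

lemma twist_twist: "character E \<Longrightarrow> twist E i (twist E j g) = twist E (i + j) g"
  by (rule fps_ext) (simp add: characterD algebra_simps)

lemma twist_1: "character E \<Longrightarrow> twist E i 1 = 1"
  by (rule fps_ext) (simp add: character_0)

lemma twist_mult:
  assumes "character E"
  shows "twist E i (f * g) = twist E i f * twist E i g"
proof (rule fps_ext)
  fix n
  have "E (i * int n) * (f $ k * g $ (n - k)) = (E (i * int k) * f $ k) * (E (i * int (n - k)) * g $ (n - k))"
    if "k \<in> {0..n}" for k
  proof -
    have "E (i * int n) = E (i * int k) * E (i * int (n - k))"
      unfolding characterD[OF assms, symmetric] using that by (simp add: algebra_simps of_nat_diff)
    then show ?thesis by (simp add: mult_ac)
  qed
  then show "twist E i (f * g) $ n = (twist E i f * twist E i g) $ n"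
    by (simp add: fps_mult_nth sum_distrib_left)
qed

text \<open>
  The cocycle \<open>\<Prod>\<^bsub>0\<le>i<j\<^esub> g(q\<^sup>iz)\<close>, continued to negative \<open>j\<close> so that the cocycle law holds for all integers.
\<close>

definition cocycle :: "(int \<Rightarrow> 'c::comm_ring_1) \<Rightarrow> 'c fps \<Rightarrow> int \<Rightarrow> 'c fps" where
  "cocycle E g j = (if 0 \<le> j then \<Prod>i\<in>{0..<j}. twist E i g
     else unit_powi (\<Prod>i\<in>{j..<0}. twist E i g) (- 1))"

lemma twist_nth_0: "character E \<Longrightarrow> g $ 0 = 1 \<Longrightarrow> twist E i g $ 0 = 1"
  by (simp add: character_0)

lemma prod_twist_nth_0: "character E \<Longrightarrow> g $ 0 = 1 \<Longrightarrow> (\<Prod>i\<in>I. twist E i g) $ 0 = 1"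
  by (induction I rule: infinite_finite_induct) (simp_all add: character_0)

lemma unit_powi_inverse:
  fixes u :: "'a::comm_ring_1"
  assumes "u dvd 1"
  shows "u * unit_powi u (- 1) = 1"
  using unit_powi_Suc[OF assms, of "- 1"] by (simp add: mult.commute)

lemma cocycle_0 [simp]: "cocycle E g 0 = 1"
  by (simp add: cocycle_def)

lemma cocycle_Suc:
  assumes E: "character E" and g: "g $ 0 = 1"
  shows "cocycle E g (j + 1) = cocycle E g j * twist E j g"
proof (cases "0 \<le> j")
  case True
  then have "{0..<j + 1} = insert j {0..<j}" by auto
  then show ?thesis using True by (simp add: cocycle_def mult.commute)
next
  case False
  let ?P = "\<Prod>i\<in>{j + 1..<0}. twist E i g"
  have "{j..<0} = insert j {j + 1..<0}" using False by auto
  then have j: "cocycle E g j = unit_powi (twist E j g * ?P) (- 1)"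
    using False by (simp add: cocycle_def)
  have u: "twist E j g dvd 1" "?P dvd 1"
    using twist_nth_0[OF E g] prod_twist_nth_0[OF E g] by (auto intro: fps_unit)
  have j1: "cocycle E g (j + 1) = unit_powi ?P (- 1)"
  proof (cases "j = - 1")
    case False
    then show ?thesis using \<open>\<not> 0 \<le> j\<close> by (simp add: cocycle_def)
  qed simp
  show ?thesis
    unfolding j j1 unit_powi_prod[OF u]
    by (simp only: mult.assoc mult.commute[of _ "twist E j g"] mult.left_commute[of _ "twist E j g"])
      (simp only: mult.assoc[symmetric] unit_powi_inverse[OF u(1)] mult_1_left)
qed

lemma cocycle_1: "character E \<Longrightarrow> g $ 0 = 1 \<Longrightarrow> cocycle E g 1 = g"
  using cocycle_Suc[of E g 0] by (simp add: twist_0)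

lemma cocycle_nth_0:
  assumes "character E" "g $ 0 = 1"
  shows "cocycle E g j $ 0 = 1"
  using prod_twist_nth_0[OF assms] by (simp add: cocycle_def unit_powi_nth_0)

lemma cocycle_add:
  assumes E: "character E" and g: "g $ 0 = 1"
  shows "cocycle E g (j + k) = cocycle E g j * twist E j (cocycle E g k)"
proof (induction k rule: int_induct[where k = 0])
  case base
  then show ?case by (simp add: twist_1[OF E])
next
  case (step1 i)
  have "cocycle E g (j + (i + 1)) = cocycle E g (j + i) * twist E (j + i) g"
    using cocycle_Suc[OF assms, of "j + i"] by (simp add: add.assoc)
  then show ?case
    by (simp add: step1 cocycle_Suc[OF assms] twist_mult[OF E] twist_twist[OF E] mult.assoc)
next
  case (step2 i)
  let ?t = "twist E (j + (i - 1)) g"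
  have "cocycle E g (j + (i - 1)) * ?t = cocycle E g (j + i)"
    using cocycle_Suc[OF assms, of "j + (i - 1)"] by (simp add: add.assoc)
  also have "\<dots> = (cocycle E g j * twist E j (cocycle E g (i - 1))) * ?t"
    using cocycle_Suc[OF assms, of "i - 1"]
    by (simp add: step2 twist_mult[OF E] twist_twist[OF E] mult.assoc)
  finally have "cocycle E g (j + (i - 1)) * ?t = (cocycle E g j * twist E j (cocycle E g (i - 1))) * ?t" .
  moreover have "?t dvd 1" using twist_nth_0[OF assms] by (rule fps_unit)
  ultimately show ?case using unit_cancel by blast
qed

text \<open>
  For \<open>q = 1\<close> the cocycle law is the law of exponents.
\<close>

lemma cocycle_trivial:
  fixes g :: "'c::comm_ring_1 fps"
  assumes "g $ 0 = 1"
  shows "cocycle (\<lambda>_. 1) g j = unit_powi g j"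
proof (rule unit_powi_unique[OF fps_unit[OF assms]])
  have E: "character (\<lambda>_. 1 :: 'c)" by (simp add: character_def)
  have "twist (\<lambda>_. 1) k g = g" for k by (rule fps_ext) simp
  then show "cocycle (\<lambda>_. 1) g (k + 1) = cocycle (\<lambda>_. 1) g k * g" for k
    using cocycle_Suc[OF E assms, of k] by simp
qed simp

definition fps_cong :: "nat \<Rightarrow> 'c fps \<Rightarrow> 'c fps \<Rightarrow> bool" where
  "fps_cong N f g \<longleftrightarrow> (\<forall>n<N. f $ n = g $ n)"

lemma fps_cong_refl [simp]: "fps_cong N f f"
  by (simp add: fps_cong_def)

lemma fps_cong_mult:
  fixes f g :: "'c::comm_ring_1 fps"
  assumes "fps_cong N f f'" "fps_cong N g g'"
  shows "fps_cong N (f * g) (f' * g')"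
  using assms by (auto simp: fps_cong_def fps_mult_nth intro!: sum.cong)

lemma fps_cong_prod:
  fixes f :: "'i \<Rightarrow> 'c::comm_ring_1 fps"
  assumes "\<And>i. i \<in> I \<Longrightarrow> fps_cong N (f i) (f' i)"
  shows "fps_cong N (\<Prod>i\<in>I. f i) (\<Prod>i\<in>I. f' i)"
  using assms by (induction I rule: infinite_finite_induct) (simp_all add: fps_cong_mult)

lemma fps_cong_power:
  fixes f :: "'c::comm_ring_1 fps"
  shows "fps_cong N f g \<Longrightarrow> fps_cong N (f ^ k) (g ^ k)"
  by (induction k) (simp_all add: fps_cong_mult)

lemma fps_cong_unit_powi:
  fixes f g :: "'c::comm_ring_1 fps"
  assumes fg: "fps_cong N f g" and f: "f $ 0 = 1" and g: "g $ 0 = 1"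
  shows "fps_cong N (unit_powi f k) (unit_powi g k)"
proof -
  obtain f' where f': "f * f' = 1" using fps_right_inverse[of f 1] f by auto
  obtain g' where g': "g * g' = 1" using fps_right_inverse[of g 1] g by auto
  have "fps_cong N (g' * f * f') (g' * g * f')"
    using fg by (intro fps_cong_mult) simp_all
  moreover have "g' * f * f' = g'" using f' by (simp only: mult.assoc mult_1_right)
  moreover have "g' * g * f' = f'" using g' by (simp only: mult.commute[of g' g] mult_1_left)
  ultimately have "fps_cong N f' g'" by (simp add: fps_cong_def)
  then show ?thesis
    using fg by (cases k rule: int_cases2)
      (simp_all add: fps_cong_power unit_powi_minus_of_nat[OF f'] unit_powi_minus_of_nat[OF g'])
qed

lemma fps_cong_cocycle:
  assumes E: "character E" and fg: "fps_cong N f g" and f: "f $ 0 = 1" and g: "g $ 0 = 1"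
  shows "fps_cong N (cocycle E f j) (cocycle E g j)"
proof -
  have "fps_cong N (twist E i f) (twist E i g)" for i
    using fg by (simp add: fps_cong_def)
  then show ?thesis
    using prod_twist_nth_0[OF E f] prod_twist_nth_0[OF E g]
    by (simp add: cocycle_def fps_cong_prod fps_cong_unit_powi)
qed

text \<open>
  Kernels take pairs as arguments; a quantifier over pairs that the simplifier splits no longer matches the
  facts about them.
\<close>

declare split_paired_All [simp del]

section \<open>Automorphisms of a given slope\<close>

definition ray :: "nat \<Rightarrow> nat \<times> nat \<Rightarrow> nat \<times> nat" where
  "ray n v = (n * fst v, n * snd v)"

definition primitive :: "nat \<times> nat \<Rightarrow> bool" where
  "primitive v \<longleftrightarrow> coprime (fst v) (snd v)"

text \<open>
  Up to sign the determinant: at \<open>q = 1\<close>, the exponent of \<open>g\<close> in the image of \<open>e\<^sub>u\<close> under the automorphism of slope \<open>v\<close>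
  with series \<open>g\<close>.
\<close>

definition pairing :: "nat \<times> nat \<Rightarrow> int \<times> int \<Rightarrow> int" where
  "pairing v u = int (fst v) * snd u - int (snd v) * fst u"

lemma pairing_add: "pairing v (u + u') = pairing v u + pairing v u'"
  by (simp add: pairing_def algebra_simps)

lemma ray_0 [simp]: "ray 0 v = 0"
  by (simp add: ray_def zero_prod_def)

lemma ray_add: "ray (n + k) v = ray n v + ray k v"
  by (simp add: ray_def algebra_simps)

lemma deg_ray [simp]: "deg (ray n v) = n * deg v"
  by (simp add: ray_def deg_def algebra_simps)

lemma gcd_ray: "primitive v \<Longrightarrow> gcd (fst (ray n v)) (snd (ray n v)) = n"
  by (simp add: ray_def primitive_def flip: gcd_mult_distrib_nat)

lemma ray_eq_iff: "primitive v \<Longrightarrow> ray n v = ray k v \<longleftrightarrow> n = k"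
  by (metis gcd_ray)

lemma ray_unique:
  assumes "primitive v" "primitive v'" "ray n v = ray k v'" "n \<noteq> 0"
  shows "v = v'"
proof -
  have "n = k" using assms(1-3) by (metis gcd_ray)
  with assms(3,4) show ?thesis by (simp add: ray_def prod_eq_iff)
qed

lemma ray_exists:
  assumes "w \<noteq> 0"
  shows "\<exists>v n. primitive v \<and> n \<noteq> 0 \<and> w = ray n v"
proof -
  let ?n = "gcd (fst w) (snd w)"
  have n: "?n \<noteq> 0" using assms by (auto simp: prod_eq_iff)
  then have "coprime (fst w div ?n) (snd w div ?n)"
    by (intro div_gcd_coprime) auto
  moreover have "w = ray ?n (fst w div ?n, snd w div ?n)"
    by (simp add: ray_def)
  ultimately show ?thesis using n unfolding primitive_def by (metis fst_conv snd_conv)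
qed

lemma primitive_deg: "primitive v \<Longrightarrow> 0 < deg v"
  by (cases v) (auto simp: primitive_def deg_def intro: ccontr)

lemma pairing_eq_1:
  assumes "primitive v"
  shows "\<exists>u. pairing v u = 1"
proof -
  obtain x y where "int (fst v) * x + int (snd v) * y = 1"
    using assms bezout_int[of "int (fst v)" "int (snd v)"]
    by (auto simp: primitive_def mult.commute)
  then have "pairing v (- y, x) = 1" by (simp add: pairing_def)
  then show ?thesis ..
qed

text \<open>
  The quantum version of \<open>T\<close>: \<open>e\<^sub>u \<mapsto> e\<^sub>u (\<Prod>\<^bsub>i<j\<^esub> g(q\<^sup>iz))\<close>, where \<open>j = pairing v u\<close> and
  \<open>z = e\<^bsub>m v\<^esub>\<close>. The power of \<open>q\<close> is what normal ordering of \<open>e\<^sub>u z\<^sup>n\<close> produces; the binomial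
  coefficient comes from the product of \<open>n\<close> copies of \<open>z\<close>. The multiple \<open>n\<close> of \<open>v\<close> is recovered as the gcd of the
  components, \<open>v\<close> being primitive.
\<close>

definition slope_kernel :: "(int \<Rightarrow> 'c::comm_ring_1) \<Rightarrow> nat \<Rightarrow> nat \<times> nat \<Rightarrow> 'c fps \<Rightarrow> 'c kernel" where
  "slope_kernel E m v g u w = (let n = gcd (fst w) (snd w) in
     if w = ray n v
     then E (int n * int (snd v) * fst u + int (m * fst v * snd v * (n choose 2))) *
       cocycle E g (pairing v u) $ n
     else 0)"

lemma slope_kernel_ray:
  assumes "primitive v"
  shows "slope_kernel E m v g u (ray n v) =
    E (int n * int (snd v) * fst u + int (m * fst v * snd v * (n choose 2))) *
      cocycle E g (pairing v u) $ n"
  by (simp add: slope_kernel_def gcd_ray[OF assms])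

lemma slope_kernel_not_ray: "(\<And>n. w \<noteq> ray n v) \<Longrightarrow> slope_kernel E m v g u w = 0"
  by (simp add: slope_kernel_def Let_def)

lemma unital_slope_kernel:
  assumes "character E" "primitive v" "g $ 0 = 1"
  shows "unital (slope_kernel E m v g)"
  using slope_kernel_ray[OF assms(2), of E m g _ 0] assms
  by (simp add: unital_def cocycle_nth_0 character_0 numeral_2_eq_2)

lemma choose_2_add: "(i + k) choose 2 = (i choose 2) + (k choose 2) + i * k"
  by (induction i) (simp_all add: numeral_2_eq_2)

lemma sum_splits_ray:
  assumes v: "primitive v"
    and f: "\<And>p r. f p r \<noteq> 0 \<Longrightarrow> \<exists>i k. p = ray i v \<and> r = ray k v"
  shows "(\<Sum>(p, r)\<in>splits (ray n v). f p r) = (\<Sum>i=0..n. f (ray i v) (ray (n - i) v))"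
proof -
  let ?h = "\<lambda>i. (ray i v, ray (n - i) v)"
  have "(\<Sum>(p, r)\<in>splits (ray n v). f p r) = (\<Sum>(p, r)\<in>?h ` {0..n}. f p r)"
  proof (rule sum.mono_neutral_right)
    show "?h ` {0..n} \<subseteq> splits (ray n v)"
      by (auto simp: splits_def simp flip: ray_add)
    show "\<forall>z\<in>splits (ray n v) - ?h ` {0..n}. (case z of (p, r) \<Rightarrow> f p r) = 0"
    proof
      fix z assume z: "z \<in> splits (ray n v) - ?h ` {0..n}"
      obtain p r where pr: "z = (p, r)" by (cases z)
      show "(case z of (p, r) \<Rightarrow> f p r) = 0"
      proof (rule ccontr)
        assume "\<not> ?thesis"
        then have "f p r \<noteq> 0" by (simp add: pr)
        then obtain i k where ik: "p = ray i v" "r = ray k v" using f by blast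
        then have "ray (i + k) v = ray n v" using z pr by (simp add: splits_def ray_add)
        then have "i + k = n" by (simp add: ray_eq_iff[OF v])
        then have "z = ?h i" "i \<in> {0..n}" using ik pr by auto
        then show False using z by blast
      qed
    qed
  qed simp
  also have "\<dots> = (\<Sum>i=0..n. f (ray i v) (ray (n - i) v))"
    by (subst sum.reindex) (auto simp: inj_on_def ray_eq_iff[OF v])
  finally show ?thesis .
qed

text \<open>
  Beyond the bookkeeping of normal ordering this is the cocycle law.
\<close>

lemma multiplicative_slope_kernel:
  assumes E: "character E" and v: "primitive v" and g: "g $ 0 = 1"
  shows "multiplicative E m (slope_kernel E m v g)"
  unfolding multiplicative_def
proof (intro allI)
  fix u u' :: "int \<times> int" and w :: "nat \<times> nat"
  let ?\<gamma> = "\<lambda>p r. fst u * int (snd r) + int (fst p) * snd u' + int (m * fst p * snd r)"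
  let ?A = "slope_kernel E m v g"
  let ?f = "\<lambda>p r. ?A u p * ?A u' r * E (?\<gamma> p r)"
  have f: "\<exists>i k. p = ray i v \<and> r = ray k v" if "?f p r \<noteq> 0" for p r
    using that slope_kernel_not_ray[of p v E m g u] slope_kernel_not_ray[of r v E m g u'] by (metis mult_zero_left mult_zero_right)
  show "?A (u + u') w = (\<Sum>(p, r)\<in>splits w. ?f p r)"
  proof (cases "\<exists>n. w = ray n v")
    case False
    have "(\<Sum>(p, r)\<in>splits w. ?f p r) = 0"
    proof (rule sum.neutral, rule ballI)
      fix z assume z: "z \<in> splits w"
      obtain p r where pr: "z = (p, r)" by (cases z)
      have "\<not> (\<exists>i k. p = ray i v \<and> r = ray k v)"
        using False z by (auto simp: pr splits_def simp flip: ray_add)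
      then show "(case z of (p, r) \<Rightarrow> ?f p r) = 0" using f[of p r] pr by auto
    qed
    then show ?thesis using False slope_kernel_not_ray[of w v] by metis
  next
    case True
    then obtain n where w: "w = ray n v" ..
    let ?j = "pairing v u" and ?j' = "pairing v u'"
    let ?a = "int (fst v)" and ?b = "int (snd v)"
    have coc: "cocycle E g (pairing v (u + u')) = twist E ?j' (cocycle E g ?j) * cocycle E g ?j'"
      by (simp only: pairing_add add.commute[of ?j] cocycle_add[OF E g] mult.commute)
    let ?\<kappa> = "\<lambda>n u. int n * ?b * fst u + int (m * fst v * snd v * (n choose 2))"
    have regroup: "x * (y * c * d) = p * c * (r * d) * s" if "x * y = p * r * s" for x y p r s c d :: 'a
    proof -
      have "x * (y * c * d) = (x * y) * (c * d)" by (simp only: mult_ac)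
      also have "\<dots> = p * c * (r * d) * s" unfolding that by (simp only: mult_ac)
      finally show ?thesis .
    qed
    have "?A (u + u') w = (\<Sum>i=0..n. E (?\<kappa> n (u + u')) *
        (E (?j' * int i) * cocycle E g ?j $ i * cocycle E g ?j' $ (n - i)))"
      unfolding w slope_kernel_ray[OF v] coc by (simp add: fps_mult_nth sum_distrib_left)
    also have "\<dots> = (\<Sum>i=0..n. ?f (ray i v) (ray (n - i) v))"
    proof (rule sum.cong[OF refl])
      fix i assume "i \<in> {0..n}"
      then obtain k where k: "n = i + k" by (auto simp: le_iff_add)
      have "E (?\<kappa> n (u + u')) * E (?j' * int i) =
        E (?\<kappa> i u) * E (?\<kappa> k u') * E (?\<gamma> (ray i v) (ray k v))"
        unfolding characterD[OF E, symmetric]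
        by (rule arg_cong[where f = E])
          (simp add: k choose_2_add pairing_def ray_def algebra_simps)
      from regroup[OF this] have
        "E (?\<kappa> n (u + u')) * (E (?j' * int i) * cocycle E g ?j $ i * cocycle E g ?j' $ k) =
         ?f (ray i v) (ray k v)"
        unfolding slope_kernel_ray[OF v] .
      then show "E (?\<kappa> n (u + u')) * (E (?j' * int i) * cocycle E g ?j $ i * cocycle E g ?j' $ (n - i))
         = ?f (ray i v) (ray (n - i) v)"
        by (simp only: k add_diff_cancel_left')
    qed
    also have "\<dots> = (\<Sum>(p, r)\<in>splits w. ?f p r)"
      unfolding w by (rule sum_splits_ray[OF v f, symmetric])
    finally show ?thesis .
  qed
qed

definition ordered_prod :: "(int \<Rightarrow> 'c::comm_ring_1) \<Rightarrow> nat \<Rightarrow> (nat \<times> nat \<Rightarrow> 'c fps) \<Rightarrow> (nat \<times> nat) list \<Rightarrow> 'c kernel" where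
  "ordered_prod E m g ps = foldr (\<lambda>v K. kcomp m (slope_kernel E m v (g v)) K) ps id_kernel"

lemma ordered_prod_Nil [simp]: "ordered_prod E m g [] = id_kernel"
  and ordered_prod_Cons [simp]: "ordered_prod E m g (v # ps) = kcomp m (slope_kernel E m v (g v)) (ordered_prod E m g ps)"
  by (simp_all add: ordered_prod_def)

lemma unital_ordered_prod:
  assumes "character E" "\<forall>v. g v $ 0 = 1" "\<forall>v\<in>set ps. primitive v"
  shows "unital (ordered_prod E m g ps)"
  using assms(3)
  by (induction ps) (auto intro!: unital_comp unital_slope_kernel simp: assms(1,2) unital_id_kernel)

lemma multiplicative_ordered_prod:
  assumes "character E" "\<forall>v. g v $ 0 = 1" "\<forall>v\<in>set ps. primitive v"
  shows "multiplicative E m (ordered_prod E m g ps)"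
  using assms(3)
  by (induction ps)
    (auto intro!: multiplicative_comp multiplicative_slope_kernel simp: assms(1,2) multiplicative_id_kernel)

lemma agree_slope_kernel:
  assumes E: "character E" and v: "primitive v" and g: "g $ 0 = 1" "g' $ 0 = 1"
    and eq: "\<And>n. n * deg v < N \<Longrightarrow> g $ n = g' $ n"
  shows "agree N (slope_kernel E m v g) (slope_kernel E m v g')"
  unfolding agree_def
proof (intro allI impI)
  fix u w assume w: "deg w < N"
  show "slope_kernel E m v g u w = slope_kernel E m v g' u w"
  proof (cases "\<exists>n. w = ray n v")
    case True
    then obtain n where n: "w = ray n v" ..
    have "k * deg v < N" if "k \<le> n" for k
      using w that unfolding n deg_ray by (meson le_less_trans mult_le_mono1)
    then have "fps_cong (Suc n) g g'" using eq by (simp add: fps_cong_def less_Suc_eq_le)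
    then have "fps_cong (Suc n) (cocycle E g (pairing v u)) (cocycle E g' (pairing v u))"
      by (intro fps_cong_cocycle E g)
    then show ?thesis unfolding n slope_kernel_ray[OF v] by (simp add: fps_cong_def)
  qed (metis slope_kernel_not_ray)
qed

lemma agree_slope_kernel_id:
  assumes E: "character E" and v: "primitive v" and g: "g $ 0 = 1" and N: "N \<le> deg v"
  shows "agree N (slope_kernel E m v g) id_kernel"
  unfolding agree_def
proof (intro allI impI)
  fix u w assume w: "deg w < N"
  show "slope_kernel E m v g u w = id_kernel u w"
  proof (cases "w = 0")
    case True
    then show ?thesis
      using unitalD[OF unital_slope_kernel[OF E v g]] unitalD[OF unital_id_kernel] by metis
  next
    case False
    have "w \<noteq> ray n v" for n
    proof
      assume n: "w = ray n v"
      then have "n \<noteq> 0" using False by (cases n) auto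
      then have "deg v \<le> deg w" by (simp add: n)
      then show False using w N by simp
    qed
    then show ?thesis using False by (simp add: slope_kernel_not_ray id_kernel_def)
  qed
qed

lemma agree_refl [simp]: "agree N A A"
  by (simp add: agree_def)

lemma agree_ordered_prod:
  assumes "character E" "\<forall>v\<in>set ps. primitive v" "\<forall>v. g v $ 0 = 1" "\<forall>v. g' v $ 0 = 1"
    and "\<And>v n. v \<in> set ps \<Longrightarrow> n * deg v < N \<Longrightarrow> g v $ n = g' v $ n"
  shows "agree N (ordered_prod E m g ps) (ordered_prod E m g' ps)"
  using assms(2,5)
  by (induction ps) (auto intro!: agree_comp agree_slope_kernel simp: assms(1,3,4))

lemma agree_ordered_prod_filter:
  assumes "character E" "\<forall>v\<in>set ps. primitive v" "\<forall>v. g v $ 0 = 1"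
  shows "agree N (ordered_prod E m g ps) (ordered_prod E m g (filter (\<lambda>v. deg v < N) ps))"
  using assms(2)
proof (induction ps)
  case (Cons v ps)
  then have IH: "agree N (ordered_prod E m g ps) (ordered_prod E m g (filter (\<lambda>v. deg v < N) ps))" by simp
  show ?case
  proof (cases "deg v < N")
    case True
    then show ?thesis using IH by (simp add: agree_comp)
  next
    case False
    then have "agree N (slope_kernel E m v (g v)) id_kernel"
      using Cons.prems assms by (intro agree_slope_kernel_id) simp_all
    then have "agree N (ordered_prod E m g (v # ps)) (kcomp m id_kernel (ordered_prod E m g (filter (\<lambda>v. deg v < N) ps)))"
      using IH by (simp add: agree_comp)
    then show ?thesis using False by (simp add: comp_id_left)
  qed
qed simp

lemma ordered_prod_leading:
  assumes E: "character E" and ps: "\<forall>v\<in>set ps. primitive v"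
    and g: "\<forall>v. g v $ 0 = 1" "\<forall>v. g' v $ 0 = 1"
    and eq: "\<And>v n. v \<in> set ps \<Longrightarrow> n * deg v < deg w \<Longrightarrow> g v $ n = g' v $ n"
    and w: "w \<noteq> 0"
  shows "ordered_prod E m g ps u w - ordered_prod E m g' ps u w =
    (\<Sum>v\<leftarrow>ps. slope_kernel E m v (g v) u w - slope_kernel E m v (g' v) u w)"
  using ps eq
proof (induction ps)
  case (Cons v ps)
  have "ordered_prod E m g (v # ps) u w - ordered_prod E m g' (v # ps) u w =
    (slope_kernel E m v (g v) u w - slope_kernel E m v (g' v) u w) + (ordered_prod E m g ps u w - ordered_prod E m g' ps u w)"
    unfolding ordered_prod_Cons
  proof (rule comp_leading)
    show "agree (deg w) (slope_kernel E m v (g v)) (slope_kernel E m v (g' v))"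
      using Cons.prems g by (intro agree_slope_kernel E) simp_all
    show "agree (deg w) (ordered_prod E m g ps) (ordered_prod E m g' ps)"
      using Cons.prems g by (intro agree_ordered_prod E) simp_all
  qed (use Cons.prems g w in \<open>simp_all add: unital_slope_kernel unital_ordered_prod E\<close>)
  then show ?case using Cons by simp
qed simp

text \<open>
  On the monomial \<open>e\<^sub>u\<close> and in the direction \<open>v\<close>, changing the top coefficients of all series affects the
  product only through the coefficient of \<open>v\<close>, and by a unit multiple. This yields both existence and
  uniqueness of factorizations, one degree at a time.
\<close>

lemma ordered_prod_leading_ray:
  assumes E: "character E" and ps: "\<forall>v\<in>set ps. primitive v" "distinct ps" "v \<in> set ps"
    and g: "\<forall>v. g v $ 0 = 1" "\<forall>v. g' v $ 0 = 1"
    and eq: "\<And>v' k. v' \<in> set ps \<Longrightarrow> k * deg v' < n * deg v \<Longrightarrow> g v' $ k = g' v' $ k"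
    and n: "n \<noteq> 0" and u: "pairing v u = 1"
  shows "ordered_prod E m g ps u (ray n v) - ordered_prod E m g' ps u (ray n v) =
    E (int n * int (snd v) * fst u + int (m * fst v * snd v * (n choose 2))) * (g v $ n - g' v $ n)"
proof -
  have v: "primitive v" using ps by blast
  let ?w = "ray n v"
  have w: "?w \<noteq> 0" using n primitive_deg[OF v] by (simp add: deg_eq_0_iff[symmetric] del: deg_eq_0_iff)
  have zero: "slope_kernel E m v' h u ?w = 0" if "v' \<in> set ps" "v' \<noteq> v" for v' h
    using that ps ray_unique[OF v _ _ n] by (intro slope_kernel_not_ray) metis
  have "ordered_prod E m g ps u ?w - ordered_prod E m g' ps u ?w =
    (\<Sum>v'\<leftarrow>ps. slope_kernel E m v' (g v') u ?w - slope_kernel E m v' (g' v') u ?w)"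
    using eq by (intro ordered_prod_leading E ps g w) simp
  also have "\<dots> = (\<Sum>v'\<in>set ps. if v' = v then slope_kernel E m v (g v) u ?w - slope_kernel E m v (g' v) u ?w else 0)"
    unfolding sum_list_distinct_conv_sum_set[OF ps(2)]
    by (rule sum.cong) (auto simp: zero)
  also have "\<dots> = slope_kernel E m v (g v) u ?w - slope_kernel E m v (g' v) u ?w"
    using ps(3) by simp
  also have "\<dots> = E (int n * int (snd v) * fst u + int (m * fst v * snd v * (n choose 2))) * (g v $ n - g' v $ n)"
    unfolding slope_kernel_ray[OF v] u using g by (simp add: cocycle_1[OF E] algebra_simps)
  finally show ?thesis .
qed

text \<open>
  The difference of two endomorphisms that agree in lower degrees is, in its leading degree, a derivation
  \<open>\<delta>\<close> over the quantum torus. Applying it to \<open>e\<^sub>u e\<^sub>v\<close> and to \<open>e\<^sub>v e\<^sub>u\<close>, which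
  differ by a power of \<open>q\<close>, gives a linear relation between \<open>\<delta> u\<close> and
  \<open>\<delta> v\<close>, which determines \<open>\<delta> u\<close> from \<open>\<delta> v\<close> when \<open>q\<close> is not a root of unity. At \<open>q = 1\<close> the relation is void,
  which is one reason for deforming first.
\<close>

lemma multiplicative_rigid:
  fixes E :: "int \<Rightarrow> 'c::idom"
  assumes E: "character E" and inj: "\<And>i. E i = 1 \<Longrightarrow> i = 0"
    and mult: "multiplicative E m A" "multiplicative E m A'" and un: "unital A" "unital A'"
    and agree: "agree (deg w) A A'" and w: "w = ray n v" "n \<noteq> 0" "w \<noteq> 0"
    and u0: "pairing v u0 = 1" "A u0 w = A' u0 w"
  shows "A u w = A' u w"
proof -
  define \<delta> where "\<delta> u = A u w - A' u w" for u
  have add: "\<delta> (u + u') = \<delta> u * E (int (fst w) * snd u') + \<delta> u' * E (fst u * int (snd w))" for u u'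
  proof -
    let ?\<gamma> = "\<lambda>p r. fst u * int (snd r) + int (fst p) * snd u' + int (m * fst p * snd r)"
    let ?t = "\<lambda>(p, r). A u p * A u' r * E (?\<gamma> p r) - A' u p * A' u' r * E (?\<gamma> p r)"
    have "\<delta> (u + u') = sum ?t (splits w)"
      by (simp only: \<delta>_def multiplicativeD[OF mult(1)] multiplicativeD[OF mult(2)] sum_subtractf case_prod_unfold)
    also have "\<dots> = ?t (0, w) + ?t (w, 0)"
      unfolding prod.case
    proof (rule sum_splits_ends[OF finite_splits_vector w(3)])
      fix p r assume "p + r = w" "p \<noteq> 0" "r \<noteq> 0"
      then have "deg p < deg w" "deg r < deg w" by (simp_all add: deg_less)
      then show "A u p * A u' r * E (?\<gamma> p r) - A' u p * A' u' r * E (?\<gamma> p r) = 0"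
        by (simp add: agreeD[OF agree])
    qed
    also have "\<dots> = \<delta> u * E (int (fst w) * snd u') + \<delta> u' * E (fst u * int (snd w))"
      by (simp add: unitalD[OF un(1)] unitalD[OF un(2)] \<delta>_def algebra_simps)
    finally show ?thesis .
  qed
  have \<delta>0: "\<delta> u0 = 0" using u0(2) by (simp add: \<delta>_def)
  have "\<delta> u * E (int (fst w) * snd u0) = \<delta> u * E (fst u0 * int (snd w))"
    using add[of u u0] add[of u0 u] by (simp add: \<delta>0 add.commute)
  moreover have "E (int (fst w) * snd u0) \<noteq> E (fst u0 * int (snd w))"
  proof
    assume eq: "E (int (fst w) * snd u0) = E (fst u0 * int (snd w))"
    have "int (fst w) * snd u0 - fst u0 * int (snd w) = int n * pairing v u0"
      by (simp add: w(1) ray_def pairing_def algebra_simps)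
    then have n: "int (fst w) * snd u0 + - (fst u0 * int (snd w)) = int n" using u0 by simp
    have "E (int n) = E (int (fst w) * snd u0) * E (- (fst u0 * int (snd w)))"
      unfolding characterD[OF E, symmetric] n ..
    also have "\<dots> = 1"
      unfolding eq characterD[OF E, symmetric] by (simp add: character_0[OF E])
    finally show False using inj w(2) by force
  qed
  ultimately have "\<delta> u = 0" by simp
  then show ?thesis by (simp add: \<delta>_def)
qed

section \<open>Ordered factorizations\<close>

definition dirs :: "nat \<Rightarrow> (nat \<times> nat) set" where
  "dirs N = {v. primitive v \<and> deg v \<le> N}"

lemma finite_dirs: "finite (dirs N)"
  by (rule finite_subset[where B = "{..N} \<times> {..N}"]) (auto simp: dirs_def deg_def)

lemma steeper_iff: "steeper v w \<longleftrightarrow> fst v * snd w < fst w * snd v"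
  by (simp add: steeper_def case_prod_unfold mult.commute)

lemma sorted_wrt_unique:
  assumes asym: "\<And>x y. R x y \<Longrightarrow> \<not> R y x"
    and "sorted_wrt R xs" "sorted_wrt R ys" "set xs = set ys"
  shows "xs = ys"
  using assms(2-)
proof (induction xs arbitrary: ys)
  case (Cons x xs)
  then obtain y ys' where ys: "ys = y # ys'" by (cases ys) auto
  have "x = y"
  proof (rule ccontr)
    assume "x \<noteq> y"
    then have "x \<in> set ys'" "y \<in> set xs" using Cons.prems ys by auto
    then have "R x y" "R y x" using Cons.prems ys by auto
    then show False using asym by blast
  qed
  moreover have "\<not> R z z" for z using asym by blast
  then have "x \<notin> set xs" "y \<notin> set ys'" using Cons.prems ys by auto
  ultimately have "set xs = set ys'" using Cons.prems(3) ys by auto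
  then show ?case using Cons ys \<open>x = y\<close> by auto
qed simp

lemma steeper_linear:
  assumes "primitive v" "primitive w" "v \<noteq> w"
  shows "steeper v w \<or> steeper w v"
proof (rule ccontr)
  assume "\<not> ?thesis"
  then have eq: "fst v * snd w = fst w * snd v" by (simp add: steeper_iff)
  have "fst v = fst w \<and> snd v = snd w"
    using coprime_crossproduct_nat[of "fst v" "snd v" "fst w" "snd w"] assms(1,2) eq
    by (simp add: primitive_def mult.commute)
  then show False using assms(3) by (simp add: prod_eq_iff)
qed

lemma steeper_trans:
  assumes "primitive u" "primitive v" "primitive w" "steeper u v" "steeper v w"
  shows "steeper u w"
proof -
  have 1: "fst u * snd v < fst v * snd u" and 2: "fst v * snd w < fst w * snd v"
    using assms by (simp_all add: steeper_iff)
  have "fst u * snd v * snd w \<le> fst v * snd u * snd w"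
    using 1 by (intro mult_le_mono1) simp
  also have "\<dots> = fst v * snd w * snd u" by simp
  also have "\<dots> < fst w * snd v * snd u" using 1 2 by (intro mult_strict_right_mono) (auto intro: Nat.gr0I)
  finally have lt: "snd v * (fst u * snd w) < snd v * (fst w * snd u)" by (simp only: mult_ac)
  show ?thesis
    unfolding steeper_iff using lt by (rule mult_left_less_imp_less) simp
qed

lemma sorted_dirs_exist:
  assumes "finite S" "\<forall>v\<in>S. primitive v"
  shows "\<exists>ps. sorted_wrt steeper ps \<and> set ps = S"
  using assms
proof (induction S rule: finite_induct)
  case (insert v S)
  then obtain ps where ps: "sorted_wrt steeper ps" "set ps = S" by auto
  let ?qs = "filter (\<lambda>w. steeper w v) ps @ v # filter (\<lambda>w. steeper v w) ps"
  have "set ?qs = insert v S"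
    using steeper_linear[of v] insert ps by auto
  moreover have "sorted_wrt steeper ?qs"
    using ps insert.prems steeper_trans[of _ v]
    by (auto simp: sorted_wrt_append sorted_wrt_filter)
  ultimately show ?case by blast
qed simp

text \<open>
  The finitely many slopes that matter up to a given degree, in decreasing order; this order is unique.
\<close>

definition dir_list :: "nat \<Rightarrow> (nat \<times> nat) list" where
  "dir_list N = (SOME ps. sorted_wrt steeper ps \<and> set ps = dirs N)"

lemma dir_list: "sorted_wrt steeper (dir_list N)" "set (dir_list N) = dirs N"
  using someI_ex[OF sorted_dirs_exist[OF finite_dirs, of N]] by (auto simp: dir_list_def dirs_def)

lemma primitive_dir_list: "\<forall>v\<in>set (dir_list N). primitive v"
  by (simp add: dir_list dirs_def)

lemma distinct_dir_list: "distinct (dir_list N)"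
proof -
  have "sorted_wrt (\<noteq>) (dir_list N)"
    using dir_list(1) by (rule sorted_wrt_mono_rel[rotated]) (auto simp: steeper_iff)
  then show ?thesis by (simp add: distinct_conv_nth sorted_wrt_iff_nth_less) (metis nat_neq_iff)
qed

lemma filter_dir_list:
  assumes "M \<le> N"
  shows "filter (\<lambda>v. deg v < Suc M) (dir_list N) = dir_list M"
proof (rule sorted_wrt_unique[where R = steeper])
  show "sorted_wrt steeper (filter (\<lambda>v. deg v < Suc M) (dir_list N))"
    by (intro sorted_wrt_filter dir_list)
  show "set (filter (\<lambda>v. deg v < Suc M) (dir_list N)) = set (dir_list M)"
    using assms by (auto simp: dir_list dirs_def)
qed (auto simp: dir_list steeper_iff)

lemma agree_ordered_prod_dir_list:
  assumes "character E" "\<forall>v. g v $ 0 = 1" "M \<le> N"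
  shows "agree (Suc M) (ordered_prod E m g (dir_list N)) (ordered_prod E m g (dir_list M))"
  using agree_ordered_prod_filter[OF assms(1) primitive_dir_list assms(2), of "Suc M" m N]
    filter_dir_list[OF assms(3)] by simp

text \<open>
  Induction on the degree. In each degree the coefficient of \<open>z\<^sup>n\<close> in direction \<open>v\<close> is chosen so that the
  product is right on one monomial \<open>e\<^sub>u\<close> with \<open>pairing v u = 1\<close>; by rigidity it is then right on all of them.
  No division occurs, so the coefficients stay in the ring of the given endomorphism.
\<close>

theorem ordered_factorization_exists:
  fixes E :: "int \<Rightarrow> 'c::idom"
  assumes E: "character E" and inj: "\<And>i. E i = 1 \<Longrightarrow> i = 0"
    and \<Phi>: "multiplicative E m \<Phi>" "unital \<Phi>"
  shows "\<exists>g. (\<forall>v. g v $ 0 = 1) \<and> (\<forall>N. agree (Suc N) (ordered_prod E m g (dir_list N)) \<Phi>)"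
proof -
  define P where "P N g \<longleftrightarrow> (\<forall>v. g v $ 0 = 1) \<and> agree (Suc N) (ordered_prod E m g (dir_list N)) \<Phi>" for N g
  define Q where "Q N g g' \<longleftrightarrow> (\<forall>v n. primitive v \<longrightarrow> n * deg v \<le> N \<longrightarrow> g' v $ n = g v $ n)"
    for N and g g' :: "nat \<times> nat \<Rightarrow> 'c fps"
  have "\<exists>G. \<forall>N. P N (G N) \<and> Q N (G N) (G (Suc N))"
  proof (rule dependent_nat_choice)
    have "agree (Suc 0) (ordered_prod E m (\<lambda>_. 1) (dir_list 0)) \<Phi>"
      unfolding agree_def
      using unitalD[OF unital_ordered_prod[OF E _ primitive_dir_list]] unitalD[OF \<Phi>(2)] by simp
    then show "\<exists>g. P 0 g" by (auto simp: P_def intro!: exI[of _ "\<lambda>_. 1"])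
  next
    fix g N assume "P N g"
    then have g0: "\<forall>v. g v $ 0 = 1" and g: "agree (Suc N) (ordered_prod E m g (dir_list N)) \<Phi>"
      by (simp_all add: P_def)
    obtain u0 where u0: "\<And>v. primitive v \<Longrightarrow> pairing v (u0 v) = 1"
      using pairing_eq_1 by metis
    let ?L = "dir_list (Suc N)"
    let ?\<kappa> = "\<lambda>v n. int n * int (snd v) * fst (u0 v) + int (m * fst v * snd v * (n choose 2))"
    \<comment> \<open>The defect of the current product on \<open>e\<^bsub>u0 v\<^esub>\<close>, divided by the unit in \<open>ordered_prod_leading_ray\<close>.\<close>
    define c where "c v n = E (- ?\<kappa> v n) * (\<Phi> (u0 v) (ray n v) - ordered_prod E m g ?L (u0 v) (ray n v))" for v n
    define g' where "g' v = Abs_fps (\<lambda>n. if n * deg v = Suc N then g v $ n + c v n else g v $ n)" for v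
    have g'0: "\<forall>v. g' v $ 0 = 1" using g0 by (simp add: g'_def)
    have gg': "g' v $ n = g v $ n" if "n * deg v < Suc N" for v n
      using that by (simp add: g'_def)
    have "agree (Suc N) (ordered_prod E m g' ?L) (ordered_prod E m g ?L)"
      using gg' by (intro agree_ordered_prod E primitive_dir_list g0 g'0) simp
    moreover have "agree (Suc N) (ordered_prod E m g ?L) (ordered_prod E m g (dir_list N))"
      by (intro agree_ordered_prod_dir_list E g0) simp
    ultimately have low: "agree (Suc N) (ordered_prod E m g' ?L) \<Phi>"
      using g agree_trans by blast
    have top: "ordered_prod E m g' ?L u w = \<Phi> u w" if w: "deg w = Suc N" for u w
    proof -
      have w0: "w \<noteq> 0" using w by auto
      then obtain v n where v: "primitive v" and n: "n \<noteq> 0" and wr: "w = ray n v"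
        using ray_exists by blast
      have nv: "n * deg v = Suc N" using w wr by simp
      then have "deg v \<le> Suc N" using n by (cases n) auto
      then have vL: "v \<in> set ?L" using v by (simp add: dir_list dirs_def)
      have inv: "E (?\<kappa> v n) * E (- ?\<kappa> v n) = 1"
        unfolding characterD[OF E, symmetric] by (simp add: character_0[OF E])
      have "ordered_prod E m g' ?L (u0 v) (ray n v) - ordered_prod E m g ?L (u0 v) (ray n v) =
          E (?\<kappa> v n) * (g' v $ n - g v $ n)"
        using gg' nv by (intro ordered_prod_leading_ray E primitive_dir_list distinct_dir_list vL g0 g'0 n u0 v) simp
      moreover have "g' v $ n - g v $ n = c v n" by (simp add: g'_def nv)
      ultimately have "ordered_prod E m g' ?L (u0 v) w - ordered_prod E m g ?L (u0 v) w =
          \<Phi> (u0 v) w - ordered_prod E m g ?L (u0 v) w"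
        by (simp only: c_def mult.assoc[symmetric] inv mult_1_left wr)
      then have "ordered_prod E m g' ?L (u0 v) w = \<Phi> (u0 v) w" by simp
      moreover have "agree (deg w) (ordered_prod E m g' ?L) \<Phi>" using low w by simp
      ultimately show ?thesis
        using multiplicative_rigid[OF E inj multiplicative_ordered_prod[OF E g'0 primitive_dir_list] \<Phi>(1)
            unital_ordered_prod[OF E g'0 primitive_dir_list] \<Phi>(2) _ wr n w0 u0[OF v]] by blast
    qed
    have "agree (Suc (Suc N)) (ordered_prod E m g' ?L) \<Phi>"
      unfolding agree_def
    proof (intro allI impI)
      fix u w assume "deg w < Suc (Suc N)"
      then show "ordered_prod E m g' ?L u w = \<Phi> u w"
        using top[of w u] agreeD[OF low, of w u] by linarith
    qed
    then show "\<exists>g'. P (Suc N) g' \<and> Q N g g'"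
      using g'0 gg' by (auto simp: P_def Q_def intro!: exI[of _ g'])
  qed
  then obtain G where P: "\<And>N. P N (G N)" and Q: "\<And>N. Q N (G N) (G (Suc N))" by blast
  define g where "g v = Abs_fps (\<lambda>n. G (n * deg v) v $ n)" for v
  have stable: "G N v $ n = g v $ n" if "primitive v" "n * deg v \<le> N" for N v n
    using that(2)
  proof (induction N rule: dec_induct)
    case base
    then show ?case by (simp add: g_def)
  next
    case (step N)
    then show ?case using Q[of N] that(1) by (simp add: Q_def)
  qed
  have g0: "\<forall>v. g v $ 0 = 1" using P by (simp add: g_def P_def)
  have "agree (Suc N) (ordered_prod E m g (dir_list N)) \<Phi>" for N
  proof -
    have "agree (Suc N) (ordered_prod E m g (dir_list N)) (ordered_prod E m (G N) (dir_list N))"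
      using P[of N] stable by (intro agree_ordered_prod E primitive_dir_list g0) (auto simp: P_def dir_list dirs_def)
    then show ?thesis using P[of N] by (auto simp: P_def intro: agree_trans)
  qed
  then show ?thesis using g0 by blast
qed

text \<open>
  Unlike existence this holds for every \<open>q\<close>, in particular for \<open>q = 1\<close>, where it is applied.
\<close>

theorem ordered_factorization_unique:
  fixes E :: "int \<Rightarrow> 'c::comm_ring_1"
  assumes E: "character E"
    and g: "\<forall>v. g v $ 0 = 1" "\<forall>v. g' v $ 0 = 1"
    and eq: "\<And>N. agree (Suc N) (ordered_prod E m g (dir_list N)) (ordered_prod E m g' (dir_list N))"
    and v: "primitive v"
  shows "g v $ n = g' v $ n"
  using v
proof (induction "n * deg v" arbitrary: v n rule: less_induct)
  case less
  show ?case
  proof (cases "n = 0")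
    case False
    let ?L = "dir_list (n * deg v)"
    obtain u where u: "pairing v u = 1" using pairing_eq_1[OF less.prems] ..
    let ?\<kappa> = "int n * int (snd v) * fst u + int (m * fst v * snd v * (n choose 2))"
    have "deg v \<le> n * deg v" using False by (cases n) auto
    then have vL: "v \<in> set ?L" using less.prems by (simp add: dir_list dirs_def)
    have "ordered_prod E m g ?L u (ray n v) - ordered_prod E m g' ?L u (ray n v) = E ?\<kappa> * (g v $ n - g' v $ n)"
      using less.hyps primitive_dir_list
      by (intro ordered_prod_leading_ray E primitive_dir_list distinct_dir_list vL g False u) blast
    moreover have "ordered_prod E m g ?L u (ray n v) = ordered_prod E m g' ?L u (ray n v)"
      by (rule agreeD[OF eq]) simp
    ultimately have "E ?\<kappa> * (g v $ n - g' v $ n) = 0" by simp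
    then have "E (- ?\<kappa>) * (E ?\<kappa> * (g v $ n - g' v $ n)) = 0" by simp
    then have "E (- ?\<kappa> + ?\<kappa>) * (g v $ n - g' v $ n) = 0"
      by (simp only: characterD[OF E] mult.assoc)
    then show ?thesis by (simp add: character_0[OF E])
  qed (simp add: g)
qed

section \<open>Change of the coefficient ring\<close>

definition ring_hom :: "('a::comm_ring_1 \<Rightarrow> 'b::comm_ring_1) \<Rightarrow> bool" where
  "ring_hom h \<longleftrightarrow> h 1 = 1 \<and> (\<forall>x y. h (x + y) = h x + h y) \<and> (\<forall>x y. h (x * y) = h x * h y)"

context
  fixes h :: "'a::comm_ring_1 \<Rightarrow> 'b::comm_ring_1"
  assumes h: "ring_hom h"
begin

lemma hom_1: "h 1 = 1" and hom_add: "h (x + y) = h x + h y" and hom_mult: "h (x * y) = h x * h y"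
  using h by (simp_all add: ring_hom_def)

lemma hom_0: "h 0 = 0"
  using hom_add[of 0 0] by simp

lemma hom_minus: "h (- x) = - h x"
  using hom_add[of x "- x"] by (simp add: hom_0 minus_unique eq_neg_iff_add_eq_0 add.commute)

lemma hom_sum: "h (sum f S) = (\<Sum>x\<in>S. h (f x))"
  by (induction S rule: infinite_finite_induct) (simp_all add: hom_0 hom_add)

lemma hom_prod: "h (prod f S) = (\<Prod>x\<in>S. h (f x))"
  by (induction S rule: infinite_finite_induct) (simp_all add: hom_1 hom_mult)

lemma hom_power: "h (x ^ n) = h x ^ n"
  by (induction n) (simp_all add: hom_1 hom_mult)

lemma hom_of_nat: "h (of_nat n) = of_nat n"
  by (induction n) (simp_all add: hom_1 hom_0 hom_add)

end

definition map_fps :: "('a \<Rightarrow> 'b) \<Rightarrow> 'a fps \<Rightarrow> 'b fps" where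
  "map_fps h f = Abs_fps (\<lambda>n. h (f $ n))"

lemma map_fps_nth [simp]: "map_fps h f $ n = h (f $ n)"
  by (simp add: map_fps_def)

lemma ring_hom_map_fps: "ring_hom h \<Longrightarrow> ring_hom (map_fps h)"
  unfolding ring_hom_def[of "map_fps h"]
  by (auto intro!: fps_ext simp: hom_0 hom_1 hom_add hom_mult hom_sum fps_mult_nth)

lemma map_fps_cocycle:
  assumes h: "ring_hom h" and E: "character E" and g: "g $ 0 = 1"
  shows "map_fps h (cocycle E g j) = cocycle (\<lambda>i. h (E i)) (map_fps h g) j"
proof -
  note hm = ring_hom_map_fps[OF h]
  have tw: "map_fps h (twist E i g) = twist (\<lambda>i. h (E i)) i (map_fps h g)" for i
    by (rule fps_ext) (simp add: hom_mult[OF h])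
  have "(\<Prod>i\<in>I. twist E i g) dvd 1" for I :: "int set"
    using prod_twist_nth_0[OF E g] by (rule fps_unit)
  then show ?thesis
    unfolding cocycle_def
    by (auto simp: hom_prod[OF hm] tw unit_powi_hom[OF _ hom_1[OF hm] hom_mult[OF hm]])
qed

lemma hom_comp:
  assumes h: "ring_hom h"
  shows "(\<lambda>u w. h (kcomp m A B u w)) = kcomp m (\<lambda>u w. h (A u w)) (\<lambda>u w. h (B u w))"
  by (intro ext) (simp add: kcomp_def hom_sum[OF h] hom_mult[OF h] case_prod_unfold)

lemma hom_slope_kernel:
  assumes h: "ring_hom h" and E: "character E" and g: "g $ 0 = 1"
  shows "(\<lambda>u w. h (slope_kernel E m v g u w)) = slope_kernel (\<lambda>i. h (E i)) m v (map_fps h g)"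
proof (intro ext)
  fix u w
  have "h (cocycle E g j $ n) = cocycle (\<lambda>i. h (E i)) (map_fps h g) j $ n" for j n
    by (simp flip: map_fps_cocycle[OF assms])
  then show "h (slope_kernel E m v g u w) = slope_kernel (\<lambda>i. h (E i)) m v (map_fps h g) u w"
    by (simp add: slope_kernel_def Let_def hom_0[OF h] hom_mult[OF h])
qed

lemma hom_ordered_prod:
  assumes h: "ring_hom h" and E: "character E" and g: "\<forall>v. g v $ 0 = 1"
  shows "(\<lambda>u w. h (ordered_prod E m g ps u w)) = ordered_prod (\<lambda>i. h (E i)) m (\<lambda>v. map_fps h (g v)) ps"
proof (induction ps)
  case Nil
  show ?case by (intro ext) (simp add: id_kernel_def hom_0[OF h] hom_1[OF h])
next
  case (Cons v ps)
  then show ?case using g by (simp add: hom_comp[OF h] hom_slope_kernel[OF h E])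
qed

text \<open>
  The additive extension of a map given on monomials. Ring homomorphisms out of Laurent polynomial rings
  are obtained from it: the evaluation of \<open>q\<close>, and the substitution of monomials.
\<close>

definition pm_lift :: "('k \<Rightarrow> 'a \<Rightarrow> 'b) \<Rightarrow> ('k \<Rightarrow>\<^sub>0 'a::zero) \<Rightarrow> 'b::comm_monoid_add" where
  "pm_lift F p = (\<Sum>k\<in>keys p. F k (lookup p k))"

lemma pm_lift_superset:
  assumes "finite S" "keys p \<subseteq> S" "\<And>k. F k 0 = 0"
  shows "pm_lift F p = (\<Sum>k\<in>S. F k (lookup p k))"
  unfolding pm_lift_def using assms
  by (intro sum.mono_neutral_left) (auto simp: in_keys_iff)

lemma pm_lift_single: "(\<And>k. F k 0 = 0) \<Longrightarrow> pm_lift F (single k a) = F k a"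
  by (subst pm_lift_superset[where S = "{k}"]) auto

lemma pm_lift_add:
  assumes "\<And>k. F k 0 = 0" "\<And>k a b. F k (a + b) = F k a + F k b"
  shows "pm_lift F (p + q) = pm_lift F p + pm_lift F q"
proof -
  let ?S = "keys p \<union> keys q"
  have "pm_lift F r = (\<Sum>k\<in>?S. F k (lookup r k))"
    if "keys r \<subseteq> ?S" for r
    using that assms(1) by (intro pm_lift_superset) auto
  then show ?thesis
    using keys_add[of p q] by (simp add: lookup_add assms(2) sum.distrib)
qed

lemma pm_induct [case_names single add]:
  fixes p :: "'k \<Rightarrow>\<^sub>0 'a::comm_monoid_add"
  assumes single: "\<And>k a. P (single k a)" and add: "\<And>p q. P p \<Longrightarrow> P q \<Longrightarrow> P (p + q)"
  shows "P p"
proof -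
  let ?f = "\<lambda>k. single k (lookup p k)"
  have "p = (\<Sum>k\<in>keys p. ?f k)"
  proof (rule poly_mapping_eqI)
    fix k
    have "lookup (\<Sum>k\<in>keys p. ?f k) k =
      (\<Sum>k'\<in>keys p. if k' = k then lookup p k else 0)"
      unfolding lookup_sum by (rule sum.cong) (auto simp: lookup_single)
    then show "lookup p k = lookup (\<Sum>k\<in>keys p. ?f k) k"
      by (simp add: in_keys_iff)
  qed
  moreover have "P (\<Sum>k\<in>S. ?f k)" for S
    by (induction S rule: infinite_finite_induct)
      (use single[of _ 0] in \<open>auto intro: add single\<close>)
  ultimately show ?thesis by metis
qed

lemma ring_hom_pm_lift:
  fixes F :: "'k::comm_monoid_add \<Rightarrow> 'a::comm_ring_1 \<Rightarrow> 'b::comm_ring_1"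
  assumes add: "\<And>k a b. F k (a + b) = F k a + F k b"
    and mult: "\<And>k l a b. F (k + l) (a * b) = F k a * F l b" and one: "F 0 1 = 1"
  shows "ring_hom (pm_lift F)"
proof -
  have zero: "F k 0 = 0" for k using add[of k 0 0] by simp
  note lift_add = pm_lift_add[of F, OF zero add]
  have single_mult: "pm_lift F (single k a * q) = F k a * pm_lift F q" for k a q
    by (induction q rule: pm_induct)
      (simp_all add: mult_single pm_lift_single[of F, OF zero] mult distrib_left lift_add)
  have "pm_lift F (p * q) = pm_lift F p * pm_lift F q" for p q
    by (induction p rule: pm_induct)
      (simp_all add: single_mult pm_lift_single[of F, OF zero] distrib_right lift_add)
  moreover have "pm_lift F 1 = 1"
    using pm_lift_single[of F 0 1, OF zero] one by simp
  ultimately show ?thesis by (simp add: ring_hom_def lift_add)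
qed

text \<open>
  The ring \<open>\<int>[q, q\<^sup>-\<^sup>1]\<close>, an integral domain in which \<open>q\<close> is not a root of unity.
\<close>

type_synonym qlaurent = "int \<Rightarrow>\<^sub>0 int"

definition qmon :: "int \<Rightarrow> qlaurent" where
  "qmon i = single i 1"

definition qeval :: "complex \<Rightarrow> qlaurent \<Rightarrow> complex" where
  "qeval z = pm_lift (\<lambda>i c. of_int c * z powi i)"

lemma ring_hom_qeval: "z \<noteq> 0 \<Longrightarrow> ring_hom (qeval z)"
  unfolding qeval_def
  by (rule ring_hom_pm_lift) (simp_all add: algebra_simps power_int_add)

lemma qeval_single: "qeval z (single i c) = of_int c * z powi i"
  by (simp add: qeval_def pm_lift_single)

lemma qeval_qmon [simp]: "qeval z (qmon i) = z powi i"
  by (simp add: qmon_def qeval_single)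

lemma character_qmon: "character qmon"
  by (simp add: character_def qmon_def mult_single)

lemma qmon_eq_1: "qmon i = 1 \<Longrightarrow> i = 0"
  unfolding qmon_def by (metis keys_one keys_single singleton_inject zero_neq_one)

lemma character_powi: "z \<noteq> 0 \<Longrightarrow> character (\<lambda>i. z powi i :: complex)"
  by (simp add: character_def power_int_add)

section \<open>Roots of unity\<close>

definition times_vec :: "nat \<Rightarrow> int \<times> int \<Rightarrow> int \<times> int" where
  "times_vec d u = (int d * fst u, int d * snd u)"

text \<open>
  At a \<open>d\<close>-th root of unity the monomials \<open>e\<^bsub>d u\<^esub>\<close> span a commutative subring. Its basis is indexed by \<open>u\<close>
  again.
\<close>

definition on_multiples :: "nat \<Rightarrow> 'c kernel \<Rightarrow> 'c kernel" where
  "on_multiples d A u w = A (times_vec d u) (ray d w)"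

definition preserves_multiples :: "nat \<Rightarrow> 'c::zero kernel \<Rightarrow> bool" where
  "preserves_multiples d A \<longleftrightarrow> (\<forall>u w. A (times_vec d u) w \<noteq> 0 \<longrightarrow> (\<exists>w'. w = ray d w'))"

lemma preservesD: "preserves_multiples d A \<Longrightarrow> A (times_vec d u) w \<noteq> 0 \<Longrightarrow> \<exists>w'. w = ray d w'"
  unfolding preserves_multiples_def by blast

lemma shift_times_vec: "shift m (times_vec d u) (ray d w) = times_vec d (shift m u w)"
  by (simp add: shift_def times_vec_def ray_def algebra_simps)

lemma ray_plus: "ray d (p + r) = ray d p + ray d r"
  by (simp add: ray_def algebra_simps)

lemma ray_inj: "d \<noteq> 0 \<Longrightarrow> ray d p = ray d r \<longleftrightarrow> p = r"
  by (simp add: ray_def prod_eq_iff)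

lemma on_multiples_comp:
  assumes d: "d \<noteq> 0" and A: "preserves_multiples d A" and B: "preserves_multiples d B"
  shows "on_multiples d (kcomp m A B) = kcomp m (on_multiples d A) (on_multiples d B)"
proof (intro ext)
  fix u w
  let ?f = "\<lambda>(p, r). B (times_vec d u) p * A (shift m (times_vec d u) p) r"
  let ?h = "\<lambda>(p, r). (ray d p, ray d r)"
  have "on_multiples d (kcomp m A B) u w = sum ?f (splits (ray d w))"
    by (simp add: on_multiples_def kcomp_def)
  also have "\<dots> = sum ?f (?h ` splits w)"
  proof (rule sum.mono_neutral_right)
    show "?h ` splits w \<subseteq> splits (ray d w)"
    proof (rule image_subsetI)
      fix z assume "z \<in> splits w"
      then show "?h z \<in> splits (ray d w)" by (cases z) (simp add: splits_def flip: ray_plus)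
    qed
    show "\<forall>z\<in>splits (ray d w) - ?h ` splits w. ?f z = 0"
    proof
      fix z assume z: "z \<in> splits (ray d w) - ?h ` splits w"
      obtain p r where pr: "z = (p, r)" by (cases z)
      show "?f z = 0"
      proof (rule ccontr)
        assume "?f z \<noteq> 0"
        then have B': "B (times_vec d u) p \<noteq> 0" and A': "A (shift m (times_vec d u) p) r \<noteq> 0" by (auto simp: pr)
        then obtain p' where p: "p = ray d p'" using preservesD[OF B] by blast
        obtain r' where r: "r = ray d r'" using preservesD[OF A A'[unfolded p shift_times_vec]] by blast
        have "p' + r' = w" using z d by (simp add: pr p r splits_def ray_inj flip: ray_plus)
        then have "z \<in> ?h ` splits w" by (auto simp: pr p r splits_def)
        then show False using z by blast
      qed
    qed
  qed simp
  also have "\<dots> = kcomp m (on_multiples d A) (on_multiples d B) u w"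
    by (subst sum.reindex)
      (auto simp: inj_on_def ray_inj[OF d] kcomp_def on_multiples_def shift_times_vec case_prod_unfold)
  finally show "on_multiples d (kcomp m A B) u w = kcomp m (on_multiples d A) (on_multiples d B) u w" .
qed

lemma preserves_multiples_comp:
  assumes A: "preserves_multiples d A" and B: "preserves_multiples d B"
  shows "preserves_multiples d (kcomp m A B)"
  unfolding preserves_multiples_def
proof (intro allI impI)
  fix u w assume "kcomp m A B (times_vec d u) w \<noteq> 0"
  then obtain z where z: "z \<in> splits w" "(case z of (p, r) \<Rightarrow> B (times_vec d u) p * A (shift m (times_vec d u) p) r) \<noteq> 0"
    unfolding kcomp_def by (meson sum.neutral)
  obtain p r where pr: "z = (p, r)" by (cases z)
  have B': "B (times_vec d u) p \<noteq> 0" and A': "A (shift m (times_vec d u) p) r \<noteq> 0" using z by (auto simp: pr)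
  then obtain p' where p: "p = ray d p'" using preservesD[OF B] by blast
  obtain r' where r: "r = ray d r'" using preservesD[OF A A'[unfolded p shift_times_vec]] by blast
  have "w = ray d (p' + r')" using z by (simp add: pr p r splits_def ray_plus)
  then show "\<exists>w'. w = ray d w'" ..
qed

lemma preserves_multiples_id: "preserves_multiples d id_kernel"
proof -
  have "(0 :: nat \<times> nat) = ray d 0" by (simp add: ray_def zero_prod_def)
  then show ?thesis unfolding preserves_multiples_def id_kernel_def by metis
qed

lemma on_multiples_id: "d \<noteq> 0 \<Longrightarrow> on_multiples d id_kernel = id_kernel"
  by (intro ext) (auto simp: on_multiples_def id_kernel_def ray_def prod_eq_iff)

lemma sparse_mult_nth:
  fixes F G :: "'c::comm_ring_1 fps"
  assumes d: "d \<noteq> 0" and sparse: "\<And>n. \<not> d dvd n \<Longrightarrow> F $ n = 0"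
  shows "(F * G) $ (d * n) = (\<Sum>i=0..n. F $ (d * i) * G $ (d * (n - i)))"
proof -
  have "(F * G) $ (d * n) = (\<Sum>i\<in>{0..d * n}. F $ i * G $ (d * n - i))"
    by (simp add: fps_mult_nth)
  also have "\<dots> = (\<Sum>i\<in>(\<lambda>i. d * i) ` {0..n}. F $ i * G $ (d * n - i))"
  proof (rule sum.mono_neutral_right)
    show "\<forall>i\<in>{0..d * n} - (\<lambda>i. d * i) ` {0..n}. F $ i * G $ (d * n - i) = 0"
    proof
      fix i assume i: "i \<in> {0..d * n} - (\<lambda>i. d * i) ` {0..n}"
      have "\<not> d dvd i"
      proof
        assume "d dvd i"
        then obtain k where "i = d * k" ..
        then show False using i d by auto
      qed
      then show "F $ i * G $ (d * n - i) = 0" by (simp add: sparse)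
    qed
  qed auto
  also have "\<dots> = (\<Sum>i=0..n. F $ (d * i) * G $ (d * (n - i)))"
    using d by (subst sum.reindex) (auto simp: inj_on_def right_diff_distrib')
  finally show ?thesis .
qed

text \<open>
  The last assumption says that \<open>q\<close> has multiplicative order exactly \<open>d\<close>.
\<close>

locale root_of_unity_character =
  fixes E :: "int \<Rightarrow> 'c::idom" and d :: nat
  assumes E: "character E" and d: "d \<noteq> 0"
    and E_1_iff: "\<And>i. E i = 1 \<longleftrightarrow> int d dvd i"
begin

lemma E_multiple [simp]: "E (int d * i) = 1"
  by (simp add: E_1_iff)

text \<open>
  The cocycle at \<open>d j\<close> is invariant under \<open>z \<mapsto> q z\<close>, because it can be extended by one factor on either
  side, and the two factors are equal as \<open>q\<^sup>d = 1\<close>.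
\<close>

lemma cocycle_sparse:
  assumes g: "g $ 0 = 1" and n: "\<not> d dvd n"
  shows "cocycle E g (int d * j) $ n = 0"
proof -
  let ?C = "cocycle E g (int d * j)"
  have "g * twist E 1 ?C = cocycle E g (1 + int d * j)"
    using cocycle_add[OF E g, of 1 "int d * j"] by (simp add: cocycle_1[OF E g])
  also have "\<dots> = ?C * twist E (int d * j) g"
    using cocycle_Suc[OF E g, of "int d * j"] by (simp add: add.commute)
  also have "twist E (int d * j) g = g"
    by (rule fps_ext) (simp add: mult.assoc)
  finally have "twist E 1 ?C * g = ?C * g" by (simp add: mult.commute)
  then have "twist E 1 ?C = ?C" using fps_unit[OF g] unit_cancel by blast
  then have "E (int n) * ?C $ n = ?C $ n" by (metis mult_1 twist_nth)
  moreover have "E (int n) \<noteq> 1" using n by (simp add: E_1_iff)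
  ultimately show ?thesis by (simp add: mult_cancel_right1)
qed

text \<open>
  The series by which the restricted automorphism acts. Up to the sign from normal ordering it is the series
  \<open>h\<close> with \<open>\<Prod>\<^bsub>i<d\<^esub> g(q\<^sup>iz) = h(z\<^sup>d)\<close>.
\<close>

definition residual :: "nat \<Rightarrow> 'c fps \<Rightarrow> 'c fps" where
  "residual e g = Abs_fps (\<lambda>n. E (int (e * (d choose 2))) ^ n * cocycle E g (int d) $ (d * n))"

lemma residual_nth_0: "g $ 0 = 1 \<Longrightarrow> residual e g $ 0 = 1"
  by (simp add: residual_def cocycle_nth_0[OF E])

lemma unit_powi_residual:
  assumes g: "g $ 0 = 1"
  shows "unit_powi (residual e g) j $ n =
    E (int (e * (d choose 2))) ^ n * cocycle E g (int d * j) $ (d * n)"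
proof -
  let ?\<mu> = "E (int (e * (d choose 2)))"
  define B where "B j = Abs_fps (\<lambda>n. ?\<mu> ^ n * cocycle E g (int d * j) $ (d * n))" for j
  have "B j = unit_powi (residual e g) j"
  proof (rule unit_powi_unique)
    show "residual e g dvd 1" using residual_nth_0[OF g] by (rule fps_unit)
    show "B 0 = 1"
      using d by (intro fps_ext) (auto simp: B_def)
    fix k
    have "twist E (int d * k) (cocycle E g (int d)) = cocycle E g (int d)"
      by (rule fps_ext) (simp add: mult.assoc)
    then have split: "cocycle E g (int d * (k + 1)) = cocycle E g (int d * k) * cocycle E g (int d)"
      using cocycle_add[OF E g, of "int d * k" "int d"] by (simp add: distrib_left)
    show "B (k + 1) = B k * residual e g"
    proof (rule fps_ext)
      fix n
      let ?F = "cocycle E g (int d * k)" and ?G = "cocycle E g (int d)"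
      have "(?F * ?G) $ (d * n) = (\<Sum>i=0..n. ?F $ (d * i) * ?G $ (d * (n - i)))"
        using cocycle_sparse[OF g] by (rule sparse_mult_nth[OF d])
      then have "B (k + 1) $ n = (\<Sum>i=0..n. ?\<mu> ^ n * (?F $ (d * i) * ?G $ (d * (n - i))))"
        unfolding B_def split fps_nth_Abs_fps by (simp only: sum_distrib_left)
      also have "\<dots> = (\<Sum>i=0..n. B k $ i * residual e g $ (n - i))"
      proof (rule sum.cong[OF refl])
        fix i assume "i \<in> {0..n}"
        then have "?\<mu> ^ n = ?\<mu> ^ i * ?\<mu> ^ (n - i)" by (simp flip: power_add)
        then show "?\<mu> ^ n * (?F $ (d * i) * ?G $ (d * (n - i))) = B k $ i * residual e g $ (n - i)"
          unfolding B_def residual_def fps_nth_Abs_fps by (simp only: mult_ac)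
      qed
      finally have "B (k + 1) $ n = (\<Sum>i=0..n. B k $ i * residual e g $ (n - i))" .
      then show "B (k + 1) $ n = (B k * residual e g) $ n" by (simp only: fps_mult_nth)
    qed
  qed
  then have "B j $ n = unit_powi (residual e g) j $ n" by simp
  then show ?thesis by (simp only: B_def fps_nth_Abs_fps)
qed

lemma E_choose: "E (int (e * (d * n choose 2))) = E (int (e * (d choose 2))) ^ n"
proof (induction n)
  case (Suc n)
  have split: "int (e * (d * Suc n choose 2)) =
      (int (e * (d * n choose 2)) + int (e * (d choose 2))) + int d * int (e * (d * n))"
    using choose_2_add[of "d * n" d] by (simp add: algebra_simps)
  show ?case
    unfolding split characterD[OF E] E_multiple Suc by (simp only: mult_1_right power_Suc2)
qed (simp add: character_0[OF E] numeral_2_eq_2)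

lemma pairing_times_vec: "pairing v (times_vec d u) = int d * pairing v u"
  by (simp add: pairing_def times_vec_def algebra_simps)

lemma ray_ray: "ray d (ray n v) = ray (d * n) v"
  by (simp add: ray_def algebra_simps)

lemma preserves_multiples_slope_kernel:
  assumes v: "primitive v" and g: "g $ 0 = 1"
  shows "preserves_multiples d (slope_kernel E m v g)"
  unfolding preserves_multiples_def
proof (intro allI impI)
  fix u w assume nz: "slope_kernel E m v g (times_vec d u) w \<noteq> 0"
  then obtain n where n: "w = ray n v" using slope_kernel_not_ray by metis
  then have "cocycle E g (int d * pairing v u) $ n \<noteq> 0"
    using nz by (auto simp: n slope_kernel_ray[OF v] pairing_times_vec)
  then obtain k where "n = d * k" using cocycle_sparse[OF g] by (metis dvdE)
  then have "w = ray d (ray k v)" by (simp add: n ray_ray)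
  then show "\<exists>w'. w = ray d w'" ..
qed

lemma on_multiples_slope_kernel:
  assumes v: "primitive v" and g: "g $ 0 = 1"
  shows "on_multiples d (slope_kernel E m v g) = slope_kernel (\<lambda>_. 1) m v (residual (m * fst v * snd v) g)"
proof (intro ext)
  fix u w
  let ?e = "m * fst v * snd v"
  show "on_multiples d (slope_kernel E m v g) u w = slope_kernel (\<lambda>_. 1) m v (residual ?e g) u w"
  proof (cases "\<exists>n. w = ray n v")
    case True
    then obtain n where n: "w = ray n v" ..
    have "E (int (d * n) * int (snd v) * fst (times_vec d u) + int (m * fst v * snd v * (d * n choose 2))) =
      E (int (?e * (d choose 2))) ^ n"
    proof -
      have "int (d * n) * int (snd v) * fst (times_vec d u) = int d * (int n * int (snd v) * fst (times_vec d u))" by simp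
      then have "E (int (d * n) * int (snd v) * fst (times_vec d u)) = 1" by (simp only: E_multiple)
      then show ?thesis by (simp only: characterD[OF E] E_choose mult_1_left)
    qed
    then have "on_multiples d (slope_kernel E m v g) u w = unit_powi (residual ?e g) (pairing v u) $ n"
      unfolding on_multiples_def n ray_ray slope_kernel_ray[OF v] pairing_times_vec unit_powi_residual[OF g] by simp
    then show ?thesis
      unfolding n slope_kernel_ray[OF v] cocycle_trivial[OF residual_nth_0[OF g]] by simp
  next
    case False
    have "ray d w \<noteq> ray k v" for k
    proof
      assume k: "ray d w = ray k v"
      have "d * fst w = k * fst v" "d * snd w = k * snd v" using k by (simp_all add: ray_def)
      then have "k = gcd (d * fst w) (d * snd w)" using gcd_ray[OF v, of k] by (simp add: ray_def)
      then have "k = d * gcd (fst w) (snd w)" by (simp add: gcd_mult_distrib_nat)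
      then have "ray d w = ray d (ray (gcd (fst w) (snd w)) v)" using k by (simp add: ray_ray)
      then show False using False d by (simp add: ray_inj)
    qed
    then have "slope_kernel E m v g (times_vec d u) (ray d w) = 0" by (rule slope_kernel_not_ray)
    moreover have "slope_kernel (\<lambda>_. 1) m v (residual ?e g) u w = 0"
      using False by (intro slope_kernel_not_ray) auto
    ultimately show ?thesis by (simp add: on_multiples_def)
  qed
qed

lemma on_multiples_ordered_prod:
  assumes "\<forall>v\<in>set ps. primitive v" "\<forall>v. g v $ 0 = 1"
  shows "preserves_multiples d (ordered_prod E m g ps) \<and> on_multiples d (ordered_prod E m g ps) =
    ordered_prod (\<lambda>_. 1) m (\<lambda>v. residual (m * fst v * snd v) (g v)) ps"
  using assms(1)
proof (induction ps)
  case (Cons v ps)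
  then have "preserves_multiples d (slope_kernel E m v (g v))" using assms(2) by (simp add: preserves_multiples_slope_kernel)
  then show ?case
    using Cons assms(2) d by (simp add: preserves_multiples_comp on_multiples_comp on_multiples_slope_kernel)
qed (use d in \<open>simp add: on_multiples_id preserves_multiples_id\<close>)

end

context root_of_unity_character
begin

lemma E_half:
  assumes "d = 2 * k"
  shows "E (int k) = - 1"
proof -
  have "E (int k) * E (int k) = E (int d * 1)"
    unfolding characterD[OF E, symmetric] using assms by simp
  then have "E (int k) * E (int k) = 1" by (simp only: E_multiple)
  then have "(E (int k) - 1) * (E (int k) + 1) = 0" by (simp add: algebra_simps)
  moreover have "E (int k) \<noteq> 1"
    using d assms by (auto simp: E_1_iff dest: dvd_imp_le)
  ultimately show ?thesis by (simp add: eq_neg_iff_add_eq_0)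
qed

lemma E_choose_odd: "E (int (d choose 2)) * (- 1) ^ d = - 1"
proof (cases "even d")
  case True
  then obtain k where k: "d = 2 * k" by blast
  have "d choose 2 = k * (d - 1)" by (simp add: choose_two k)
  then have "int (d choose 2) + int k = int d * int k"
    using d k by (simp add: of_nat_diff algebra_simps)
  then have "E (int (d choose 2)) * E (int k) = 1"
    unfolding characterD[OF E, symmetric] by (simp only: E_multiple)
  then have "- E (int (d choose 2)) = 1" by (simp add: E_half[OF k])
  then have "E (int (d choose 2)) = - 1" by (metis minus_minus)
  then show ?thesis using True by simp
next
  case False
  then obtain k where k: "d = 2 * k + 1" by (metis oddE)
  have "d choose 2 = d * k" by (simp add: choose_two k)
  then show ?thesis using False by simp
qed

text \<open>
  The sign left by normal ordering at the roots of unity of even order, absorbed by the substitution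
  \<open>z \<mapsto> (-1)\<^sup>e z\<close>. With \<open>e = m a b\<close> this is the source of the sign in the final product formula.
\<close>

lemma E_sign: "E (int (e * (d choose 2))) * ((- 1) ^ e) ^ d = (- 1) ^ e"
proof -
  have "E (int (e * (d choose 2))) = E (int (d choose 2)) ^ e"
    by (induction e) (simp_all add: character_0[OF E] characterD[OF E] algebra_simps)
  then have "E (int (e * (d choose 2))) * ((- 1) ^ e) ^ d = (E (int (d choose 2)) * (- 1) ^ d) ^ e"
    by (simp add: power_mult_distrib mult.commute flip: power_mult)
  then show ?thesis by (simp add: E_choose_odd)
qed

end

text \<open>
  The product to be factored. It is normalized with \<open>1 - z\<close> rather than \<open>1 + z\<close>, since
  \<open>\<Prod>\<^bsub>i<d\<^esub> (1 - \<zeta>\<^sup>iz) = 1 - z\<^sup>d\<close> has the same shape for every \<open>d\<close>; the original signs are restored by \<open>t \<mapsto> -t\<close>.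
\<close>

definition base_kernel :: "(int \<Rightarrow> 'c::comm_ring_1) \<Rightarrow> nat \<Rightarrow> 'c kernel" where
  "base_kernel E m = kcomp m (slope_kernel E m (1, 0) (1 - fps_X)) (slope_kernel E m (0, 1) (1 - fps_X))"

lemma primitive_axes [simp]: "primitive (1, 0)" "primitive (0, 1)" "primitive (Suc 0, 0)" "primitive (0, Suc 0)"
  by (simp_all add: primitive_def)

lemma unital_base_kernel: "character E \<Longrightarrow> unital (base_kernel E m)"
  unfolding base_kernel_def by (intro unital_comp unital_slope_kernel) simp_all

lemma multiplicative_base_kernel: "character E \<Longrightarrow> multiplicative E m (base_kernel E m)"
  unfolding base_kernel_def by (intro multiplicative_comp multiplicative_slope_kernel) simp_all

lemma hom_base_kernel:
  assumes h: "ring_hom h" and E: "character E"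
  shows "(\<lambda>u w. h (base_kernel E m u w)) = base_kernel (\<lambda>i. h (E i)) m"
proof -
  have "map_fps h (1 - fps_X) = 1 - fps_X"
    by (rule fps_ext) (simp add: fps_X_def hom_0[OF h] hom_1[OF h] hom_minus[OF h])
  then show ?thesis by (simp add: base_kernel_def hom_comp[OF h] hom_slope_kernel[OF h E])
qed

text \<open>
  The degree and the leading coefficient of \<open>\<Prod>\<^bsub>i<k\<^esub> (1 - q\<^sup>iz)\<close>, which is all that remains of it at a root of
  unity of order \<open>k\<close>.
\<close>

lemma cocycle_linear:
  fixes E :: "int \<Rightarrow> 'c::comm_ring_1"
  assumes E: "character E"
  shows "cocycle E (1 - fps_X) (int k) $ k = (- 1) ^ k * E (int (k choose 2)) \<and>
    (\<forall>n>k. cocycle E (1 - fps_X) (int k) $ n = 0)"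
proof (induction k)
  case 0
  show ?case by (simp add: character_0[OF E] numeral_2_eq_2)
next
  case (Suc k)
  let ?C = "cocycle E (1 - fps_X)"
  have "twist E (int k) (1 - fps_X) = 1 - fps_const (E (int k)) * fps_X"
    by (rule fps_ext) (simp add: fps_X_def character_0[OF E])
  then have "?C (int k + 1) = ?C (int k) * (1 - fps_const (E (int k)) * fps_X)"
    using cocycle_Suc[OF E, of "1 - fps_X" "int k"] by simp
  then have "?C (int (Suc k)) = ?C (int k) - fps_const (E (int k)) * (fps_X * ?C (int k))"
    by (simp add: algebra_simps)
  then have nth: "?C (int (Suc k)) $ n = ?C (int k) $ n - (if n = 0 then 0 else E (int k) * ?C (int k) $ (n - 1))" for n
    by simp
  have "int (Suc k choose 2) = int k + int (k choose 2)" by (simp add: numeral_2_eq_2)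
  then show ?case
    using Suc unfolding nth by (simp only: characterD[OF E]) (auto simp: algebra_simps)
qed

lemma (in root_of_unity_character) residual_linear: "residual 0 (1 - fps_X) = 1 - fps_X"
proof (rule fps_ext)
  fix n :: nat
  note lin = cocycle_linear[OF E, of d]
  consider "n = 0" | "n = 1" | "n > 1" by linarith
  then show "residual 0 (1 - fps_X) $ n = (1 - fps_X) $ n"
  proof cases
    case 1
    then show ?thesis using residual_nth_0[of "1 - fps_X"] by simp
  next
    case 2
    then show ?thesis
      using lin E_choose_odd by (simp add: residual_def character_0[OF E] mult.commute)
  next
    case 3
    then have "d < d * n" using d by simp
    then show ?thesis using lin 3 by (simp add: residual_def fps_X_def)
  qed
qed

lemma (in root_of_unity_character) on_multiples_base_kernel:
  "on_multiples d (base_kernel E m) = base_kernel (\<lambda>_. 1) m"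
proof -
  have "on_multiples d (slope_kernel E m v (1 - fps_X)) = slope_kernel (\<lambda>_. 1) m v (1 - fps_X)"
    if "v = (1, 0) \<or> v = (0, 1)" for v
    using that on_multiples_slope_kernel[of v "1 - fps_X" m] residual_linear by (auto simp: primitive_def)
  then show ?thesis
    unfolding base_kernel_def by (subst on_multiples_comp[OF d]) (simp_all add: preserves_multiples_slope_kernel)
qed

lemma (in root_of_unity_character) residual_factorization:
  assumes g: "\<forall>v. g v $ 0 = 1"
    and fact: "\<And>N. agree (Suc N) (ordered_prod E m g (dir_list N)) (base_kernel E m)"
  shows "agree (Suc N) (ordered_prod (\<lambda>_. 1) m (\<lambda>v. residual (m * fst v * snd v) (g v)) (dir_list N))
    (base_kernel (\<lambda>_. 1) m)"
proof -
  let ?g = "\<lambda>v. residual (m * fst v * snd v) (g v)"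
  have triv: "character (\<lambda>_. 1 :: 'c)" by (simp add: character_def)
  have g': "\<forall>v. ?g v $ 0 = 1" using g by (simp add: residual_nth_0)
  have dil: "on_multiples d (ordered_prod E m g (dir_list (d * N))) = ordered_prod (\<lambda>_. 1) m ?g (dir_list (d * N))"
    using on_multiples_ordered_prod[OF primitive_dir_list g] by blast
  have "agree (Suc N) (on_multiples d (ordered_prod E m g (dir_list (d * N)))) (on_multiples d (base_kernel E m))"
    unfolding agree_def
  proof (intro allI impI)
    fix u w assume "deg w < Suc N"
    then have "deg (ray d w) < Suc (d * N)" by (simp add: less_Suc_eq_le)
    then show "on_multiples d (ordered_prod E m g (dir_list (d * N))) u w = on_multiples d (base_kernel E m) u w"
      unfolding on_multiples_def by (rule agreeD[OF fact])
  qed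
  moreover have "N \<le> d * N" using d by simp
  then have "agree (Suc N) (ordered_prod (\<lambda>_. 1) m ?g (dir_list (d * N))) (ordered_prod (\<lambda>_. 1) m ?g (dir_list N))"
    by (rule agree_ordered_prod_dir_list[OF triv g'])
  ultimately show ?thesis
    unfolding dil on_multiples_base_kernel using agree_trans agree_sym by blast
qed

text \<open>
  At a root of unity the \<open>q\<close>-factorization, restricted to the multiples of \<open>d\<close>, and the factorization at
  \<open>q = 1\<close> are ordered factorizations of the same kernel.
\<close>

theorem quantum_factorization:
  obtains g :: "nat \<times> nat \<Rightarrow> qlaurent fps" where
    "\<forall>v. g v $ 0 = 1"
    "\<And>N. agree (Suc N) (ordered_prod qmon m g (dir_list N)) (base_kernel qmon m)"
    "\<And>v \<xi> d. primitive v \<Longrightarrow> \<xi> \<noteq> 0 \<Longrightarrow> root_of_unity_character (\<lambda>i. \<xi> powi i) d \<Longrightarrow>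
       root_of_unity_character.residual (\<lambda>i. \<xi> powi i) d (m * fst v * snd v) (map_fps (qeval \<xi>) (g v))
         = map_fps (qeval 1) (g v)"
proof -
  obtain g :: "nat \<times> nat \<Rightarrow> qlaurent fps" where g: "\<forall>v. g v $ 0 = 1"
    and fact: "\<And>N. agree (Suc N) (ordered_prod qmon m g (dir_list N)) (base_kernel qmon m)"
    using ordered_factorization_exists[OF character_qmon qmon_eq_1
        multiplicative_base_kernel[OF character_qmon] unital_base_kernel[OF character_qmon], of m] by blast
  have g': "\<forall>v. map_fps (qeval \<xi>) (g v) $ 0 = 1" if "\<xi> \<noteq> 0" for \<xi>
    using g hom_1[OF ring_hom_qeval[OF that]] by simp
  have ev: "agree (Suc N) (ordered_prod (\<lambda>i. \<xi> powi i) m (\<lambda>v. map_fps (qeval \<xi>) (g v)) (dir_list N))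
       (base_kernel (\<lambda>i. \<xi> powi i) m)" if "\<xi> \<noteq> 0" for \<xi> N
  proof -
    note h = ring_hom_qeval[OF that]
    have "agree (Suc N) (\<lambda>u w. qeval \<xi> (ordered_prod qmon m g (dir_list N) u w)) (\<lambda>u w. qeval \<xi> (base_kernel qmon m u w))"
      using fact[of N] by (simp add: agree_def)
    then show ?thesis
      by (simp add: hom_ordered_prod[OF h character_qmon g] hom_base_kernel[OF h character_qmon])
  qed
  have ev1: "agree (Suc N) (ordered_prod (\<lambda>_. 1) m (\<lambda>v. map_fps (qeval 1) (g v)) (dir_list N))
       (base_kernel (\<lambda>_. 1) m)" for N
    using ev[of 1 N] by simp
  have res: "root_of_unity_character.residual (\<lambda>i. \<xi> powi i) d (m * fst v * snd v) (map_fps (qeval \<xi>) (g v))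
         = map_fps (qeval 1) (g v)"
    if v: "primitive v" and \<xi>: "\<xi> \<noteq> 0" and "root_of_unity_character (\<lambda>i. \<xi> powi i) d" for v \<xi> d
  proof -
    interpret root_of_unity_character "\<lambda>i. \<xi> powi i" d by fact
    let ?r = "\<lambda>v. residual (m * fst v * snd v) (map_fps (qeval \<xi>) (g v))"
    have triv: "character (\<lambda>_. 1 :: complex)" by (simp add: character_def)
    have r0: "\<forall>v. ?r v $ 0 = 1" using g'[OF \<xi>] by (simp add: residual_nth_0)
    have g0: "\<forall>v. map_fps (qeval 1) (g v) $ 0 = 1" by (rule g') simp
    have eq: "agree (Suc N) (ordered_prod (\<lambda>_. 1) m ?r (dir_list N))
        (ordered_prod (\<lambda>_. 1) m (\<lambda>v. map_fps (qeval 1) (g v)) (dir_list N))" for N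
      using residual_factorization[OF g'[OF \<xi>] ev[OF \<xi>]] ev1 agree_trans agree_sym by blast
    show ?thesis
      by (rule fps_ext) (rule ordered_factorization_unique[OF triv r0 g0 eq v])
  qed
  show thesis by (rule that[OF g fact res])
qed

section \<open>Logarithmic derivatives\<close>

text \<open>
  The operator \<open>f \<mapsto> z f' / f\<close>, which turns products into sums and over an integral domain of characteristic zero
  determines the series.
\<close>

definition logderiv :: "'a::comm_ring_1 fps \<Rightarrow> 'a fps" where
  "logderiv f = fps_X * fps_deriv f * unit_powi f (- 1)"

lemma Xderiv_nth: "(fps_X * fps_deriv f) $ n = of_nat n * f $ n"
  by (cases n) simp_all

lemma logderiv_mult_self:
  assumes "f $ 0 = 1"
  shows "logderiv f * f = fps_X * fps_deriv f"
proof -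
  have "logderiv f * f = fps_X * fps_deriv f * (f * unit_powi f (- 1))"
    by (simp only: logderiv_def mult_ac)
  then show ?thesis by (simp add: unit_powi_inverse[OF fps_unit[OF assms]])
qed

lemma logderiv_eqI:
  assumes "f $ 0 = 1" "h * f = fps_X * fps_deriv f"
  shows "logderiv f = h"
  using unit_cancel[OF fps_unit[OF assms(1)]] logderiv_mult_self[OF assms(1)] assms(2) by metis

lemma logderiv_1 [simp]: "logderiv 1 = 0"
  by (rule logderiv_eqI) simp_all

lemma logderiv_mult:
  assumes f: "f $ 0 = 1" and g: "g $ 0 = 1"
  shows "logderiv (f * g) = logderiv f + logderiv g"
proof (rule logderiv_eqI)
  have "(logderiv f + logderiv g) * (f * g) = (logderiv f * f) * g + f * (logderiv g * g)"
    by (simp add: algebra_simps)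
  also have "\<dots> = fps_X * fps_deriv (f * g)"
    unfolding logderiv_mult_self[OF f] logderiv_mult_self[OF g] by (simp add: algebra_simps)
  finally show "(logderiv f + logderiv g) * (f * g) = fps_X * fps_deriv (f * g)" .
qed (simp add: f g)

lemma logderiv_prod:
  assumes "\<And>i. i \<in> I \<Longrightarrow> f i $ 0 = 1"
  shows "logderiv (\<Prod>i\<in>I. f i) = (\<Sum>i\<in>I. logderiv (f i)) \<and> (\<Prod>i\<in>I. f i) $ 0 = 1"
  using assms by (induction I rule: infinite_finite_induct) (simp_all add: logderiv_mult)

lemma logderiv_unit_powi:
  assumes f: "f $ 0 = 1"
  shows "logderiv (unit_powi f k) = of_int k * logderiv f"
proof (induction k rule: int_induct[where k = 0])
  case (step1 i)
  have "logderiv (unit_powi f (i + 1)) = logderiv (unit_powi f i) + logderiv f"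
    by (simp only: unit_powi_Suc[OF fps_unit[OF f]] logderiv_mult unit_powi_nth_0 f)
  then show ?case by (simp only: step1 of_int_add of_int_1 distrib_right mult_1_left)
next
  case (step2 i)
  have "logderiv (unit_powi f i) = logderiv (unit_powi f (i - 1)) + logderiv f"
    using unit_powi_Suc[OF fps_unit[OF f], of "i - 1"]
    by (simp add: logderiv_mult unit_powi_nth_0 f)
  then show ?case using step2 by (simp add: algebra_simps)
qed simp

lemma logderiv_nth_0 [simp]: "logderiv f $ 0 = 0"
  by (simp add: logderiv_def)

lemma logderiv_recursion:
  assumes "f $ 0 = 1"
  shows "of_nat n * f $ n = (\<Sum>k=1..n. logderiv f $ k * f $ (n - k))"
proof -
  have "of_nat n * f $ n = (logderiv f * f) $ n"
    unfolding logderiv_mult_self[OF assms] Xderiv_nth ..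
  also have "\<dots> = (\<Sum>k=0..n. logderiv f $ k * f $ (n - k))"
    by (simp add: fps_mult_nth)
  also have "\<dots> = (\<Sum>k=1..n. logderiv f $ k * f $ (n - k))"
    by (rule sum.mono_neutral_right) (auto simp: not_less_eq_eq)
  finally show ?thesis .
qed

lemma logderiv_inj:
  fixes f g :: "'a::{idom,ring_char_0} fps"
  assumes f: "f $ 0 = 1" and g: "g $ 0 = 1"
    and eq: "\<And>k. 1 \<le> k \<Longrightarrow> k \<le> N \<Longrightarrow> logderiv f $ k = logderiv g $ k"
  shows "fps_cong (Suc N) f g"
proof -
  have "f $ n = g $ n" if "n \<le> N" for n
    using that
  proof (induction n rule: less_induct)
    case (less n)
    show ?case
    proof (cases "n = 0")
      case False
      have "of_nat n * f $ n = of_nat n * g $ n"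
        unfolding logderiv_recursion[OF f] logderiv_recursion[OF g]
        using less eq by (intro sum.cong) auto
      then show ?thesis using False by simp
    qed (simp add: f g)
  qed
  then show ?thesis by (simp add: fps_cong_def)
qed

definition fps_scale :: "'a::comm_ring_1 \<Rightarrow> 'a fps \<Rightarrow> 'a fps" where
  "fps_scale c f = Abs_fps (\<lambda>n. c ^ n * f $ n)"

lemma fps_scale_nth [simp]: "fps_scale c f $ n = c ^ n * f $ n"
  by (simp add: fps_scale_def)

lemma fps_scale_mult: "fps_scale c (f * g) = fps_scale c f * fps_scale c g"
proof (rule fps_ext)
  fix n
  have "c ^ n * (f $ i * g $ (n - i)) = (c ^ i * f $ i) * (c ^ (n - i) * g $ (n - i))" if "i \<in> {0..n}" for i
  proof -
    have "c ^ n = c ^ i * c ^ (n - i)" using that by (simp flip: power_add)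
    then show ?thesis by (simp add: mult_ac)
  qed
  then show "fps_scale c (f * g) $ n = (fps_scale c f * fps_scale c g) $ n"
    by (simp add: fps_mult_nth sum_distrib_left)
qed

lemma logderiv_scale:
  assumes f: "f $ 0 = 1"
  shows "logderiv (fps_scale c f) = fps_scale c (logderiv f)"
proof (rule logderiv_eqI)
  show "fps_scale c (logderiv f) * fps_scale c f = fps_X * fps_deriv (fps_scale c f)"
    unfolding fps_scale_mult[symmetric] logderiv_mult_self[OF f]
    by (rule fps_ext) (simp only: fps_scale_nth Xderiv_nth mult_ac)
qed (simp add: f)

lemma logderiv_map_fps:
  assumes h: "ring_hom h" and f: "f $ 0 = 1"
  shows "logderiv (map_fps h f) = map_fps h (logderiv f)"
proof (rule logderiv_eqI)
  show "map_fps h (logderiv f) * map_fps h f = fps_X * fps_deriv (map_fps h f)"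
    unfolding hom_mult[OF ring_hom_map_fps[OF h], symmetric] logderiv_mult_self[OF f]
    by (rule fps_ext) (simp only: map_fps_nth Xderiv_nth hom_mult[OF h] hom_of_nat[OF h])
qed (simp add: f hom_1[OF h])

lemma character_power: "character E \<Longrightarrow> E (i * int n) = E i ^ n"
  by (induction n) (simp_all add: character_0 characterD algebra_simps)

lemma twist_eq_scale: "character E \<Longrightarrow> twist E i f = fps_scale (E i) f"
  by (rule fps_ext) (simp add: character_power)

text \<open>
  Summing the logarithmic derivatives of the factors \<open>g(q\<^sup>iz)\<close> kills the coefficients whose index is not a multiple
  of \<open>d\<close> and multiplies the others by \<open>d\<close>, as does the substitution \<open>z \<mapsto> z\<^sup>d\<close>; the two factors \<open>d\<close> cancel.
\<close>

lemma (in root_of_unity_character) logderiv_residual: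
  assumes g: "g $ 0 = 1" and char0: "of_nat d \<noteq> (0 :: 'c)"
  shows "E (int (e * (d choose 2))) ^ n * logderiv g $ (d * n) = logderiv (residual e g) $ n"
proof -
  let ?C = "cocycle E g (int d)" and ?\<mu> = "E (int (e * (d choose 2)))"
  let ?r = "residual e g"
  have C0: "?C $ 0 = 1" by (rule cocycle_nth_0[OF E g])
  have C: "?C = (\<Prod>i\<in>{0..<int d}. twist E i g)" by (simp add: cocycle_def)
  have "logderiv ?C = (\<Sum>i\<in>{0..<int d}. twist E i (logderiv g))"
    using logderiv_prod[of "{0..<int d}" "\<lambda>i. twist E i g"] twist_nth_0[OF E g]
    unfolding C by (simp add: twist_eq_scale[OF E] logderiv_scale[OF g])
  then have ldC: "logderiv ?C $ (d * n) = of_nat d * logderiv g $ (d * n)" for n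
    by (simp add: fps_sum_nth mult.left_commute[of _ "int d"])
  \<comment> \<open>Both \<open>\<Lambda>\<close> and \<open>d\<close> times the logarithmic derivative of the residual series solve the same linear equation.\<close>
  define \<Lambda> where "\<Lambda> = Abs_fps (\<lambda>n. ?\<mu> ^ n * logderiv ?C $ (d * n))"
  have "\<Lambda> * ?r = of_nat d * (fps_X * fps_deriv ?r)"
  proof (rule fps_ext)
    fix n
    have "(\<Lambda> * ?r) $ n = (?r * \<Lambda>) $ n" by (simp only: mult.commute)
    also have "\<dots> = (\<Sum>i=0..n. ?r $ i * \<Lambda> $ (n - i))" by (simp only: fps_mult_nth)
    also have "\<dots> = (\<Sum>i=0..n. ?\<mu> ^ n * (?C $ (d * i) * logderiv ?C $ (d * (n - i))))"
    proof (rule sum.cong[OF refl])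
      fix i assume "i \<in> {0..n}"
      then have "?\<mu> ^ n = ?\<mu> ^ i * ?\<mu> ^ (n - i)" by (simp flip: power_add)
      then show "?r $ i * \<Lambda> $ (n - i) = ?\<mu> ^ n * (?C $ (d * i) * logderiv ?C $ (d * (n - i)))"
        unfolding \<Lambda>_def residual_def fps_nth_Abs_fps by (simp only: mult_ac)
    qed
    also have "\<dots> = ?\<mu> ^ n * (?C * logderiv ?C) $ (d * n)"
      using sparse_mult_nth[OF d, of ?C "logderiv ?C" n] cocycle_sparse[OF g, of _ 1]
      by (simp add: sum_distrib_left)
    also have "\<dots> = ?\<mu> ^ n * (of_nat (d * n) * ?C $ (d * n))"
      unfolding mult.commute[of ?C] logderiv_mult_self[OF C0] Xderiv_nth ..
    also have "\<dots> = of_nat d * (of_nat n * ?r $ n)"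
      by (simp add: residual_def mult_ac)
    also have "\<dots> = (of_nat d * (fps_X * fps_deriv ?r)) $ n"
      unfolding fps_of_nat[symmetric] fps_mult_left_const_nth Xderiv_nth ..
    finally show "(\<Lambda> * ?r) $ n = (of_nat d * (fps_X * fps_deriv ?r)) $ n" .
  qed
  also have "\<dots> = (of_nat d * logderiv ?r) * ?r"
    unfolding logderiv_mult_self[OF residual_nth_0[OF g], symmetric] by (simp only: mult.assoc)
  finally have "\<Lambda> = of_nat d * logderiv ?r"
    using unit_cancel[OF fps_unit[OF residual_nth_0[OF g]]] by blast
  then have "\<Lambda> $ n = of_nat d * logderiv ?r $ n"
    by (simp only: fps_of_nat[symmetric] fps_mult_left_const_nth)
  then have "of_nat d * (?\<mu> ^ n * logderiv g $ (d * n)) = of_nat d * logderiv ?r $ n"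
    by (simp add: \<Lambda>_def ldC mult_ac)
  then show ?thesis using char0 by simp
qed

lemma (in root_of_unity_character) logderiv_scaled_residual:
  assumes g: "g $ 0 = 1" and char0: "of_nat d \<noteq> (0 :: 'c)"
  shows "logderiv (fps_scale ((- 1) ^ e) g) $ (d * n) = logderiv (fps_scale ((- 1) ^ e) (residual e g)) $ n"
proof -
  let ?s = "(- 1) ^ e :: 'c" and ?\<mu> = "E (int (e * (d choose 2)))"
  have "?s * ?s = 1" by (simp flip: power_mult_distrib)
  then have "(?s ^ d) * (?s ^ d) = 1" by (simp flip: power_mult_distrib)
  then have "?s * ?\<mu> = (?\<mu> * ?s ^ d) * (?s * ?s ^ d)" by (simp add: mult_ac)
  also have "\<dots> = ?s ^ d"
    unfolding E_sign using \<open>?s * ?s = 1\<close> by (simp add: mult.assoc[symmetric])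
  finally have s: "?s ^ d = ?s * ?\<mu>" ..
  have "logderiv (fps_scale ?s g) $ (d * n) = (?s ^ d) ^ n * logderiv g $ (d * n)"
    unfolding logderiv_scale[OF g] fps_scale_nth power_mult ..
  also have "\<dots> = ?s ^ n * (?\<mu> ^ n * logderiv g $ (d * n))"
    unfolding s power_mult_distrib by (simp only: mult.assoc)
  also have "\<dots> = logderiv (fps_scale ?s (residual e g)) $ n"
    unfolding logderiv_residual[OF assms] logderiv_scale[OF residual_nth_0[OF g]] fps_scale_nth ..
  finally show ?thesis .
qed

section \<open>Product expansions over Laurent polynomials\<close>

text \<open>
  The Adams operation \<open>q \<mapsto> q\<^sup>j\<close>.
\<close>

definition adams :: "nat \<Rightarrow> qlaurent \<Rightarrow> qlaurent" where
  "adams j = pm_lift (\<lambda>i c. single (int j * i) c)"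

lemma adams_single: "adams j (single i c) = single (int j * i) c"
  by (simp add: adams_def pm_lift_single)

lemma adams_add: "adams j (p + q) = adams j p + adams j q"
  unfolding adams_def by (rule pm_lift_add) (simp_all add: single_add)

lemma adams_1 [simp]: "adams (Suc 0) p = p"
  by (induction p rule: pm_induct) (simp_all add: adams_single adams_add)

lemma qeval_adams:
  assumes "z \<noteq> 0"
  shows "qeval z (adams j p) = qeval (z ^ j) p"
proof (induction p rule: pm_induct)
  case (single i c)
  show ?case by (simp add: adams_single qeval_single power_int_mult)
next
  case (add p q)
  then show ?case
    using assms by (simp add: adams_add hom_add[OF ring_hom_qeval])
qed

lemma logderiv_binomial:
  fixes a :: "'a::comm_ring_1"
  assumes k: "k \<noteq> 0"
  shows "logderiv (1 - fps_const a * fps_X ^ k) $ n =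
    (if n \<noteq> 0 \<and> k dvd n then - of_nat k * a ^ (n div k) else 0)"
proof -
  define h where "h = Abs_fps (\<lambda>n. if n \<noteq> 0 \<and> k dvd n then - of_nat k * a ^ (n div k) else 0)"
  have "logderiv (1 - fps_const a * fps_X ^ k) = h"
  proof (rule logderiv_eqI)
    show "(1 - fps_const a * fps_X ^ k) $ 0 = 1" using k by simp
    show "h * (1 - fps_const a * fps_X ^ k) = fps_X * fps_deriv (1 - fps_const a * fps_X ^ k)"
    proof (rule fps_ext)
      fix n
      have "h * (1 - fps_const a * fps_X ^ k) = h - fps_const a * (fps_X ^ k * h)"
        by (simp add: algebra_simps)
      then have lhs: "(h * (1 - fps_const a * fps_X ^ k)) $ n = h $ n - a * (if n < k then 0 else h $ (n - k))"
        by (simp add: fps_X_power_mult_nth)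
      have rhs: "(fps_X * fps_deriv (1 - fps_const a * fps_X ^ k)) $ n = (if n = k then - of_nat k * a else 0)"
        using k unfolding Xderiv_nth by simp
      show "(h * (1 - fps_const a * fps_X ^ k)) $ n = (fps_X * fps_deriv (1 - fps_const a * fps_X ^ k)) $ n"
      proof (cases "k dvd n")
        case False
        then have "\<not> k dvd n - k" if "\<not> n < k"
          using that by (simp add: dvd_minus_self)
        then show ?thesis using False unfolding lhs rhs by (auto simp: h_def)
      next
        case True
        then obtain i where i: "n = k * i" ..
        consider "i = 0" | "i = 1" | j where "i = Suc (Suc j)" by (metis One_nat_def not0_implies_Suc)
        then show ?thesis
        proof cases
          case 1
          then show ?thesis using k i unfolding lhs rhs by (simp add: h_def)
        next
          case 2
          then show ?thesis using k i unfolding lhs rhs by (simp add: h_def)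
        next
          case 3
          then have "n - k = k * Suc j" by (simp add: i)
          then show ?thesis using k i 3 unfolding lhs rhs by (simp add: h_def algebra_simps)
        qed
      qed
    qed
  qed
  then show ?thesis by (simp add: h_def)
qed

lemma qmon_power: "qmon i ^ n = qmon (int n * i)"
  using character_power[OF character_qmon, of i n] by (simp add: mult.commute)

text \<open>
  The series is \<open>\<Prod>\<^bsub>i\<^esub> (1 - q\<^sup>iz\<^sup>k)\<^bsup>r(i)\<^esup>\<close> for \<open>p = \<Sum>\<^bsub>i\<^esub> r(i) q\<^sup>i\<close>.
\<close>

lemma exists_series_with_logderiv:
  assumes k: "k \<noteq> 0"
  shows "\<exists>F. F $ 0 = 1 \<and> (\<forall>n. logderiv F $ n =
    (if n \<noteq> 0 \<and> k dvd n then - of_nat k * adams (n div k) p else 0))"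
proof (induction p rule: pm_induct)
  case (single i c)
  let ?b = "1 - fps_const (qmon i) * fps_X ^ k"
  let ?F = "unit_powi ?b c"
  have b: "?b $ 0 = 1" using k by simp
  have c: "of_int c * qmon i ^ n = single (int n * i) c" for n
    unfolding qmon_power by (simp add: qmon_def mult_single flip: single_of_int)
  have "logderiv ?F $ n = of_int c * logderiv ?b $ n" for n
    unfolding logderiv_unit_powi[OF b] by (simp flip: fps_of_int)
  then have "logderiv ?F $ n = (if n \<noteq> 0 \<and> k dvd n then - of_nat k * adams (n div k) (single i c) else 0)" for n
    by (simp add: logderiv_binomial[OF k] adams_single mult.left_commute flip: c)
  then show ?case using unit_powi_nth_0[OF b] by blast
next
  case (add p q)
  then obtain F G where "F $ 0 = 1" "G $ 0 = 1"
    "\<forall>n. logderiv F $ n = (if n \<noteq> 0 \<and> k dvd n then - of_nat k * adams (n div k) p else 0)"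
    "\<forall>n. logderiv G $ n = (if n \<noteq> 0 \<and> k dvd n then - of_nat k * adams (n div k) q else 0)"
    by blast
  then show ?case
    by (intro exI[of _ "F * G"]) (auto simp: logderiv_mult adams_add algebra_simps)
qed

text \<open>
  The expansion \<open>G = \<Prod>\<^bsub>k\<^esub> \<Prod>\<^bsub>i\<^esub> (1 - q\<^sup>iz\<^sup>k)\<^bsup>r(k,i)\<^esup>\<close> in terms of logarithmic derivatives, where \<open>R k\<close> collects the
  exponents \<open>r(k,i)\<close>. After the factors up to \<open>N\<close> are divided out, the quotient is \<open>1 + h z\<^bsup>N+1\<^esup> + \<dots>\<close>, and \<open>-h\<close> is the
  next Laurent polynomial.
\<close>

lemma exists_plethystic_log:
  fixes G :: "qlaurent fps"
  assumes G: "G $ 0 = 1"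
  shows "\<exists>R. \<forall>n. n \<noteq> 0 \<longrightarrow> logderiv G $ n = - (\<Sum>k | k dvd n. of_nat k * adams (n div k) (R k))"
proof -
  define P where "P N R \<longleftrightarrow> (\<forall>n. 0 < n \<and> n \<le> N \<longrightarrow>
      logderiv G $ n = - (\<Sum>k | k dvd n. of_nat k * adams (n div k) (R k)))" for N and R :: "nat \<Rightarrow> qlaurent"
  have "\<exists>R. \<forall>N. P N (R N) \<and> (\<forall>k\<le>N. R (Suc N) k = R N k)"
  proof (rule dependent_nat_choice)
    show "\<exists>R. P 0 R" by (simp add: P_def)
  next
    fix R N assume R: "P N R"
    have "\<forall>k. \<exists>F. k \<noteq> 0 \<longrightarrow> F $ 0 = 1 \<and> (\<forall>n. logderiv F $ n =
        (if n \<noteq> 0 \<and> k dvd n then - of_nat k * adams (n div k) (R k) else 0))"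
      using exists_series_with_logderiv by blast
    from choice[OF this] obtain F where F: "\<And>k. k \<noteq> 0 \<Longrightarrow> F k $ 0 = 1" and
      ldF: "\<And>k n. k \<noteq> 0 \<Longrightarrow> logderiv (F k) $ n = (if n \<noteq> 0 \<and> k dvd n then - of_nat k * adams (n div k) (R k) else 0)"
      by blast
    let ?F' = "\<lambda>k. unit_powi (F k) (- 1)"
    define H where "H = G * (\<Prod>k\<in>{1..N}. ?F' k)"
    have F': "?F' k $ 0 = 1" if "k \<in> {1..N}" for k using F that by (simp add: unit_powi_nth_0)
    have H0: "H $ 0 = 1" using logderiv_prod[of "{1..N}" ?F'] F' G by (simp add: H_def)
    have divs: "{k \<in> {1..N}. k dvd n} = {k. k dvd n \<and> k \<le> N}" if "n \<noteq> 0" for n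
      using that by (auto intro: Nat.gr0I)
    have ldH: "logderiv H $ n = logderiv G $ n + (\<Sum>k | k dvd n \<and> k \<le> N. of_nat k * adams (n div k) (R k))"
      if n: "n \<noteq> 0" for n
    proof -
      have "logderiv H = logderiv G + (\<Sum>k\<in>{1..N}. logderiv (?F' k))"
        using logderiv_prod[of "{1..N}" ?F'] F' G by (simp add: H_def logderiv_mult)
      then have "logderiv H $ n = logderiv G $ n + (\<Sum>k\<in>{1..N}. logderiv (?F' k) $ n)"
        by (simp add: fps_sum_nth)
      also have "(\<Sum>k\<in>{1..N}. logderiv (?F' k) $ n) = (\<Sum>k\<in>{1..N}. if k dvd n then of_nat k * adams (n div k) (R k) else 0)"
        using n by (intro sum.cong refl) (simp add: logderiv_unit_powi F ldF)
      also have "\<dots> = (\<Sum>k | k dvd n \<and> k \<le> N. of_nat k * adams (n div k) (R k))"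
        unfolding divs[OF n, symmetric] by (rule sum.inter_filter[symmetric]) simp
      finally show ?thesis .
    qed
    have ldH_low: "logderiv H $ n = 0" if "0 < n" "n \<le> N" for n
    proof -
      have "{k. k dvd n \<and> k \<le> N} = {k. k dvd n}"
        using that by (auto dest: dvd_imp_le)
      then show ?thesis using R that by (simp add: ldH P_def)
    qed
    define r where "r = - H $ Suc N"
    have "of_nat (Suc N) * H $ Suc N = (\<Sum>k=1..Suc N. logderiv H $ k * H $ (Suc N - k))"
      by (rule logderiv_recursion[OF H0])
    also have "\<dots> = (\<Sum>k=1..Suc N. if k = Suc N then logderiv H $ Suc N else 0)"
      using ldH_low H0 by (intro sum.cong refl) (auto simp: le_Suc_eq)
    finally have top: "logderiv H $ Suc N = - of_nat (Suc N) * r"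
      by (simp add: r_def algebra_simps)
    define R' where "R' = R(Suc N := r)"
    have "P (Suc N) R'"
      unfolding P_def
    proof (intro allI impI)
      fix n assume n: "0 < n \<and> n \<le> Suc N"
      show "logderiv G $ n = - (\<Sum>k | k dvd n. of_nat k * adams (n div k) (R' k))"
      proof (cases "n = Suc N")
        case False
        then have "n \<le> N" using n by simp
        then have "k \<noteq> Suc N" if "k dvd n" for k using that n by (auto dest: dvd_imp_le)
        then have "(\<Sum>k | k dvd n. of_nat k * adams (n div k) (R' k)) = (\<Sum>k | k dvd n. of_nat k * adams (n div k) (R k))"
          by (intro sum.cong refl) (auto simp: R'_def)
        then show ?thesis using R n \<open>n \<le> N\<close> by (simp add: P_def)
      next
        case True
        have set: "{k. k dvd n} = insert n {k. k dvd n \<and> k \<le> N}"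
          using True dvd_imp_le[of _ n] by (auto simp: le_Suc_eq)
        have fin: "finite {k. k dvd n \<and> k \<le> N}" by simp
        have "(\<Sum>k | k dvd n. of_nat k * adams (n div k) (R' k)) =
          of_nat n * r + (\<Sum>k | k dvd n \<and> k \<le> N. of_nat k * adams (n div k) (R k))"
        proof -
          have "(\<Sum>k | k dvd n. of_nat k * adams (n div k) (R' k)) = of_nat n * adams (n div n) (R' n) +
            (\<Sum>k | k dvd n \<and> k \<le> N. of_nat k * adams (n div k) (R' k))"
            unfolding set using True fin by (subst sum.insert) simp_all
          also have "(\<Sum>k | k dvd n \<and> k \<le> N. of_nat k * adams (n div k) (R' k)) =
            (\<Sum>k | k dvd n \<and> k \<le> N. of_nat k * adams (n div k) (R k))"
            by (rule sum.cong[OF refl]) (simp add: R'_def)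
          finally show ?thesis using True by (simp add: R'_def)
        qed
        then show ?thesis using ldH[of n] top True by (simp add: algebra_simps)
      qed
    qed
    then show "\<exists>R'. P (Suc N) R' \<and> (\<forall>k\<le>N. R' k = R k)"
      by (intro exI[of _ R']) (simp add: R'_def)
  qed
  then obtain S where P: "\<And>N. P N (S N)" and stable: "\<And>N k. k \<le> N \<Longrightarrow> S (Suc N) k = S N k" by blast
  have S: "S N k = S k k" if "k \<le> N" for N k
    using that
  proof (induction N rule: dec_induct)
    case (step N)
    then show ?case using stable[of k N] by simp
  qed simp
  show ?thesis
  proof (intro exI allI impI)
    fix n :: nat assume n: "n \<noteq> 0"
    have "(\<Sum>k | k dvd n. of_nat k * adams (n div k) (S n k)) = (\<Sum>k | k dvd n. of_nat k * adams (n div k) (S k k))"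
    proof (rule sum.cong[OF refl])
      fix k assume "k \<in> {k. k dvd n}"
      then have "k \<le> n" using n by (auto dest: dvd_imp_le)
      from S[OF this] show "of_nat k * adams (n div k) (S n k) = of_nat k * adams (n div k) (S k k)" by simp
    qed
    then show "logderiv G $ n = - (\<Sum>k | k dvd n. of_nat k * adams (n div k) (S k k))"
      using P[of n] n by (simp add: P_def)
  qed
qed

text \<open>
  Evaluation at \<open>q = 1\<close>, with integer values.
\<close>

definition augmentation :: "qlaurent \<Rightarrow> int" where
  "augmentation = pm_lift (\<lambda>_ c. c)"

lemma ring_hom_augmentation: "ring_hom augmentation"
  unfolding augmentation_def by (rule ring_hom_pm_lift) simp_all

lemma augmentation_single [simp]: "augmentation (single i c) = c"
  by (simp add: augmentation_def pm_lift_single)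

lemma augmentation_adams [simp]: "augmentation (adams j p) = augmentation p"
  by (induction p rule: pm_induct)
    (simp_all add: adams_single adams_add hom_add[OF ring_hom_augmentation])

lemma qeval_1: "qeval 1 p = of_int (augmentation p)"
  by (induction p rule: pm_induct)
    (simp_all add: qeval_single hom_add[OF ring_hom_augmentation] hom_add[OF ring_hom_qeval])

lemma sum_roots_powi:
  assumes n: "n \<noteq> 0"
  shows "(\<Sum>z | z ^ n = 1. z powi i :: complex) = (if int n dvd i then of_nat n else 0)"
proof (cases "int n dvd i")
  case True
  then obtain k where "i = int n * k" ..
  then have one: "z powi i = 1" if "z ^ n = 1" for z :: complex
    using that by (simp add: power_int_mult)
  have "(\<Sum>z | z ^ n = 1. z powi i :: complex) = (\<Sum>z::complex | z ^ n = 1. 1)"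
    by (rule sum.cong[OF refl]) (rule one, simp)
  also have "\<dots> = of_nat (card {z::complex. z ^ n = 1})" by (simp only: sum_constant mult_1_right)
  also have "\<dots> = of_nat n" using card_roots_unity_eq[of n] n by (simp only: neq0_conv)
  finally show ?thesis unfolding if_P[OF True] .
next
  case False
  define r where "r = nat (i mod int n)"
  have r: "0 < r" "r < n"
    using False n pos_mod_sign[of "int n" i] pos_mod_bound[of "int n" i]
    unfolding r_def dvd_eq_mod_eq_0 by linarith+
  have powi: "z powi i = z ^ r" if "z ^ n = 1" for z :: complex
  proof -
    have z0: "z \<noteq> 0" using that n by (cases "z = 0") (auto simp: power_0_left)
    have "i = int n * (i div int n) + int r" using n by (simp add: r_def)
    then have "z powi i = z powi (int n * (i div int n)) * z powi int r"
      using z0 by (metis power_int_add)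
    then show ?thesis using that by (simp add: power_int_mult)
  qed
  let ?A = "{z::complex. z ^ n = 1}"
  have fin: "finite ?A" using n by (intro finite_roots_unity) simp
  have "\<exists>w\<in>?A. w ^ r \<noteq> 1"
  proof (rule ccontr)
    assume "\<not> ?thesis"
    then have "?A \<subseteq> {z. z ^ r = 1}" by auto
    then have "card ?A \<le> card {z::complex. z ^ r = 1}"
      using r by (intro card_mono finite_roots_unity) simp_all
    then show False using r card_roots_unity_eq[of n] card_roots_unity_eq[of r] n by simp
  qed
  \<comment> \<open>Multiplication by \<open>w\<close> permutes the roots of unity and multiplies the sum by \<open>w\<^sup>r\<close>.\<close>
  then obtain w :: complex where w: "w ^ n = 1" "w ^ r \<noteq> 1" by blast
  have w0: "w \<noteq> 0" using w n by (cases "w = 0") (auto simp: power_0_left)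
  have "(\<Sum>z\<in>?A. z ^ r) = (\<Sum>z\<in>?A. (w * z) ^ r)"
    by (rule sum.reindex_bij_witness[where i = "\<lambda>z. w * z" and j = "\<lambda>z. z / w"])
      (use w w0 in \<open>auto simp: power_mult_distrib power_divide\<close>)
  also have "\<dots> = w ^ r * (\<Sum>z\<in>?A. z ^ r)"
    by (simp only: power_mult_distrib sum_distrib_left)
  finally have "(w ^ r - 1) * (\<Sum>z\<in>?A. z ^ r) = 0"
    by (simp only: left_diff_distrib mult_1_left) simp
  then have "(\<Sum>z\<in>?A. z ^ r) = 0" using w by simp
  then show ?thesis using False powi by simp
qed

lemma sum_roots_qeval:
  assumes n: "n \<noteq> 0"
  shows "\<exists>s. (\<Sum>z | z ^ n = 1. qeval z p) = of_int (int n * s)"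
proof (induction p rule: pm_induct)
  case (single i c)
  have "(\<Sum>z | z ^ n = 1. qeval z (single i c)) = of_int c * (\<Sum>z | z ^ n = 1. z powi i)"
    by (simp add: qeval_single sum_distrib_left)
  also have "\<dots> = of_int (int n * (if int n dvd i then c else 0))"
    by (simp add: sum_roots_powi[OF n])
  finally show ?case by blast
next
  case (add p q)
  then obtain s t where "(\<Sum>z | z ^ n = 1. qeval z p) = of_int (int n * s)"
    "(\<Sum>z | z ^ n = 1. qeval z q) = of_int (int n * t)" by blast
  moreover have "(\<Sum>z | z ^ n = 1. qeval z (p + q)) = (\<Sum>z | z ^ n = 1. qeval z p + qeval z q)"
    using n by (intro sum.cong refl hom_add ring_hom_qeval) (auto simp: power_0_left)
  ultimately have "(\<Sum>z | z ^ n = 1. qeval z (p + q)) = of_int (int n * (s + t))"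
    by (simp add: sum.distrib algebra_simps)
  then show ?case by blast
qed

text \<open>
  If \<open>p\<close> vanishes at all other \<open>n\<close>-th roots of unity, then \<open>p(1)\<close> is the sum of \<open>p\<close> over all of them, which is \<open>n\<close>
  times the sum of the coefficients of \<open>p\<close> at multiples of \<open>n\<close>.
\<close>

lemma dvd_augmentation:
  assumes n: "n \<noteq> 0" and zero: "\<And>z. z ^ n = 1 \<Longrightarrow> z \<noteq> 1 \<Longrightarrow> qeval z p = 0"
  shows "int n dvd augmentation p"
proof -
  obtain s where s: "(\<Sum>z | z ^ n = 1. qeval z p) = of_int (int n * s)"
    using sum_roots_qeval[OF n] by blast
  have "(\<Sum>z | z ^ n = 1. qeval z p) = (\<Sum>z\<in>{1}. qeval z p)"
    using n zero by (intro sum.mono_neutral_right finite_roots_unity) auto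
  then have "(of_int (augmentation p) :: complex) = of_int (int n * s)"
    using s by (simp add: qeval_1)
  then show ?thesis by (simp only: of_int_eq_iff dvd_triv_left)
qed

lemma root_of_unity_order:
  fixes \<xi> :: complex
  assumes n: "n \<noteq> 0" and \<xi>: "\<xi> ^ n = 1"
  shows "\<exists>d. root_of_unity_character (\<lambda>i. \<xi> powi i) d"
proof -
  define d where "d = (LEAST k. 0 < k \<and> \<xi> ^ k = 1)"
  have d: "0 < d" "\<xi> ^ d = 1"
    using LeastI[of "\<lambda>k. 0 < k \<and> \<xi> ^ k = 1" n] n \<xi> by (simp_all add: d_def)
  have least: "k = 0" if "k < d" "\<xi> ^ k = 1" for k
    using that not_less_Least[of k "\<lambda>k. 0 < k \<and> \<xi> ^ k = 1"] by (auto simp: d_def)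
  have \<xi>0: "\<xi> \<noteq> 0" using \<xi> n by (cases "\<xi> = 0") (auto simp: power_0_left)
  have "\<xi> powi i = 1 \<longleftrightarrow> int d dvd i" for i
  proof -
    have "i = int d * (i div int d) + int (nat (i mod int d))" using d by simp
    from this have "\<xi> powi i = \<xi> powi (int d * (i div int d)) * \<xi> powi int (nat (i mod int d))"
      using \<xi>0 by (metis power_int_add)
    also have "\<dots> = \<xi> ^ nat (i mod int d)"
      unfolding power_int_mult power_int_of_nat using d by simp
    finally have "\<xi> powi i = \<xi> ^ nat (i mod int d)" .
    moreover have "nat (i mod int d) < d" using d by (simp add: nat_less_iff)
    ultimately have "\<xi> powi i = 1 \<longleftrightarrow> nat (i mod int d) = 0"
      using least by (metis power_0)
    also have "\<dots> \<longleftrightarrow> i mod int d = 0" using d pos_mod_sign[of "int d" i] by linarith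
    finally show ?thesis by (simp add: dvd_eq_mod_eq_0)
  qed
  then have "root_of_unity_character (\<lambda>i. \<xi> powi i) d"
    using d by unfold_locales (simp_all add: character_powi[OF \<xi>0])
  then show ?thesis ..
qed

text \<open>
  The hypothesis says that \<open>\<Prod>\<^bsub>i<d\<^esub> G\<^sub>\<zeta>(\<zeta>\<^sup>iz) = G\<^sub>1(z\<^sup>d)\<close>. Compare the coefficients of \<open>z\<^sup>n\<close> at a root of unity \<open>\<zeta>\<close> of
  order \<open>d\<close> dividing \<open>n\<close>: the terms with \<open>\<zeta>\<^bsup>n/k\<^esup> = 1\<close> are those of the right hand side, all others with \<open>k < n\<close>
  vanish by induction, and \<open>n R\<^sub>n(\<zeta>)\<close> is left.
\<close>

theorem product_expansion:
  fixes G :: "qlaurent fps"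
  assumes G: "G $ 0 = 1"
    and root: "\<And>\<xi> d N. \<xi> \<noteq> 0 \<Longrightarrow> root_of_unity_character (\<lambda>i. \<xi> powi i) d \<Longrightarrow>
      logderiv (map_fps (qeval \<xi>) G) $ (d * N) = logderiv (map_fps (qeval 1) G) $ N"
  shows "\<exists>c :: nat \<Rightarrow> int. \<forall>K. fps_cong (Suc K) (map_fps augmentation G)
     (\<Prod>k=1..K. unit_powi (1 - fps_X ^ k) (int k * c k))"
proof -
  obtain R where R: "\<And>n. n \<noteq> 0 \<Longrightarrow>
      logderiv G $ n = - (\<Sum>k | k dvd n. of_nat k * adams (n div k) (R k))"
    using exists_plethystic_log[OF G] by blast
  have ev: "logderiv (map_fps (qeval \<xi>) G) $ n = - (\<Sum>k | k dvd n. of_nat k * qeval (\<xi> ^ (n div k)) (R k))"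
    if \<xi>: "\<xi> \<noteq> 0" and n: "n \<noteq> 0" for \<xi> n
  proof -
    note h = ring_hom_qeval[OF \<xi>]
    show ?thesis
      by (simp add: logderiv_map_fps[OF h G] R[OF n] hom_minus[OF h] hom_sum[OF h] hom_mult[OF h]
          hom_of_nat[OF h] qeval_adams[OF \<xi>])
  qed
  have vanish: "qeval \<xi> (R n) = 0" if "n \<noteq> 0" "\<xi> ^ n = 1" "\<xi> \<noteq> 1" for n \<xi>
    using that
  proof (induction n arbitrary: \<xi> rule: less_induct)
    case (less n)
    have \<xi>0: "\<xi> \<noteq> 0" using less.prems by (cases "\<xi> = 0") (auto simp: power_0_left)
    obtain d where ch: "root_of_unity_character (\<lambda>i. \<xi> powi i) d"
      using root_of_unity_order less.prems by blast
    interpret root_of_unity_character "\<lambda>i. \<xi> powi i" d by (fact ch)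
    have pow1: "\<xi> ^ j = 1 \<longleftrightarrow> d dvd j" for j
      using E_1_iff[of "int j"] by simp
    obtain N where N: "n = d * N" using less.prems pow1 by blast
    then have N0: "N \<noteq> 0" using less.prems by auto
    have d1: "\<not> d dvd 1" using pow1[of 1] less.prems by simp
    let ?f = "\<lambda>k. of_nat k * qeval (\<xi> ^ (n div k)) (R k)"
    have "(\<Sum>k | k dvd n. ?f k) = (\<Sum>k | k dvd N. of_nat k * qeval (1 ^ (N div k)) (R k))"
      using root[OF \<xi>0 ch, of N] ev[OF \<xi>0 less.prems(1)] ev[of 1 N] N0 by (simp add: N)
    also have "\<dots> = (\<Sum>k | k dvd N. ?f k)"
    proof (rule sum.cong[OF refl])
      fix k assume "k \<in> {k. k dvd N}"
      then have "\<xi> ^ (n div k) = 1" by (auto simp: pow1 N div_mult_swap[symmetric])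
      then show "of_nat k * qeval (1 ^ (N div k)) (R k) = ?f k" by simp
    qed
    finally have eq: "(\<Sum>k | k dvd n. ?f k) = (\<Sum>k | k dvd N. ?f k)" .
    have nN: "\<not> n dvd N" using d1 N N0 by (auto simp: dvd_mult_cancel2)
    have fin: "finite {k. k dvd n}" using less.prems by simp
    have sub: "insert n {k. k dvd N} \<subseteq> {k. k dvd n}" by (auto simp: N)
    have "(\<Sum>k | k dvd n. ?f k) = (\<Sum>k\<in>insert n {k. k dvd N}. ?f k)"
    proof (rule sum.mono_neutral_right[OF fin sub], rule ballI)
      fix k assume k: "k \<in> {k. k dvd n} - insert n {k. k dvd N}"
      then have kn: "k dvd n" "k \<noteq> n" "\<not> k dvd N" by auto
      then have "k < n" "k \<noteq> 0" using less.prems by (auto dest: dvd_imp_le simp: le_less)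
      moreover have "(\<xi> ^ (n div k)) ^ k = 1"
        using kn less.prems by (simp flip: power_mult)
      moreover have "\<xi> ^ (n div k) \<noteq> 1"
      proof
        assume "\<xi> ^ (n div k) = 1"
        then obtain j where "n div k = d * j" by (auto simp: pow1)
        then have "n = d * j * k" using kn by (metis dvd_div_mult_self)
        then have "N = j * k" using N d by simp
        then show False using kn by simp
      qed
      ultimately show "?f k = 0" using less.IH[of k "\<xi> ^ (n div k)"] by simp
    qed
    also have "\<dots> = ?f n + (\<Sum>k | k dvd N. ?f k)"
      using nN N0 by (subst sum.insert) auto
    finally have "?f n = 0" using eq by simp
    then show ?case using less.prems by simp
  qed
  have "\<exists>c. n \<noteq> 0 \<longrightarrow> augmentation (R n) = int n * c" for n
    using dvd_augmentation[of n "R n"] vanish[of n] by (meson dvdE)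
  then obtain c where c: "\<And>n. n \<noteq> 0 \<Longrightarrow> augmentation (R n) = int n * c n" by metis
  note aug = ring_hom_augmentation
  have ldG: "logderiv (map_fps augmentation G) $ n = - (\<Sum>k | k dvd n. int k * (int k * c k))" if "n \<noteq> 0" for n
  proof -
    have "logderiv (map_fps augmentation G) $ n = - (\<Sum>k | k dvd n. int k * augmentation (R k))"
      by (simp add: logderiv_map_fps[OF aug G] R[OF that] hom_minus[OF aug] hom_sum[OF aug] hom_mult[OF aug] hom_of_nat[OF aug])
    also have "(\<Sum>k | k dvd n. int k * augmentation (R k)) = (\<Sum>k | k dvd n. int k * (int k * c k))"
      using that by (intro sum.cong refl) (auto simp: c)
    finally show ?thesis .
  qed
  have "fps_cong (Suc K) (map_fps augmentation G) (\<Prod>k=1..K. unit_powi (1 - fps_X ^ k) (int k * c k))" for K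
  proof (rule logderiv_inj)
    let ?b = "\<lambda>k. 1 - fps_X ^ k :: int fps" and ?e = "\<lambda>k. int k * c k"
    have b: "unit_powi (?b k) (?e k) $ 0 = 1 \<and> ?b k $ 0 = 1" if "k \<in> {1..K}" for k
      using that by (simp add: unit_powi_nth_0)
    have ld: "logderiv (\<Prod>k=1..K. unit_powi (?b k) (?e k)) = (\<Sum>k=1..K. logderiv (unit_powi (?b k) (?e k)))"
      and "(\<Prod>k=1..K. unit_powi (?b k) (?e k)) $ 0 = 1"
      using logderiv_prod[of "{1..K}" "\<lambda>k. unit_powi (?b k) (?e k)"] b by simp_all
    then show "(\<Prod>k=1..K. unit_powi (?b k) (?e k)) $ 0 = 1" by simp
    show "map_fps augmentation G $ 0 = 1" by (simp add: G hom_1[OF aug])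
    fix n assume n: "1 \<le> n" "n \<le> K"
    have "logderiv (unit_powi (?b k) (?e k)) $ n = (if k dvd n then - (int k * (int k * c k)) else 0)"
      if k: "k \<in> {1..K}" for k
    proof -
      have "logderiv (?b k) $ n = (if k dvd n then - int k else 0)"
        using logderiv_binomial[of k "1::int" n] k n by simp
      moreover have "logderiv (unit_powi (?b k) (?e k)) $ n = ?e k * logderiv (?b k) $ n"
        using logderiv_unit_powi[of "?b k" "?e k"] b[OF k]
        by (simp flip: fps_of_int)
      ultimately show ?thesis by simp
    qed
    then have "logderiv (\<Prod>k=1..K. unit_powi (?b k) (?e k)) $ n =
      (\<Sum>k=1..K. if k dvd n then - (int k * (int k * c k)) else 0)"
      unfolding ld fps_sum_nth by (intro sum.cong) simp_all
    also have "\<dots> = (\<Sum>k\<in>{k \<in> {1..K}. k dvd n}. - (int k * (int k * c k)))"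
      by (rule sum.inter_filter[symmetric]) simp
    also have "{k \<in> {1..K}. k dvd n} = {k. k dvd n}"
      using n by (auto dest: dvd_imp_le intro: Nat.gr0I)
    finally show "logderiv (map_fps augmentation G) $ n = logderiv (\<Prod>k=1..K. unit_powi (?b k) (?e k)) $ n"
      using n by (simp add: ldG sum_negf)
  qed
  then show ?thesis by blast
qed

lemma map_fps_scale:
  assumes h: "ring_hom h"
  shows "map_fps h (fps_scale c f) = fps_scale (h c) (map_fps h f)"
  by (rule fps_ext) (simp add: hom_mult[OF h] hom_power[OF h])

text \<open>
  The factorization at \<open>q = 1\<close>. The sign makes the hypothesis of \<open>product_expansion\<close> hold exactly, also
  for roots of unity of even order.
\<close>

theorem classical_factorization:
  obtains f :: "nat \<times> nat \<Rightarrow> int fps" where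
    "\<forall>v. f v $ 0 = 1"
    "\<And>N. agree (Suc N) (ordered_prod (\<lambda>_. 1) m f (dir_list N)) (base_kernel (\<lambda>_. 1) m)"
    "\<And>v. primitive v \<Longrightarrow> \<exists>c :: nat \<Rightarrow> int. \<forall>K. fps_cong (Suc K)
       (fps_scale ((- 1) ^ (m * fst v * snd v)) (f v)) (\<Prod>k=1..K. unit_powi (1 - fps_X ^ k) (int k * c k))"
proof -
  obtain g :: "nat \<times> nat \<Rightarrow> qlaurent fps" where g: "\<forall>v. g v $ 0 = 1"
    and fact: "\<And>N. agree (Suc N) (ordered_prod qmon m g (dir_list N)) (base_kernel qmon m)"
    and res: "\<And>v \<xi> d. primitive v \<Longrightarrow> \<xi> \<noteq> 0 \<Longrightarrow> root_of_unity_character (\<lambda>i. \<xi> powi i) d \<Longrightarrow>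
       root_of_unity_character.residual (\<lambda>i. \<xi> powi i) d (m * fst v * snd v) (map_fps (qeval \<xi>) (g v))
         = map_fps (qeval 1) (g v)"
    by (rule quantum_factorization[of m]) (rule that)
  note aug = ring_hom_augmentation
  let ?f = "\<lambda>v. map_fps augmentation (g v)"
  have f0: "\<forall>v. ?f v $ 0 = 1" using g by (simp add: hom_1[OF aug])
  have f: "agree (Suc N) (ordered_prod (\<lambda>_. 1) m ?f (dir_list N)) (base_kernel (\<lambda>_. 1) m)" for N
  proof -
    have "agree (Suc N) (\<lambda>u w. augmentation (ordered_prod qmon m g (dir_list N) u w))
        (\<lambda>u w. augmentation (base_kernel qmon m u w))"
      using fact[of N] by (simp add: agree_def)
    moreover have "augmentation (qmon i) = 1" for i by (simp add: qmon_def)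
    ultimately show ?thesis
      by (simp add: hom_ordered_prod[OF aug character_qmon g] hom_base_kernel[OF aug character_qmon])
  qed
  have prod: "\<exists>c :: nat \<Rightarrow> int. \<forall>K. fps_cong (Suc K) (fps_scale ((- 1) ^ (m * fst v * snd v)) (?f v))
      (\<Prod>k=1..K. unit_powi (1 - fps_X ^ k) (int k * c k))" if v: "primitive v" for v
  proof -
    let ?e = "m * fst v * snd v"
    let ?G = "fps_scale ((- 1) ^ ?e) (g v)"
    have sign: "h ((- 1) ^ ?e) = (- 1) ^ ?e" if "ring_hom h" for h :: "qlaurent \<Rightarrow> 'a::comm_ring_1"
      by (simp add: hom_power[OF that] hom_minus[OF that] hom_1[OF that])
    have "logderiv (map_fps (qeval \<xi>) ?G) $ (d * N) = logderiv (map_fps (qeval 1) ?G) $ N"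
      if \<xi>: "\<xi> \<noteq> 0" and ch: "root_of_unity_character (\<lambda>i. \<xi> powi i) d" for \<xi> d N
    proof -
      interpret root_of_unity_character "\<lambda>i. \<xi> powi i" d by (fact ch)
      have "map_fps (qeval \<xi>) (g v) $ 0 = 1" using g by (simp add: hom_1[OF ring_hom_qeval[OF \<xi>]])
      then have "logderiv (fps_scale ((- 1) ^ ?e) (map_fps (qeval \<xi>) (g v))) $ (d * N) =
          logderiv (fps_scale ((- 1) ^ ?e) (map_fps (qeval 1) (g v))) $ N"
        using d unfolding res[OF v \<xi> ch, symmetric] by (intro logderiv_scaled_residual) simp_all
      then show ?thesis
        by (simp add: map_fps_scale ring_hom_qeval \<xi> sign)
    qed
    moreover have "?G $ 0 = 1" using g by simp
    ultimately have "\<exists>c :: nat \<Rightarrow> int. \<forall>K. fps_cong (Suc K) (map_fps augmentation ?G)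
        (\<Prod>k=1..K. unit_powi (1 - fps_X ^ k) (int k * c k))"
      by (intro product_expansion) blast+
    then show ?thesis by (simp add: map_fps_scale[OF aug] sign[OF aug])
  qed
  show thesis by (rule that[OF f0 f prod])
qed

section \<open>Automorphisms of the power series ring\<close>

lemma finite_splits_exponent [simp]: "finite (splits n)" for n :: "'v \<Rightarrow>\<^sub>0 nat"
  using finite_antidiag[of n] by (simp add: antidiag_def splits_def)

lemma mps_coeff_mult: "mps_coeff (f * g) n = (\<Sum>(p, r)\<in>splits n. mps_coeff f p * mps_coeff g r)"
  by (simp add: times_mps.rep_eq antidiag_def splits_def)

lemma mps_coeff_add: "mps_coeff (f + g) n = mps_coeff f n + mps_coeff g n"
  by (simp add: plus_mps.rep_eq)

lemma mps_coeff_diff: "mps_coeff (f - g) n = mps_coeff f n - mps_coeff g n"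
  by (simp add: minus_mps.rep_eq)

lemma mps_coeff_0 [simp]: "mps_coeff 0 n = 0"
  by (simp add: zero_mps.rep_eq)

lemma mps_coeff_1: "mps_coeff 1 n = (if n = 0 then 1 else 0)"
  by (simp add: one_mps.rep_eq)

lemma mps_coeff_const: "mps_coeff (mps_const c) n = (if n = 0 then c else 0)"
  by (simp add: mps_const.rep_eq)

lemma mps_coeff_var: "mps_coeff (mps_var v) n = (if n = single v 1 then 1 else 0)"
  by (simp add: mps_var.rep_eq)

lemma mps_coeff_Abs [simp]: "mps_coeff (Abs_mps f) = f"
  by (simp add: Abs_mps_inverse)

lemma mps_coeff_sum: "mps_coeff (sum f S) n = (\<Sum>x\<in>S. mps_coeff (f x) n)"
  by (induction S rule: infinite_finite_induct) (simp_all add: mps_coeff_add)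

lemma mps_coeff_const_mult: "mps_coeff (mps_const c * f) n = c * mps_coeff f n"
proof -
  have "mps_coeff (mps_const c * f) n = (\<Sum>(p, r)\<in>splits n. if p = 0 then c * mps_coeff f r else 0)"
    unfolding mps_coeff_mult by (rule sum_splits_cong) (simp add: mps_coeff_const)
  then show ?thesis by (simp only: sum_splits_delta_left finite_splits_exponent)
qed

lemma ring_hom_mps_const: "ring_hom (mps_const :: 'a::comm_ring_1 \<Rightarrow> ('v, 'a) mps)"
proof -
  have "mps_const (x * y) = (mps_const x * mps_const y :: ('v, 'a) mps)" for x y :: 'a
    by (rule mps_eqI) (simp add: mps_coeff_const_mult mps_coeff_const)
  moreover have "mps_const (x + y) = (mps_const x + mps_const y :: ('v, 'a) mps)" for x y :: 'a
    by (rule mps_eqI) (simp add: mps_coeff_add mps_coeff_const)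
  moreover have "mps_const 1 = (1 :: ('v, 'a) mps)"
    by (rule mps_eqI) (simp add: mps_coeff_1 mps_coeff_const)
  ultimately show ?thesis by (simp add: ring_hom_def)
qed

lemma total_degree_eq: "total_degree n = (\<Sum>v\<in>UNIV. lookup n v)" for n :: "'v::finite \<Rightarrow>\<^sub>0 nat"
  unfolding total_degree_def by (rule sum.mono_neutral_left) (auto simp: in_keys_iff)

lemma total_degree_add [simp]:
  "total_degree (p + r) = total_degree p + total_degree r" for p r :: "'v::finite \<Rightarrow>\<^sub>0 nat"
  by (simp add: total_degree_eq lookup_add sum.distrib)

lemma total_degree_eq_0_iff [simp]: "total_degree n = 0 \<longleftrightarrow> n = 0" for n :: "'v::finite \<Rightarrow>\<^sub>0 nat"
  by (auto simp: total_degree_eq intro: poly_mapping_eqI)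

lemma total_degree_single [simp]: "total_degree (single v k) = k" for v :: "'v::finite"
  by (simp add: total_degree_def)

lemma mps_coeff_power_eq_0:
  fixes g :: "('v::finite, 'a::comm_ring_1) mps"
  assumes "mps_coeff g 0 = 0"
  shows "total_degree n < k \<Longrightarrow> mps_coeff (g ^ k) n = 0"
proof (induction k arbitrary: n)
  case (Suc k)
  have "mps_coeff g p * mps_coeff (g ^ k) r = 0" if "p + r = n" for p r
  proof (cases "p = 0")
    case False
    then have "0 < total_degree p" by (metis gr0I total_degree_eq_0_iff)
    then have "total_degree r < k" using Suc.prems that[symmetric] by simp
    then show ?thesis using Suc.IH by simp
  qed (simp add: assms)
  then have "(\<Sum>(p, r)\<in>splits n. mps_coeff g p * mps_coeff (g ^ k) r) = (\<Sum>(p, r)\<in>splits n. 0)"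
    by (intro sum_splits_cong)
  then show ?case by (simp add: mps_coeff_mult)
qed simp

text \<open>
  Geometric series; in each degree finitely many powers of \<open>1 - f\<close> contribute.
\<close>

lemma mps_unit:
  fixes f :: "('v::finite, 'a::comm_ring_1) mps"
  assumes f: "mps_coeff f 0 = 1"
  shows "f dvd 1"
proof -
  let ?g = "1 - f"
  have g0: "mps_coeff ?g 0 = 0" by (simp add: mps_coeff_diff mps_coeff_1 f)
  define h where "h = Abs_mps (\<lambda>n. mps_coeff (\<Sum>k\<le>total_degree n. ?g ^ k) n)"
  have h: "mps_coeff h n = mps_coeff (\<Sum>k\<le>N. ?g ^ k) n" if "total_degree n \<le> N" for n N
  proof -
    have "(\<Sum>k\<le>N. mps_coeff (?g ^ k) n) = (\<Sum>k\<le>total_degree n. mps_coeff (?g ^ k) n)"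
      using that by (intro sum.mono_neutral_right) (auto intro: mps_coeff_power_eq_0[OF g0])
    then show ?thesis by (simp add: h_def mps_coeff_sum)
  qed
  have "f * h = 1"
  proof (rule mps_eqI)
    fix n :: "'v \<Rightarrow>\<^sub>0 nat"
    let ?N = "total_degree n"
    have "mps_coeff (f * h) n = mps_coeff (f * (\<Sum>k\<le>?N. ?g ^ k)) n"
      unfolding mps_coeff_mult
    proof (rule sum_splits_cong)
      fix p r assume "p + r = n"
      then have "total_degree r \<le> ?N" by auto
      from h[OF this] show "mps_coeff f p * mps_coeff h r = mps_coeff f p * mps_coeff (\<Sum>k\<le>?N. ?g ^ k) r"
        by simp
    qed
    also have "f * (\<Sum>k\<le>?N. ?g ^ k) = 1 - ?g ^ Suc ?N"
      using one_diff_power_eq[of ?g "Suc ?N"] by (simp add: lessThan_Suc_atMost)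
    also have "mps_coeff \<dots> n = mps_coeff 1 n"
      using mps_coeff_power_eq_0[OF g0, of n "Suc ?N"] by (simp only: mps_coeff_diff) simp
    finally show "mps_coeff (f * h) n = mps_coeff 1 n" .
  qed
  then show ?thesis by (metis dvdI)
qed

lemma mps_coeff_var_mult:
  "mps_coeff (mps_var v * g) n = (if lookup n v = 0 then 0 else mps_coeff g (n - single v 1))"
  for g :: "('v, 'a::comm_ring_1) mps"
proof -
  let ?e = "single v (1::nat)"
  have decomp: "?e + r = n \<longleftrightarrow> lookup n v \<noteq> 0 \<and> r = n - ?e" for r
  proof
    assume "?e + r = n"
    then show "lookup n v \<noteq> 0 \<and> r = n - ?e" by (auto simp: lookup_add)
  next
    assume n: "lookup n v \<noteq> 0 \<and> r = n - ?e"
    show "?e + r = n"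
      by (rule poly_mapping_eqI) (use n in \<open>auto simp: lookup_add lookup_minus lookup_single when_def\<close>)
  qed
  have "mps_coeff (mps_var v * g) n =
    (\<Sum>z\<in>splits n. if z = (?e, n - ?e) then mps_coeff g (n - ?e) else 0)"
    unfolding mps_coeff_mult
  proof (rule sum.cong[OF refl])
    fix z assume z: "z \<in> splits n"
    obtain p r where pr: "z = (p, r)" by (cases z)
    have "r = n - ?e" if "p = ?e" using z decomp that by (auto simp: pr splits_def)
    then show "(case z of (p, r) \<Rightarrow> mps_coeff (mps_var v) p * mps_coeff g r) =
      (if z = (?e, n - ?e) then mps_coeff g (n - ?e) else 0)"
      by (auto simp: pr mps_coeff_var)
  qed
  also have "\<dots> = (if (?e, n - ?e) \<in> splits n then mps_coeff g (n - ?e) else 0)"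
    by simp
  also have "(?e, n - ?e) \<in> splits n \<longleftrightarrow> lookup n v \<noteq> 0"
    using decomp[of "n - ?e"] by (simp add: splits_def)
  finally show ?thesis by simp
qed

lemma mps_decompose:
  fixes z :: "('v::finite, 'a::comm_ring_1) mps"
  shows "\<exists>y. z = mps_const (mps_coeff z 0) + (\<Sum>v\<in>UNIV. mps_var v * y v)"
proof -
  define c :: "('v \<Rightarrow>\<^sub>0 nat) \<Rightarrow> 'v" where "c n = (SOME v. lookup n v \<noteq> 0)" for n
  have c: "lookup n (c n) \<noteq> 0" if "n \<noteq> 0" for n
  proof -
    have "\<exists>v. lookup n v \<noteq> 0" using that by (metis lookup_zero poly_mapping_eqI)
    then show ?thesis unfolding c_def by (rule someI_ex)
  qed
  define y where "y v = Abs_mps (\<lambda>r. if c (r + single v 1) = v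
    then mps_coeff z (r + single v 1) else 0)" for v
  have "z = mps_const (mps_coeff z 0) + (\<Sum>v\<in>UNIV. mps_var v * y v)"
  proof (rule mps_eqI)
    fix n
    have "mps_coeff (mps_var v * y v) n = (if v = c n \<and> n \<noteq> 0 then mps_coeff z n else 0)" for v
    proof (cases "lookup n v = 0")
      case True
      then show ?thesis using c[of n] by (auto simp: mps_coeff_var_mult)
    next
      case False
      then have "n - single v 1 + single v 1 = n"
        by (intro poly_mapping_eqI) (auto simp: lookup_add lookup_minus lookup_single when_def)
      moreover have "n \<noteq> 0" using False by auto
      ultimately show ?thesis using False by (auto simp: mps_coeff_var_mult y_def)
    qed
    then have "(\<Sum>v\<in>UNIV. mps_coeff (mps_var v * y v) n) = (if n \<noteq> 0 then mps_coeff z n else 0)"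
      by simp
    then show "mps_coeff z n = mps_coeff (mps_const (mps_coeff z 0) + (\<Sum>v\<in>UNIV. mps_var v * y v)) n"
      by (simp add: mps_coeff_add mps_coeff_sum mps_coeff_const)
  qed
  then show ?thesis by blast
qed

text \<open>
  Continuity is automatic: a series without constant term is a combination of the finitely many variables
  (\<open>mps_decompose\<close>), so two such endomorphisms that agree up to some order agree up to the next one.
\<close>

lemma mps_hom_eqI:
  fixes \<phi> \<phi>' :: "('v::finite, 'a::comm_ring_1) mps \<Rightarrow> ('v, 'a) mps"
  assumes \<phi>: "ring_hom \<phi>" and \<phi>': "ring_hom \<phi>'"
    and var: "\<And>v. \<phi> (mps_var v) = mps_var v" "\<And>v. \<phi>' (mps_var v) = mps_var v"
    and const: "\<And>c. \<phi> (mps_const c) = \<phi>' (mps_const c)"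
  shows "\<phi> = \<phi>'"
proof
  fix z
  have "mps_coeff (\<phi> z) n = mps_coeff (\<phi>' z) n" if "total_degree n < N" for N n z
    using that
  proof (induction N arbitrary: z n)
    case (Suc N)
    obtain y where z: "z = mps_const (mps_coeff z 0) + (\<Sum>v\<in>UNIV. mps_var v * y v)"
      using mps_decompose by blast
    have e: "\<psi> z = \<psi> (mps_const (mps_coeff z 0)) + (\<Sum>v\<in>UNIV. mps_var v * \<psi> (y v))"
      if \<psi>: "ring_hom \<psi>" and "\<And>v. \<psi> (mps_var v) = mps_var v" for \<psi>
      by (subst z) (simp add: hom_add[OF \<psi>] hom_sum[OF \<psi>] hom_mult[OF \<psi>] that)
    have "mps_coeff (mps_var v * \<phi> (y v)) n = mps_coeff (mps_var v * \<phi>' (y v)) n" for v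
    proof (cases "lookup n v = 0")
      case False
      then have "single v 1 + (n - single v 1) = n"
        by (intro poly_mapping_eqI) (auto simp: lookup_add lookup_minus lookup_single when_def)
      then have "total_degree (single v 1 + (n - single v 1)) = total_degree n"
        by simp
      then have "total_degree (n - single v 1) < N" using Suc.prems by simp
      then show ?thesis using Suc.IH by (simp add: mps_coeff_var_mult)
    qed (simp add: mps_coeff_var_mult)
    then show ?case
      unfolding e[OF \<phi> var(1)] e[OF \<phi>' var(2)] const by (simp add: mps_coeff_add mps_coeff_sum)
  qed simp
  then show "\<phi> z = \<phi>' z" by (blast intro: mps_eqI)
qed

text \<open>
  The continuous extension of a map on the coefficients that fixes all variables.
\<close>

definition mps_ext :: "('a::comm_ring_1 \<Rightarrow> ('v, 'a) mps) \<Rightarrow> ('v, 'a) mps \<Rightarrow> ('v, 'a) mps" where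
  "mps_ext \<psi> z = Abs_mps (\<lambda>n. \<Sum>(p, r)\<in>splits n. mps_coeff (\<psi> (mps_coeff z p)) r)"

lemma mps_coeff_ext: "mps_coeff (mps_ext \<psi> z) n = (\<Sum>(p, r)\<in>splits n. mps_coeff (\<psi> (mps_coeff z p)) r)"
  by (simp add: mps_ext_def)

lemma mps_ext_const:
  assumes \<psi>: "ring_hom \<psi>"
  shows "mps_ext \<psi> (mps_const c) = \<psi> c"
proof (rule mps_eqI)
  fix n
  have "mps_coeff (mps_ext \<psi> (mps_const c)) n = (\<Sum>(p, r)\<in>splits n. if p = 0 then mps_coeff (\<psi> c) r else 0)"
    unfolding mps_coeff_ext by (rule sum_splits_cong) (simp add: mps_coeff_const hom_0[OF \<psi>])
  then show "mps_coeff (mps_ext \<psi> (mps_const c)) n = mps_coeff (\<psi> c) n"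
    by (simp only: sum_splits_delta_left finite_splits_exponent)
qed

lemma mps_ext_fixes:
  assumes \<psi>: "ring_hom \<psi>" and const: "\<And>n. \<psi> (mps_coeff z n) = mps_const (mps_coeff z n)"
  shows "mps_ext \<psi> z = z"
proof (rule mps_eqI)
  fix n
  have "mps_coeff (mps_ext \<psi> z) n = (\<Sum>(p, r)\<in>splits n. if r = 0 then mps_coeff z p else 0)"
    unfolding mps_coeff_ext by (rule sum_splits_cong) (simp add: const mps_coeff_const)
  then show "mps_coeff (mps_ext \<psi> z) n = mps_coeff z n"
    by (simp only: sum_splits_delta_right finite_splits_exponent)
qed

lemma mps_ext_var:
  assumes \<psi>: "ring_hom \<psi>"
  shows "mps_ext \<psi> (mps_var v) = mps_var v"
  by (rule mps_ext_fixes[OF \<psi>])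
    (simp add: mps_coeff_var hom_0[OF \<psi>] hom_1[OF \<psi>] hom_0[OF ring_hom_mps_const] hom_1[OF ring_hom_mps_const])

lemma ring_hom_mps_ext:
  fixes \<psi> :: "'a::comm_ring_1 \<Rightarrow> ('v, 'a) mps"
  assumes \<psi>: "ring_hom \<psi>"
  shows "ring_hom (mps_ext \<psi>)"
proof -
  have "mps_ext \<psi> (x * y) = mps_ext \<psi> x * mps_ext \<psi> y" for x y
  proof (rule mps_eqI)
    fix n
    let ?F = "\<lambda>p p' r r'. mps_coeff (\<psi> (mps_coeff x p)) r * mps_coeff (\<psi> (mps_coeff y p')) r'"
    have "mps_coeff (mps_ext \<psi> (x * y)) n =
      (\<Sum>(P, R)\<in>splits n. \<Sum>(p, p')\<in>splits P. \<Sum>(r, r')\<in>splits R. ?F p p' r r')"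
      unfolding mps_coeff_ext mps_coeff_mult hom_sum[OF \<psi>] mps_coeff_sum
      by (simp add: case_prod_unfold hom_mult[OF \<psi>] mps_coeff_mult)
    also have "\<dots> = (\<Sum>(s, s')\<in>splits n. \<Sum>(p, r)\<in>splits s. \<Sum>(p', r')\<in>splits s'. ?F p p' r r')"
      by (rule sum_splits_regroup[OF finite_splits_exponent])
    also have "\<dots> = mps_coeff (mps_ext \<psi> x * mps_ext \<psi> y) n"
      unfolding mps_coeff_mult mps_coeff_ext sum_product by (simp add: case_prod_unfold)
    finally show "mps_coeff (mps_ext \<psi> (x * y)) n = mps_coeff (mps_ext \<psi> x * mps_ext \<psi> y) n" .
  qed
  moreover have "mps_ext \<psi> (x + y) = mps_ext \<psi> x + mps_ext \<psi> y" for x y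
    by (rule mps_eqI) (simp add: mps_coeff_ext mps_coeff_add hom_add[OF \<psi>] sum.distrib case_prod_unfold)
  moreover have "mps_ext \<psi> 1 = 1"
    using mps_ext_const[OF \<psi>, of 1] by (simp add: hom_1[OF \<psi>] hom_1[OF ring_hom_mps_const])
  ultimately show ?thesis by (simp add: ring_hom_def)
qed

text \<open>
  The substitution \<open>x \<mapsto> x f\<^sup>-\<^sup>b\<close>, \<open>y \<mapsto> y f\<^sup>a\<close> on Laurent polynomials, with values in any commutative algebra \<open>\<iota>\<close>
  over them that contains the unit \<open>f\<close>.
\<close>

definition slope_subst :: "(laurent \<Rightarrow> 'r::comm_ring_1) \<Rightarrow> int \<Rightarrow> int \<Rightarrow> 'r \<Rightarrow> laurent \<Rightarrow> 'r" where
  "slope_subst \<iota> a b f = pm_lift (\<lambda>u c. \<iota> (single u c) * unit_powi f (a * snd u - b * fst u))"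

context
  fixes \<iota> :: "laurent \<Rightarrow> 'r::comm_ring_1"
  assumes \<iota>: "ring_hom \<iota>"
begin

lemma ring_hom_slope_subst:
  assumes f: "f dvd 1"
  shows "ring_hom (slope_subst \<iota> a b f)"
  unfolding slope_subst_def
proof (rule ring_hom_pm_lift)
  fix u u' :: "int \<times> int" and c c' :: rat
  show "\<iota> (single u (c + c')) * unit_powi f (a * snd u - b * fst u) =
    \<iota> (single u c) * unit_powi f (a * snd u - b * fst u) +
    \<iota> (single u c') * unit_powi f (a * snd u - b * fst u)"
    by (simp add: single_add hom_add[OF \<iota>] distrib_right)
  have j: "a * snd (u + u') - b * fst (u + u') = (a * snd u - b * fst u) + (a * snd u' - b * fst u')"
    by (simp add: algebra_simps)
  have "single (u + u') (c * c') = single u c * single u' c'"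
    by (simp add: mult_single)
  then show "\<iota> (single (u + u') (c * c')) * unit_powi f (a * snd (u + u') - b * fst (u + u')) =
    \<iota> (single u c) * unit_powi f (a * snd u - b * fst u) *
    (\<iota> (single u' c') * unit_powi f (a * snd u' - b * fst u'))"
    unfolding j by (simp only: hom_mult[OF \<iota>] unit_powi_add[OF f] mult_ac)
  show "\<iota> (single 0 1) * unit_powi f (a * snd 0 - b * fst 0) = 1"
    by (simp add: hom_1[OF \<iota>])
qed

lemma slope_subst_single:
  "slope_subst \<iota> a b f (single u c) = \<iota> (single u c) * unit_powi f (a * snd u - b * fst u)"
  unfolding slope_subst_def by (rule pm_lift_single) (simp add: hom_0[OF \<iota>])

lemma slope_subst_invariant:
  assumes "\<And>u. u \<in> keys c \<Longrightarrow> a * snd u = b * fst u"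
  shows "slope_subst \<iota> a b f c = \<iota> c"
proof -
  have "slope_subst \<iota> a b f c = pm_lift (\<lambda>u c. \<iota> (single u c)) c"
    unfolding slope_subst_def pm_lift_def using assms by (intro sum.cong refl) simp
  also have "\<dots> = \<iota> c"
    by (induction c rule: pm_induct)
      (simp_all add: pm_lift_single pm_lift_add hom_0[OF \<iota>] hom_add[OF \<iota>] single_add)
  finally show ?thesis .
qed

lemma hom_slope_subst:
  assumes h: "ring_hom h" and f: "f dvd 1"
  shows "h (slope_subst \<iota> a b f c) = slope_subst (\<lambda>c. h (\<iota> c)) a b (h f) c"
  by (simp add: slope_subst_def pm_lift_def hom_sum[OF h] hom_mult[OF h]
      unit_powi_hom[OF f hom_1[OF h] hom_mult[OF h]])

end

definition laurent_aut :: "int \<Rightarrow> int \<Rightarrow> 'm B \<Rightarrow> 'm B \<Rightarrow> 'm B" where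
  "laurent_aut a b f = mps_ext (slope_subst mps_const a b f)"

lemma slope_series_unit: "f \<in> slope_series a b \<Longrightarrow> f dvd 1" for f :: "'m::finite B"
  by (intro mps_unit) (simp add: slope_series_def)

lemma ring_hom_laurent_aut: "h dvd 1 \<Longrightarrow> ring_hom (laurent_aut a b h :: 'm::finite B \<Rightarrow> 'm B)"
  unfolding laurent_aut_def by (intro ring_hom_mps_ext ring_hom_slope_subst ring_hom_mps_const)

text \<open>
  The monomials of \<open>f\<close> are powers of \<open>x\<^sup>ay\<^sup>b\<close>, which every substitution of this slope fixes. Therefore the
  substitutions with \<open>f\<close> and with the inverse of \<open>f\<close> undo each other.
\<close>

lemma laurent_aut_invariant:
  fixes f :: "'m::finite B"
  assumes f: "f \<in> slope_series a b" and h: "h dvd 1"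
  shows "laurent_aut a b h f = f"
  unfolding laurent_aut_def
proof (rule mps_ext_fixes)
  show "ring_hom (slope_subst mps_const a b h)" by (intro ring_hom_slope_subst ring_hom_mps_const h)
  fix n
  show "slope_subst mps_const a b h (mps_coeff f n) = mps_const (mps_coeff f n)"
  proof (rule slope_subst_invariant[OF ring_hom_mps_const])
    fix u assume "u \<in> keys (mps_coeff f n)"
    moreover have "keys (mps_coeff f n) \<subseteq> insert 0 {(int k * a, int k * b) |k. k \<ge> 1}"
      using f by (cases "n = 0") (simp_all add: slope_series_def subset_insertI2)
    ultimately have "u = 0 \<or> (\<exists>k. u = (int k * a, int k * b))" by blast
    then show "a * snd u = b * fst u" by auto
  qed
qed

lemma laurent_aut_const:
  assumes h: "h dvd 1"
  shows "laurent_aut a b h (mps_const c :: 'm::finite B) = slope_subst mps_const a b h c"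
  unfolding laurent_aut_def by (intro mps_ext_const ring_hom_slope_subst ring_hom_mps_const h)

lemma laurent_aut_inverse:
  fixes z :: "'m::finite B"
  assumes "g dvd 1" "h dvd 1" and gh: "g * h = 1" and inv: "laurent_aut a b g h = h"
  shows "laurent_aut a b g (laurent_aut a b h z) = z"
proof -
  note G = ring_hom_laurent_aut[OF assms(1), of a b] and H = ring_hom_laurent_aut[OF assms(2), of a b]
  have "(\<lambda>z. laurent_aut a b g (laurent_aut a b h z)) = (\<lambda>z :: 'm B. z)"
  proof (rule mps_hom_eqI)
    show "ring_hom (\<lambda>z :: 'm B. laurent_aut a b g (laurent_aut a b h z))"
      unfolding ring_hom_def
      by (simp add: hom_1[OF G] hom_1[OF H] hom_add[OF G] hom_add[OF H] hom_mult[OF G] hom_mult[OF H])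
    show "ring_hom (\<lambda>z :: 'm B. z)" by (simp add: ring_hom_def)
    show "laurent_aut a b g (laurent_aut a b h (mps_var v)) = mps_var v" for v :: "'m + 'm"
      using assms by (simp add: laurent_aut_def mps_ext_var ring_hom_slope_subst ring_hom_mps_const)
    fix c
    show "laurent_aut a b g (laurent_aut a b h (mps_const c)) = (mps_const c :: 'm B)"
    proof (induction c rule: pm_induct)
      case (single u c)
      let ?j = "a * snd u - b * fst u"
      have "laurent_aut a b g (laurent_aut a b h (mps_const (single u c))) =
        mps_const (single u c) * (unit_powi g ?j * laurent_aut a b g (unit_powi h ?j))"
        by (simp add: laurent_aut_const assms(1,2) slope_subst_single[OF ring_hom_mps_const] hom_mult[OF G] mult.assoc)
      also have "laurent_aut a b g (unit_powi h ?j) = unit_powi h ?j"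
        using unit_powi_hom[OF assms(2) hom_1[OF G] hom_mult[OF G]] inv by simp
      also have "unit_powi g ?j * unit_powi h ?j = 1"
        unfolding unit_powi_prod[OF assms(1,2), symmetric] gh by simp
      finally show ?case by simp
    next
      case (add p q)
      then show ?case by (simp add: hom_add[OF ring_hom_mps_const] hom_add[OF G] hom_add[OF H])
    qed
  qed simp_all
  then show ?thesis by (rule fun_cong)
qed

lemma laurent_aut_in_Aut:
  fixes f :: "'m::finite B"
  assumes f: "f \<in> slope_series a b"
  shows "laurent_aut a b f \<in> Aut_R"
proof -
  note u = slope_series_unit[OF f]
  note F = ring_hom_laurent_aut[OF u, of a b]
  obtain g where fg: "f * g = 1" using u by (metis dvdE)
  then have gf: "g * f = 1" by (simp add: mult.commute)
  then have g: "g dvd 1" by (metis dvdI)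
  have "f * laurent_aut a b f g = laurent_aut a b f (f * g)"
    by (simp add: hom_mult[OF F] laurent_aut_invariant[OF f u])
  then have "laurent_aut a b f g * f = g * f"
    by (simp add: fg gf hom_1[OF F] mult.commute)
  then have "laurent_aut a b f g = g" using u unit_cancel by blast
  then have "laurent_aut a b f (laurent_aut a b g z) = z" for z
    by (intro laurent_aut_inverse u g fg)
  moreover have "laurent_aut a b g (laurent_aut a b f z) = z" for z
    by (intro laurent_aut_inverse u g gf laurent_aut_invariant f)
  ultimately have "bij (laurent_aut a b f)" by (rule o_bij[rotated, OF ext ext, simplified o_def id_def])
  moreover have "laurent_aut a b f r = r" if "r \<in> Rsub" for r
    unfolding laurent_aut_def
  proof (rule mps_ext_fixes)
    show "ring_hom (slope_subst mps_const a b f)" by (intro ring_hom_slope_subst ring_hom_mps_const u)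
    show "slope_subst mps_const a b f (mps_coeff r n) = mps_const (mps_coeff r n)" for n
    proof (rule slope_subst_invariant[OF ring_hom_mps_const])
      fix v assume "v \<in> keys (mps_coeff r n)"
      then have "v = 0" using that by (auto simp only: Rsub_def mem_Collect_eq)
      then show "a * snd v = b * fst v" by simp
    qed
  qed
  ultimately show ?thesis
    using hom_add[OF F] hom_mult[OF F] by (simp add: Aut_R_def)
qed

lemma lx_unit: "lx dvd 1" and ly_unit: "ly dvd 1"
proof -
  have "lx * single (- 1, 0) 1 = 1" "ly * single (0, - 1) 1 = 1"
    by (simp_all add: lx_def ly_def mult_single flip: zero_prod_def)
  then show "lx dvd 1" "ly dvd 1" by (metis dvdI)+
qed

lemma single_powi: "single (i, j) 1 = unit_powi lx i * unit_powi ly j"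
proof -
  have "single (i, 0) 1 = unit_powi lx i"
    by (rule unit_powi_unique[OF lx_unit, where B = "\<lambda>i. single (i, 0) 1" and k = i])
      (simp_all add: lx_def mult_single flip: zero_prod_def)
  moreover have "single (0, j) 1 = unit_powi ly j"
    by (rule unit_powi_unique[OF ly_unit, where B = "\<lambda>j. single (0, j) 1" and k = j])
      (simp_all add: ly_def mult_single flip: zero_prod_def)
  moreover have "single (i, j) (1::rat) = single (i, 0) 1 * single (0, j) 1"
    by (simp add: mult_single)
  ultimately show ?thesis by simp
qed

lemma hom_unit:
  assumes h: "ring_hom h" and "u dvd 1"
  shows "h u dvd 1"
proof -
  obtain v where "u * v = 1" using assms(2) by (metis dvdE)
  then have "h u * h v = 1" by (simp only: hom_1[OF h] flip: hom_mult[OF h])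
  then show ?thesis by (metis dvdI)
qed

lemma Bx_unit: "Bx dvd 1" and By_unit: "By dvd 1"
  unfolding Bx_def By_def 
  by (rule hom_unit[OF ring_hom_mps_const lx_unit] hom_unit[OF ring_hom_mps_const ly_unit])+

lemma const_single_powi: "mps_const (single (i, j) 1) = unit_powi Bx i * unit_powi By j"
proof -
  note h = ring_hom_mps_const
  show ?thesis
    unfolding Bx_def By_def single_powi hom_mult[OF h]
      unit_powi_hom[OF lx_unit hom_1[OF h] hom_mult[OF h]] unit_powi_hom[OF ly_unit hom_1[OF h] hom_mult[OF h]] ..
qed

text \<open>
  An \<open>R\<close>-linear automorphism fixes the variables and the rational constants, and a ring endomorphism
  of the Laurent polynomials is determined by the images of \<open>x\<close> and \<open>y\<close>.
\<close>

lemma T_eq: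
  fixes f :: "'m::finite B"
  assumes f: "f \<in> slope_series a b"
  shows "T a b f = laurent_aut a b f"
  unfolding T_def
proof (rule the_equality)
  note u = slope_series_unit[OF f]
  have val: "laurent_aut a b f Bx = Bx * unit_powi f (- b)" "laurent_aut a b f By = By * unit_powi f a"
    unfolding Bx_def By_def lx_def ly_def laurent_aut_const[OF u]
    by (simp_all add: slope_subst_single[OF ring_hom_mps_const])
  then show "laurent_aut a b f \<in> Aut_R \<and> laurent_aut a b f Bx = Bx * unit_powi f (- b) \<and>
      laurent_aut a b f By = By * unit_powi f a"
    using laurent_aut_in_Aut[OF f] by blast
  fix \<phi> assume \<phi>: "\<phi> \<in> Aut_R \<and> \<phi> Bx = Bx * unit_powi f (- b) \<and> \<phi> By = By * unit_powi f a"
  have aut: "ring_hom \<psi> \<and> (\<forall>v. \<psi> (mps_var v) = mps_var v) \<and>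
      (\<forall>c. \<psi> (mps_const (single 0 c)) = mps_const (single 0 c))"
    if \<psi>: "\<psi> \<in> Aut_R" for \<psi> :: "'m B \<Rightarrow> 'm B"
  proof -
    have R: "(mps_var v :: 'm B) \<in> Rsub" "(mps_const (single 0 c) :: 'm B) \<in> Rsub" for v :: "'m + 'm" and c
      by (auto simp: Rsub_def mps_coeff_var mps_coeff_const)
    have "(1 :: 'm B) \<in> Rsub" by (auto simp: Rsub_def mps_coeff_1)
    then have "\<psi> 1 = 1" using \<psi> by (simp add: Aut_R_def)
    then show ?thesis using \<psi> R by (simp add: Aut_R_def ring_hom_def)
  qed
  note P = aut[OF conjunct1[OF \<phi>]] and L = aut[OF laurent_aut_in_Aut[OF f]]
  note hP = conjunct1[OF P] and hL = conjunct1[OF L]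
  have "\<phi> (mps_const c) = laurent_aut a b f (mps_const c)" for c
  proof (induction c rule: pm_induct)
    case (single u c)
    have "mps_const (single u c) =
        mps_const (single 0 c) * (unit_powi Bx (fst u) * unit_powi By (snd u) :: 'm B)"
      by (simp flip: const_single_powi hom_mult[OF ring_hom_mps_const] add: mult_single)
    moreover have "\<phi> (unit_powi Bx i) = laurent_aut a b f (unit_powi Bx i)"
      "\<phi> (unit_powi By i) = laurent_aut a b f (unit_powi By i)" for i
      using \<phi> val by (simp_all add: unit_powi_hom[OF Bx_unit hom_1[OF hP] hom_mult[OF hP]]
          unit_powi_hom[OF By_unit hom_1[OF hP] hom_mult[OF hP]]
          unit_powi_hom[OF Bx_unit hom_1[OF hL] hom_mult[OF hL]]
          unit_powi_hom[OF By_unit hom_1[OF hL] hom_mult[OF hL]])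
    ultimately show ?case using P L by (simp add: hom_mult[OF hP] hom_mult[OF hL])
  next
    case (add p q)
    then show ?case by (simp add: hom_add[OF ring_hom_mps_const] hom_add[OF hP] hom_add[OF hL])
  qed
  then show "\<phi> = laurent_aut a b f"
    using P L by (intro mps_hom_eqI) blast+
qed

section \<open>Specialization to one variable\<close>

lemma finite_total_degree [simp]: "finite {n :: 'v::finite \<Rightarrow>\<^sub>0 nat. total_degree n = k}"
  by (rule finite_total_degree_eq)

lemma mps_diagonal_nth: "mps_diagonal f $ k = (\<Sum>n | total_degree n = k. mps_coeff f n)"
  by (simp add: mps_diagonal_def)

lemma total_degree_0_set: "{n :: 'v::finite \<Rightarrow>\<^sub>0 nat. total_degree n = 0} = {0}"
  by auto

lemma mps_diagonal_const:
  "mps_diagonal (mps_const c :: ('v::finite, 'a) mps) = fps_const (c :: 'a::comm_ring_1)"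
proof (rule fps_ext)
  fix k
  have "(\<Sum>n :: 'v \<Rightarrow>\<^sub>0 nat | total_degree n = k. if n = 0 then c else 0) = (if k = 0 then c else 0)"
    by (simp add: sum.delta) (simp add: total_degree_def)
  then show "mps_diagonal (mps_const c :: ('v, 'a) mps) $ k = fps_const c $ k"
    by (simp add: mps_diagonal_nth mps_coeff_const)
qed

lemma mps_diagonal_var: "mps_diagonal (mps_var v) = (fps_X :: 'a::comm_ring_1 fps)"
proof (rule fps_ext)
  fix k
  show "mps_diagonal (mps_var v) $ k = (fps_X :: 'a fps) $ k"
    by (auto simp: mps_diagonal_nth mps_coeff_var fps_X_def)
qed

lemma ring_hom_mps_diagonal:
  "ring_hom (mps_diagonal :: ('v::finite, 'a::comm_ring_1) mps \<Rightarrow> 'a fps)"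
proof -
  have "mps_diagonal (f * g) = mps_diagonal f * mps_diagonal g" for f g :: "('v, 'a) mps"
  proof (rule fps_ext)
    fix k
    show "mps_diagonal (f * g) $ k = (mps_diagonal f * mps_diagonal g) $ k"
      unfolding mps_diagonal_nth fps_mult_nth mps_coeff_mult sum_splits_by_degree[OF finite_splits_exponent finite_total_degree total_degree_add] sum_product ..
  qed
  moreover have "mps_diagonal (f + g) = mps_diagonal f + mps_diagonal g" for f g :: "('v, 'a) mps"
    by (rule fps_ext) (simp add: mps_diagonal_nth mps_coeff_add sum.distrib)
  moreover have "mps_diagonal (1 :: ('v, 'a) mps) = 1"
    using mps_diagonal_const[of "1 :: 'a", where 'v = 'v] by (simp add: hom_1[OF ring_hom_mps_const])
  ultimately show ?thesis by (simp add: ring_hom_def)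
qed

definition fps_extend :: "('a::comm_ring_1 \<Rightarrow> 'a fps) \<Rightarrow> 'a fps \<Rightarrow> 'a fps" where
  "fps_extend \<psi> z = Abs_fps (\<lambda>n. \<Sum>i=0..n. \<psi> (z $ i) $ (n - i))"

lemma fps_extend_nth: "fps_extend \<psi> z $ n = (\<Sum>i=0..n. \<psi> (z $ i) $ (n - i))"
  by (simp add: fps_extend_def)

lemma mps_diagonal_ext:
  fixes z :: "('v::finite, 'a::comm_ring_1) mps"
  assumes \<psi>: "ring_hom \<psi>"
  shows "mps_diagonal (mps_ext \<psi> z) = fps_extend (\<lambda>c. mps_diagonal (\<psi> c)) (mps_diagonal z)"
proof (rule fps_ext)
  fix k
  show "mps_diagonal (mps_ext \<psi> z) $ k = fps_extend (\<lambda>c. mps_diagonal (\<psi> c)) (mps_diagonal z) $ k"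
    unfolding mps_diagonal_nth fps_extend_nth mps_coeff_ext sum_splits_by_degree[OF finite_splits_exponent finite_total_degree total_degree_add] hom_sum[OF \<psi>] mps_coeff_sum
    by (rule sum.cong[OF refl]) (rule sum.swap)
qed

definition slope_op :: "int \<Rightarrow> int \<Rightarrow> laurent fps \<Rightarrow> laurent fps \<Rightarrow> laurent fps" where
  "slope_op a b h = fps_extend (slope_subst fps_const a b h)"

definition slope_ops :: "(nat \<times> nat \<Rightarrow> laurent fps) \<Rightarrow> (nat \<times> nat) list \<Rightarrow> laurent fps \<Rightarrow> laurent fps" where
  "slope_ops h ps = foldr (\<lambda>v \<phi>. slope_op (int (fst v)) (int (snd v)) (h v) \<circ> \<phi>) ps id"

lemma slope_ops_Nil [simp]: "slope_ops h [] z = z"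
  and slope_ops_Cons [simp]:
    "slope_ops h (v # ps) z = slope_op (int (fst v)) (int (snd v)) (h v) (slope_ops h ps z)"
  by (simp_all add: slope_ops_def)

lemma mps_diagonal_T:
  fixes f :: "'m::finite B"
  assumes f: "f \<in> slope_series a b"
  shows "mps_diagonal (T a b f z) = slope_op a b (mps_diagonal f) (mps_diagonal z)"
proof -
  note u = slope_series_unit[OF f]
  have "mps_diagonal (slope_subst mps_const a b f c) = slope_subst fps_const a b (mps_diagonal f) c" for c
    using hom_slope_subst[OF ring_hom_mps_const ring_hom_mps_diagonal u] by (simp add: mps_diagonal_const)
  then show ?thesis
    unfolding T_eq[OF f] laurent_aut_def slope_op_def
    by (simp add: mps_diagonal_ext ring_hom_slope_subst[OF ring_hom_mps_const u])
qed

lemma mps_diagonal_comp_list: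
  fixes f :: "nat \<Rightarrow> nat \<Rightarrow> 'm::finite B"
  assumes "\<And>a b. coprime a b \<Longrightarrow> f a b \<in> slope_series (int a) (int b)" and "\<forall>v\<in>set ps. primitive v"
  shows "mps_diagonal (comp_list f ps z) =
    slope_ops (\<lambda>v. mps_diagonal (f (fst v) (snd v))) ps (mps_diagonal z)"
  using assms(2)
proof (induction ps)
  case (Cons v ps)
  then have "f (fst v) (snd v) \<in> slope_series (int (fst v)) (int (snd v))"
    by (intro assms(1)) (simp add: primitive_def)
  then show ?case using Cons by (simp add: comp_list_def case_prod_unfold mps_diagonal_T)
qed (simp add: comp_list_def)

lemma slope_series_1: "(1 :: 'm::finite B) \<in> slope_series a b"
  by (simp add: slope_series_def mps_coeff_1)

lemma slope_series_mult:
  fixes f g :: "'m::finite B"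
  assumes f: "f \<in> slope_series a b" and g: "g \<in> slope_series a b"
  shows "f * g \<in> slope_series a b"
proof -
  let ?C = "{(int k * a, int k * b) |k. k \<ge> 1}"
  have coeff: "mps_coeff f 0 = 1" "mps_coeff g 0 = 1"
    "\<And>n. n \<noteq> 0 \<Longrightarrow> keys (mps_coeff f n) \<subseteq> ?C"
    "\<And>n. n \<noteq> 0 \<Longrightarrow> keys (mps_coeff g n) \<subseteq> ?C"
    using f g by (simp_all add: slope_series_def)
  have keys: "keys (mps_coeff f p * mps_coeff g r) \<subseteq> ?C" if "p + r \<noteq> 0" for p r
  proof (cases "p = 0 \<or> r = 0")
    case True
    show ?thesis
    proof (cases "p = 0")
      case True
      then show ?thesis using that coeff(4)[of r] by (simp add: coeff(1))
    next
      case False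
      then have "r = 0" using True by simp
      then show ?thesis using coeff(3)[OF False] by (simp add: coeff(2))
    qed
  next
    case False
    have "keys (mps_coeff f p * mps_coeff g r) \<subseteq>
      {x + y |x y. x \<in> keys (mps_coeff f p) \<and> y \<in> keys (mps_coeff g r)}"
      by (rule keys_mult)
    also have "\<dots> \<subseteq> {x + y |x y. x \<in> ?C \<and> y \<in> ?C}"
      using False coeff(3)[of p] coeff(4)[of r] by blast
    also have "\<dots> \<subseteq> ?C"
    proof
      fix z assume "z \<in> {x + y |x y. x \<in> ?C \<and> y \<in> ?C}"
      then obtain k l :: nat where "z = (int k * a, int k * b) + (int l * a, int l * b)" "1 \<le> k" "1 \<le> l"
        by blast
      then have "z = (int (k + l) * a, int (k + l) * b)" "1 \<le> k + l" by (simp_all add: distrib_right)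
      then show "z \<in> ?C" by blast
    qed
    finally show ?thesis .
  qed
  have "keys (mps_coeff (f * g) n) \<subseteq> ?C" if n: "n \<noteq> 0" for n
  proof -
    have "keys (mps_coeff (f * g) n) \<subseteq>
      (\<Union>(p, r)\<in>splits n. keys (mps_coeff f p * mps_coeff g r))"
      unfolding mps_coeff_mult
      using keys_sum[of "\<lambda>(p, r). mps_coeff f p * mps_coeff g r" "splits n"] by (simp add: case_prod_unfold)
    also have "\<dots> \<subseteq> ?C"
    proof (rule UN_least)
      fix z assume "z \<in> splits n"
      then show "(case z of (p, r) \<Rightarrow> keys (mps_coeff f p * mps_coeff g r)) \<subseteq> ?C"
        using n keys[of "fst z" "snd z"] by (simp add: splits_def case_prod_unfold)
    qed
    finally show ?thesis .
  qed
  moreover have "mps_coeff (f * g) 0 = 1"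
  proof -
    have "splits 0 = {(0 :: 'm + 'm \<Rightarrow>\<^sub>0 nat, 0)}"
    proof -
      have zero: "p = 0 \<and> r = 0" if "p + r = 0" for p r :: "'m + 'm \<Rightarrow>\<^sub>0 nat"
      proof -
        have "total_degree (p + r) = 0" unfolding that by (simp add: total_degree_def)
        then have "total_degree p + total_degree r = 0" by (simp only: total_degree_add)
        then show ?thesis by simp
      qed
      show ?thesis by (auto simp: splits_def dest: zero)
    qed
    then show ?thesis by (simp add: mps_coeff_mult coeff(1,2))
  qed
  ultimately show ?thesis by (simp add: slope_series_def)
qed

lemma slope_series_prod:
  fixes f :: "'i \<Rightarrow> 'm::finite B"
  shows "(\<And>i. i \<in> I \<Longrightarrow> f i \<in> slope_series a b) \<Longrightarrow> (\<Prod>i\<in>I. f i) \<in> slope_series a b"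
  by (induction I rule: infinite_finite_induct) (simp_all add: slope_series_1 slope_series_mult)

lemma slope_series_linear:
  fixes v :: "'m::finite + 'm"
  shows "1 + mps_var v * mps_const (single (a, b) 1) \<in> slope_series a b"
proof -
  let ?e = "single (a, b) 1 :: laurent"
  have coeff: "mps_coeff (1 + mps_var v * mps_const ?e) n =
      (if n = 0 then 1 else 0) + (if n = single v 1 then ?e else 0)" for n
    by (simp add: mult.commute[of "mps_var v"] mps_coeff_const_mult mps_coeff_var mps_coeff_add mps_coeff_1)
  have "0 \<noteq> single v (1::nat)" by (metis single_zero inj_single zero_neq_one injD)
  moreover have "(a, b) \<in> {(int k * a, int k * b) |k. k \<ge> 1}" by (auto intro!: exI[of _ "1::nat"])
  ultimately show ?thesis unfolding slope_series_def mem_Collect_eq coeff by auto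
qed

lemma initial_slope_series:
  "(\<Prod>k\<in>UNIV. 1 + svar k * Bx :: 'm::finite B) \<in> slope_series 1 0"
  "(\<Prod>l\<in>UNIV. 1 + tvar l * By :: 'm::finite B) \<in> slope_series 0 1"
  unfolding svar_def tvar_def Bx_def By_def lx_def ly_def
  by (intro slope_series_prod slope_series_linear)+

lemma mps_diagonal_initial:
  "mps_diagonal (\<Prod>k\<in>UNIV. 1 + svar k * Bx :: 'm::finite B) = (1 + fps_X * fps_const lx) ^ CARD('m)"
  "mps_diagonal (\<Prod>l\<in>UNIV. 1 + tvar l * By :: 'm::finite B) = (1 + fps_X * fps_const ly) ^ CARD('m)"
proof -
  note D = ring_hom_mps_diagonal
  show "mps_diagonal (\<Prod>k\<in>UNIV. 1 + svar k * Bx :: 'm::finite B) = (1 + fps_X * fps_const lx) ^ CARD('m)"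
    "mps_diagonal (\<Prod>l\<in>UNIV. 1 + tvar l * By :: 'm::finite B) = (1 + fps_X * fps_const ly) ^ CARD('m)"
    by (simp_all add: hom_prod[OF D] hom_add[OF D] hom_1[OF D] hom_mult[OF D] svar_def tvar_def Bx_def By_def
        mps_diagonal_var mps_diagonal_const)
qed

lemma fps_cong_mps_diagonal: "mps_cong N f g \<Longrightarrow> fps_cong N (mps_diagonal f) (mps_diagonal g)"
  unfolding fps_cong_def mps_diagonal_nth mps_cong_def by (intro allI impI sum.cong) auto

text \<open>
  The lists of slopes in the limit may be chosen as complete lists up to an arbitrarily large degree,
  which makes the factorization comparable with one indexed by degrees.
\<close>

lemma diagonal_factorization:
  fixes f :: "nat \<Rightarrow> nat \<Rightarrow> 'm::finite B"
  assumes "slope_factorization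
      (T 1 0 (\<Prod>k\<in>UNIV. 1 + svar k * Bx) \<circ> T 0 1 (\<Prod>l\<in>UNIV. 1 + tvar l * By)) f"
  shows "\<exists>M\<ge>L. \<forall>u. fps_cong N
    (slope_ops (\<lambda>v. mps_diagonal (f (fst v) (snd v))) (dir_list M) (fps_const (single u 1)))
    (slope_op 1 0 ((1 + fps_X * fps_const lx) ^ CARD('m))
      (slope_op 0 1 ((1 + fps_X * fps_const ly) ^ CARD('m)) (fps_const (single u 1))))"
proof -
  let ?\<Phi> = "T 1 0 (\<Prod>k\<in>UNIV. 1 + svar k * Bx :: 'm B) \<circ> T 0 1 (\<Prod>l\<in>UNIV. 1 + tvar l * By)"
  have slope: "f a b \<in> slope_series (int a) (int b)" if "coprime a b" for a b
    using assms that by (simp add: slope_factorization_def)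
  obtain S where S: "finite S" "S \<subseteq> {(a, b). coprime a b}"
    and lim: "\<And>ps z. S \<subseteq> set ps \<Longrightarrow> set ps \<subseteq> {(a, b). coprime a b} \<Longrightarrow> sorted_wrt steeper ps \<Longrightarrow>
      mps_cong N (comp_list f ps z) (?\<Phi> z)"
    using assms unfolding slope_factorization_def by metis
  define M where "M = Max (insert L (deg ` S))"
  have "L \<le> M" using S(1) by (simp add: M_def)
  have "S \<subseteq> set (dir_list M)"
  proof
    fix v assume v: "v \<in> S"
    then have "deg v \<le> M" using S(1) by (simp add: M_def)
    then show "v \<in> set (dir_list M)" using v S(2) by (auto simp: dir_list dirs_def primitive_def)
  qed
  moreover have "set (dir_list M) \<subseteq> {(a, b). coprime a b}"
    using primitive_dir_list[of M] by (auto simp: primitive_def)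
  ultimately have cong: "mps_cong N (comp_list f (dir_list M) z) (?\<Phi> z)" for z
    using dir_list(1) by (rule lim)
  have "fps_cong N
    (slope_ops (\<lambda>v. mps_diagonal (f (fst v) (snd v))) (dir_list M) (fps_const (single u 1)))
    (slope_op 1 0 ((1 + fps_X * fps_const lx) ^ CARD('m))
      (slope_op 0 1 ((1 + fps_X * fps_const ly) ^ CARD('m)) (fps_const (single u 1))))" for u
    using fps_cong_mps_diagonal[OF cong[of "mps_const (single u 1)"]]
    by (simp add: mps_diagonal_comp_list[OF slope primitive_dir_list] mps_diagonal_T initial_slope_series
        mps_diagonal_initial mps_diagonal_const)
  then show ?thesis using \<open>L \<le> M\<close> by blast
qed

section \<open>Uniqueness of the factors after specialization\<close>

lemma ring_hom_fps_const: "ring_hom (fps_const :: 'a::comm_ring_1 \<Rightarrow> 'a fps)"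
  by (simp add: ring_hom_def)

lemma fps_cong_add: "fps_cong N f f' \<Longrightarrow> fps_cong N g g' \<Longrightarrow> fps_cong N (f + g) (f' + g')"
  by (simp add: fps_cong_def)

lemma fps_cong_mono: "fps_cong N f g \<Longrightarrow> M \<le> N \<Longrightarrow> fps_cong M f g"
  by (simp add: fps_cong_def)

lemma slope_subst_fps_nth_0:
  assumes h: "h $ 0 = 1"
  shows "slope_subst fps_const a b h c $ 0 = c"
proof (induction c rule: pm_induct)
  case (single u c)
  show ?case by (simp add: slope_subst_single[OF ring_hom_fps_const] unit_powi_nth_0[OF h])
next
  case (add p q)
  then show ?case by (simp add: hom_add[OF ring_hom_slope_subst[OF ring_hom_fps_const fps_unit[OF h]]])
qed

lemma fps_cong_slope_subst:
  assumes h: "h $ 0 = 1" "h' $ 0 = 1" and cong: "fps_cong N h h'"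
  shows "fps_cong N (slope_subst fps_const a b h c) (slope_subst fps_const a b h' c)"
proof (induction c rule: pm_induct)
  case (single u c)
  show ?case
    unfolding slope_subst_single[OF ring_hom_fps_const] using h cong
    by (intro fps_cong_mult fps_cong_unit_powi) simp_all
next
  case (add p q)
  then show ?case
    by (simp add: hom_add[OF ring_hom_slope_subst[OF ring_hom_fps_const fps_unit]] h fps_cong_add)
qed

lemma slope_op_nth_0: "h $ 0 = 1 \<Longrightarrow> slope_op a b h z $ 0 = z $ 0"
  by (simp add: slope_op_def fps_extend_nth slope_subst_fps_nth_0)

lemma fps_cong_slope_op:
  assumes "h $ 0 = 1" "h' $ 0 = 1" "fps_cong N h h'" "fps_cong N z z'"
  shows "fps_cong N (slope_op a b h z) (slope_op a b h' z')"
proof -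
  have "slope_op a b h z $ n = slope_op a b h' z' $ n" if n: "n < N" for n
    unfolding slope_op_def fps_extend_nth
  proof (rule sum.cong[OF refl])
    fix i assume "i \<in> {0..n}"
    then have "z $ i = z' $ i" "n - i < N" using assms(4) n by (auto simp: fps_cong_def)
    then show "slope_subst fps_const a b h (z $ i) $ (n - i) = slope_subst fps_const a b h' (z' $ i) $ (n - i)"
      using fps_cong_slope_subst[OF assms(1-3)] by (simp add: fps_cong_def)
  qed
  then show ?thesis by (simp add: fps_cong_def)
qed

lemma slope_op_leading:
  assumes h: "h $ 0 = 1" "h' $ 0 = 1" "fps_cong N h h'" "fps_cong N z z'" and N: "N \<noteq> 0"
  shows "slope_op a b h z $ N - slope_op a b h' z' $ N =
    (slope_subst fps_const a b h (z $ 0) $ N - slope_subst fps_const a b h' (z $ 0) $ N) + (z $ N - z' $ N)"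
proof -
  let ?t = "\<lambda>i. slope_subst fps_const a b h (z $ i) $ (N - i) - slope_subst fps_const a b h' (z' $ i) $ (N - i)"
  have z0: "z' $ 0 = z $ 0" using h(4) N by (simp add: fps_cong_def)
  have "slope_op a b h z $ N - slope_op a b h' z' $ N = (\<Sum>i\<in>{0..N}. ?t i)"
    by (simp add: slope_op_def fps_extend_nth sum_subtractf)
  also have "\<dots> = (\<Sum>i\<in>{0, N}. ?t i)"
  proof (rule sum.mono_neutral_right)
    show "\<forall>i\<in>{0..N} - {0, N}. ?t i = 0"
    proof
      fix i assume "i \<in> {0..N} - {0, N}"
      then have "i < N" "N - i < N" by auto
      then show "?t i = 0"
        using h(4) fps_cong_slope_subst[OF h(1-3)] by (simp add: fps_cong_def)
    qed
  qed auto
  also have "\<dots> = ?t 0 + ?t N" using N by simp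
  finally show ?thesis by (simp add: z0 slope_subst_fps_nth_0 h)
qed

lemma fps_cong_slope_ops:
  assumes "\<And>v. v \<in> set ps \<Longrightarrow> h v $ 0 = 1 \<and> h' v $ 0 = 1 \<and> fps_cong N (h v) (h' v)"
  shows "fps_cong N (slope_ops h ps z) (slope_ops h' ps z)"
  using assms by (induction ps) (simp_all add: fps_cong_slope_op)

lemma slope_ops_nth_0:
  assumes "\<And>v. v \<in> set ps \<Longrightarrow> h v $ 0 = 1"
  shows "slope_ops h ps z $ 0 = z $ 0"
  using assms by (induction ps) (simp_all add: slope_op_nth_0)

lemma slope_ops_leading:
  assumes "\<And>v. v \<in> set ps \<Longrightarrow> h v $ 0 = 1 \<and> h' v $ 0 = 1 \<and> fps_cong N (h v) (h' v)" and N: "N \<noteq> 0"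
  shows "slope_ops h ps z $ N - slope_ops h' ps z $ N =
    (\<Sum>v\<leftarrow>ps. slope_subst fps_const (int (fst v)) (int (snd v)) (h v) (z $ 0) $ N -
      slope_subst fps_const (int (fst v)) (int (snd v)) (h' v) (z $ 0) $ N)"
  using assms(1)
proof (induction ps)
  case (Cons v ps)
  have v: "h v $ 0 = 1" "h' v $ 0 = 1" "fps_cong N (h v) (h' v)" using Cons.prems by auto
  have "fps_cong N (slope_ops h ps z) (slope_ops h' ps z)"
    using Cons.prems by (intro fps_cong_slope_ops) simp
  from slope_op_leading[OF v this N] show ?case
    using Cons slope_ops_nth_0[of ps h z] by simp
qed simp

text \<open>
  All monomials are powers of the monomial with exponent \<open>v\<close>. Unlike the kernels above, the given series are
  not known to be homogeneous, so the power of \<open>t\<close> is independent of the monomial.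
\<close>

definition supported :: "nat \<times> nat \<Rightarrow> laurent fps \<Rightarrow> bool" where
  "supported v h \<longleftrightarrow> (\<forall>n. keys (h $ n) \<subseteq> range (\<lambda>k. (int k * int (fst v), int k * int (snd v))))"

lemma supported_1: "supported v 1"
proof -
  have "0 \<in> range (\<lambda>k. (int k * int (fst v), int k * int (snd v)))"
    by (rule range_eqI[of _ _ 0]) (simp add: zero_prod_def)
  then show ?thesis unfolding supported_def by simp
qed

lemma keys_mult_cone:
  assumes "keys p \<subseteq> range (\<lambda>k. (int k * x, int k * y))"
    and "keys q \<subseteq> range (\<lambda>k. (int k * x, int k * y))"
  shows "keys (p * q) \<subseteq> range (\<lambda>k. (int k * x, int k * y))"
proof
  fix u assume "u \<in> keys (p * q)"
  then have "u \<in> {s + t |s t. s \<in> keys p \<and> t \<in> keys q}"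
    using keys_mult by blast
  then obtain k l where "u = (int k * x, int k * y) + (int l * x, int l * y)"
    using assms by blast
  then have "u = (int (k + l) * x, int (k + l) * y)" by (simp add: distrib_right)
  then show "u \<in> range (\<lambda>k. (int k * x, int k * y))" by blast
qed

lemma keys_sum_subset: "(\<And>i. i \<in> I \<Longrightarrow> keys (f i) \<subseteq> C) \<Longrightarrow> keys (sum f I) \<subseteq> C"
  using keys_sum[of f I] by blast

lemma supported_mult: "supported v f \<Longrightarrow> supported v g \<Longrightarrow> supported v (f * g)"
  unfolding supported_def fps_mult_nth by (intro allI keys_sum_subset keys_mult_cone) blast+

lemma supported_inverse:
  assumes f: "supported v f" "f $ 0 = 1" and fg: "f * g = 1"
  shows "supported v g"
proof -
  let ?C = "range (\<lambda>k. (int k * int (fst v), int k * int (snd v)))"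
  have "keys (g $ n) \<subseteq> ?C" for n
  proof (induction n rule: less_induct)
    case (less n)
    have "(1 :: laurent fps) $ n = (\<Sum>i=0..n. f $ i * g $ (n - i))"
      unfolding fg[symmetric] fps_mult_nth ..
    also have "\<dots> = g $ n + (\<Sum>i=1..n. f $ i * g $ (n - i))"
      by (simp add: sum.atLeast_Suc_atMost f(2))
    finally have e: "g $ n = (1 :: laurent fps) $ n - (\<Sum>i=1..n. f $ i * g $ (n - i))" by simp
    have k1: "keys ((1 :: laurent fps) $ n) \<subseteq> ?C"
      using supported_1 unfolding supported_def by blast
    have k2: "keys (\<Sum>i=1..n. f $ i * g $ (n - i)) \<subseteq> ?C"
      using f(1) less unfolding supported_def by (intro keys_sum_subset keys_mult_cone) auto
    have "keys (p - q) \<subseteq> keys p \<union> keys q" for p q :: laurent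
      by (auto simp: in_keys_iff lookup_minus)
    from this[of "(1 :: laurent fps) $ n" "\<Sum>i=1..n. f $ i * g $ (n - i)"] show ?case
      unfolding e[symmetric] using k1 k2 by (rule order_trans[OF _ Un_least])
  qed
  then show ?thesis unfolding supported_def by blast
qed

lemma supported_power: "supported v f \<Longrightarrow> supported v (f ^ k)"
  by (induction k) (simp_all add: supported_1 supported_mult)

lemma supported_unit_powi:
  assumes f: "supported v f" "f $ 0 = 1"
  shows "supported v (unit_powi f j)"
proof -
  obtain g where g: "f * g = 1" using fps_unit[OF f(2)] by (metis dvdE)
  then show ?thesis
    using supported_power[OF f(1)] supported_power[OF supported_inverse[OF f g]]
    by (cases j rule: int_cases2) (simp_all add: unit_powi_minus_of_nat[OF g])
qed

lemma lookup_monomial_mult: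
  "lookup (single u 1 * q :: laurent) (u + x) = lookup q x"
proof (induction q rule: pm_induct)
  case (single l c)
  show ?case by (simp add: mult_single lookup_single)
next
  case (add p q)
  then show ?case by (simp add: distrib_left lookup_add)
qed

text \<open>
  To first order the product depends additively on the factors. Series of different slopes have no monomial in common
  besides \<open>1\<close>, so the coefficients of each factor can be read off from the image of a suitable
  monomial \<open>x\<^sup>iy\<^sup>j\<close>.
\<close>

lemma slope_ops_unique:
  assumes ps: "distinct ps" "\<forall>v\<in>set ps. primitive v"
    and h: "\<And>v. v \<in> set ps \<Longrightarrow> h v $ 0 = 1 \<and> supported v (h v)"
    and h': "\<And>v. v \<in> set ps \<Longrightarrow> h' v $ 0 = 1 \<and> supported v (h' v)"
    and pos: "\<And>v n. v \<in> set ps \<Longrightarrow> n \<noteq> 0 \<Longrightarrow> 0 \<notin> keys (h v $ n) \<and> 0 \<notin> keys (h' v $ n)"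
    and eq: "\<And>u. fps_cong N (slope_ops h ps (fps_const (single u 1)))
      (slope_ops h' ps (fps_const (single u 1)))"
  shows "\<forall>v\<in>set ps. fps_cong N (h v) (h' v)"
  using eq
proof (induction N)
  case 0
  show ?case by (simp add: fps_cong_def)
next
  case (Suc N)
  have IH: "\<forall>v\<in>set ps. fps_cong N (h v) (h' v)"
    by (rule Suc.IH, rule fps_cong_mono[OF Suc.prems]) simp
  have "h v $ N = h' v $ N" if v: "v \<in> set ps" for v
  proof (cases "N = 0")
    case True
    then show ?thesis using h h' v by simp
  next
    case False
    let ?x = "\<lambda>k. (int k * int (fst v), int k * int (snd v))"
    obtain u where u: "pairing v u = 1" using pairing_eq_1 ps(2) v by blast
    let ?d = "\<lambda>w. unit_powi (h w) (pairing w u) $ N - unit_powi (h' w) (pairing w u) $ N"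
    have slope_subst: "slope_subst fps_const (int (fst w)) (int (snd w)) f (single u 1) $ N =
      single u 1 * unit_powi f (pairing w u) $ N" for w f
      by (simp add: slope_subst_single[OF ring_hom_fps_const] pairing_def)
    have "0 = (\<Sum>w\<leftarrow>ps. single u 1 * ?d w)"
      using slope_ops_leading[of ps h h' N "fps_const (single u 1)"] h h' IH False Suc.prems[of u]
      by (simp add: slope_subst fps_cong_def right_diff_distrib)
    also have "\<dots> = single u 1 * (\<Sum>w\<in>set ps. ?d w)"
      unfolding sum_list_distinct_conv_sum_set[OF ps(1)] sum_distrib_left ..
    finally have zero: "single u 1 * (\<Sum>w\<in>set ps. ?d w) = 0" ..
    have on_ray: "lookup (h v $ N) (?x k) = lookup (h' v $ N) (?x k)" if k: "k \<noteq> 0" for k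
    proof -
      have other: "lookup (?d w) (?x k) = 0" if w: "w \<in> set ps" "w \<noteq> v" for w
      proof -
        have "?x k \<notin> range (\<lambda>l. (int l * int (fst w), int l * int (snd w)))"
        proof
          assume "?x k \<in> range (\<lambda>l. (int l * int (fst w), int l * int (snd w)))"
          then obtain l where "?x k = (int l * int (fst w), int l * int (snd w))" by blast
          then have "int (k * fst v) = int (l * fst w)" "int (k * snd v) = int (l * snd w)" by simp_all
          then have "ray k v = ray l w" unfolding ray_def by (simp only: of_nat_eq_iff)
          then show False using ray_unique[of v w k l] ps(2) v w k by auto
        qed
        moreover have "supported w (unit_powi (h w) (pairing w u))" "supported w (unit_powi (h' w) (pairing w u))"
          using h h' w by (simp_all add: supported_unit_powi)
        ultimately have "?x k \<notin> keys (unit_powi (h w) (pairing w u) $ N)"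
          "?x k \<notin> keys (unit_powi (h' w) (pairing w u) $ N)"
          unfolding supported_def by blast+
        then show ?thesis by (simp add: lookup_minus in_keys_iff)
      qed
      have "lookup (\<Sum>w\<in>set ps. ?d w) (?x k) =
          lookup (single u 1 * (\<Sum>w\<in>set ps. ?d w)) (u + ?x k)"
        by (rule lookup_monomial_mult[symmetric])
      then have "0 = lookup (\<Sum>w\<in>set ps. ?d w) (?x k)"
        by (simp only: zero lookup_zero)
      also have "\<dots> = (\<Sum>w\<in>set ps. if w = v then lookup (?d v) (?x k) else 0)"
        unfolding lookup_sum by (intro sum.cong refl) (auto simp: other)
      also have "\<dots> = lookup (?d v) (?x k)" using v by simp
      finally show ?thesis by (simp add: u lookup_minus)
    qed
    have off_ray: "lookup q x = 0" if "x \<notin> range ?x - {0}" and "q = h v $ N \<or> q = h' v $ N" for q x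
    proof -
      have "keys q \<subseteq> range ?x" "0 \<notin> keys q"
        using that(2) h[OF v] h'[OF v] pos[OF v False] unfolding supported_def by blast+
      then show ?thesis using that(1) by (auto simp: in_keys_iff)
    qed
    show ?thesis
    proof (rule poly_mapping_eqI)
      fix x
      show "lookup (h v $ N) x = lookup (h' v $ N) x"
      proof (cases "x \<in> range ?x - {0}")
        case True
        then obtain k where k: "x = ?x k" by blast
        have "k \<noteq> 0" using True unfolding k by (cases "k = 0") (simp_all add: zero_prod_def)
        then show ?thesis unfolding k by (rule on_ray)
      next
        case False
        then show ?thesis by (simp add: off_ray)
      qed
    qed
  qed
  then show ?case using IH by (auto simp: fps_cong_def less_Suc_eq)
qed

section \<open>Comparison with kernels\<close>

lemma single_sum: "single u (sum f I) = (\<Sum>i\<in>I. single u (f i))"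
  by (induction I rule: infinite_finite_induct) (simp_all add: single_add)

text \<open>
  The substitution of \<open>c t\<^bsup>a+b\<^esup>x\<^sup>ay\<^sup>b\<close> into a series, where \<open>v = (a, b)\<close>.
\<close>

definition ray_embed :: "rat \<Rightarrow> nat \<times> nat \<Rightarrow> rat fps \<Rightarrow> laurent fps" where
  "ray_embed c v F = Abs_fps (\<lambda>k. if deg v dvd k
     then single (int (k div deg v) * int (fst v), int (k div deg v) * int (snd v))
       (c ^ (k div deg v) * F $ (k div deg v))
     else 0)"

lemma ray_embed_nth:
  "deg v \<noteq> 0 \<Longrightarrow> ray_embed c v F $ (deg v * n) =
     single (int n * int (fst v), int n * int (snd v)) (c ^ n * F $ n)"
  by (simp add: ray_embed_def)

lemma ray_embed_nth_0: "deg v \<noteq> 0 \<Longrightarrow> ray_embed c v F $ 0 = single 0 (F $ 0)"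
  using ray_embed_nth[of v c F 0] by (simp add: zero_prod_def)

lemma ray_embed_nth_not_dvd: "\<not> deg v dvd k \<Longrightarrow> ray_embed c v F $ k = 0"
  by (simp add: ray_embed_def)

lemma ring_hom_ray_embed:
  assumes v: "deg v \<noteq> 0"
  shows "ring_hom (ray_embed c v)"
proof -
  have eqI: "f = g" if "\<And>n. f $ (deg v * n) = g $ (deg v * n)" "\<And>k. \<not> deg v dvd k \<Longrightarrow> f $ k = g $ k"
    for f g :: "laurent fps"
    using that by (intro fps_ext) (metis dvdE)
  have "ray_embed c v (F * G) = ray_embed c v F * ray_embed c v G" for F G
  proof (rule eqI)
    fix n
    let ?u = "\<lambda>n. (int n * int (fst v), int n * int (snd v))"
    have "(ray_embed c v F * ray_embed c v G) $ (deg v * n) =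
      (\<Sum>i=0..n. ray_embed c v F $ (deg v * i) * ray_embed c v G $ (deg v * (n - i)))"
      using v ray_embed_nth_not_dvd by (rule sparse_mult_nth)
    also have "\<dots> = (\<Sum>i=0..n. single (?u n) (c ^ n * (F $ i * G $ (n - i))))"
    proof (rule sum.cong[OF refl])
      fix i assume i: "i \<in> {0..n}"
      then have "c ^ n = c ^ i * c ^ (n - i)" by (simp flip: power_add)
      moreover have "?u n = ?u i + ?u (n - i)" using i by (simp add: of_nat_diff algebra_simps)
      ultimately show "ray_embed c v F $ (deg v * i) * ray_embed c v G $ (deg v * (n - i)) =
          single (?u n) (c ^ n * (F $ i * G $ (n - i)))"
        unfolding ray_embed_nth[OF v] mult_single by (simp add: mult_ac)
    qed
    also have "\<dots> = ray_embed c v (F * G) $ (deg v * n)"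
      unfolding ray_embed_nth[OF v] fps_mult_nth sum_distrib_left single_sum ..
    finally show "ray_embed c v (F * G) $ (deg v * n) = (ray_embed c v F * ray_embed c v G) $ (deg v * n)" ..
  next
    fix k assume k: "\<not> deg v dvd k"
    have "ray_embed c v F $ i * ray_embed c v G $ (k - i) = 0" if "i \<in> {0..k}" for i
    proof (cases "deg v dvd i")
      case True
      then have "\<not> deg v dvd k - i"
        using k that by (metis atLeastAtMost_iff dvd_add le_add_diff_inverse)
      then show ?thesis by (simp add: ray_embed_nth_not_dvd)
    qed (simp add: ray_embed_nth_not_dvd)
    then show "ray_embed c v (F * G) $ k = (ray_embed c v F * ray_embed c v G) $ k"
      using k by (simp add: ray_embed_nth_not_dvd fps_mult_nth)
  qed
  moreover have "ray_embed c v (F + G) = ray_embed c v F + ray_embed c v G" for F G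
    by (rule fps_ext) (simp add: ray_embed_def distrib_left single_add)
  moreover have "ray_embed c v 1 = 1"
  proof (rule eqI)
    show "ray_embed c v 1 $ (deg v * n) = 1 $ (deg v * n)" for n
      using v by (cases "n = 0") (simp_all add: ray_embed_nth ray_embed_nth_0)
    show "ray_embed c v 1 $ k = 1 $ k" if "\<not> deg v dvd k" for k
      using that by (cases "k = 0") (simp_all add: ray_embed_nth_not_dvd)
  qed
  ultimately show ?thesis by (simp add: ring_hom_def)
qed

lemma ray_embed_X:
  assumes v: "deg v \<noteq> 0"
  shows "ray_embed c v fps_X =
    fps_const (single 0 c) * (fps_X * fps_const lx) ^ fst v * (fps_X * fps_const ly) ^ snd v"
proof -
  have "fps_X $ k = (if k = 1 then 1 else 0 :: rat)" for k by (simp add: fps_X_def)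
  then have lhs: "ray_embed c v fps_X $ k = (if k = deg v then single (int (fst v), int (snd v)) c else 0)" for k
    using v by (auto simp: ray_embed_def elim!: dvdE)
  have x: "lx ^ i = single (int i, 0) 1" for i
    by (induction i) (simp_all add: lx_def mult_single add.commute flip: zero_prod_def)
  have y: "ly ^ i = single (0, int i) 1" for i
    by (induction i) (simp_all add: ly_def mult_single add.commute flip: zero_prod_def)
  have "(fps_X * fps_const lx) ^ i = fps_X ^ i * fps_const (lx ^ i)"
    "(fps_X * fps_const ly) ^ i = fps_X ^ i * fps_const (ly ^ i)" for i
    by (simp_all add: power_mult_distrib flip: fps_const_power)
  then have "fps_const (single 0 c) * (fps_X * fps_const lx) ^ fst v * (fps_X * fps_const ly) ^ snd v =
    fps_const (single 0 c * lx ^ fst v * ly ^ snd v) * fps_X ^ deg v"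
    by (simp add: deg_def power_add mult_ac flip: fps_const_mult)
  also have "single 0 c * lx ^ fst v * ly ^ snd v = single (int (fst v), int (snd v)) c"
    unfolding x y by (simp add: mult_single)
  finally show ?thesis
    by (intro fps_ext) (simp add: lhs)
qed

lemma fps_cong_ray_embed:
  assumes v: "deg v \<noteq> 0" and cong: "fps_cong N F G"
  shows "fps_cong N (ray_embed c v F) (ray_embed c v G)"
proof -
  have "k div deg v < N" if "k < N" for k
    using that by (meson div_le_dividend le_less_trans)
  then show ?thesis using cong by (simp add: fps_cong_def ray_embed_def)
qed

lemma ray_embed_scale: "ray_embed c v (fps_scale s F) = ray_embed (c * s) v F"
  by (rule fps_ext) (simp add: ray_embed_def power_mult_distrib mult.assoc)

lemma supported_ray_embed: "supported v (ray_embed c v F)"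
  unfolding supported_def ray_embed_def by (auto split: if_splits)

lemma ray_embed_pos:
  assumes v: "primitive v" and k: "k \<noteq> 0"
  shows "0 \<notin> keys (ray_embed c v F $ k)"
proof
  assume 0: "0 \<in> keys (ray_embed c v F $ k)"
  then have "deg v dvd k" by (auto simp: ray_embed_def split: if_splits)
  then obtain n where n: "k = deg v * n" ..
  have v0: "deg v \<noteq> 0" using primitive_deg[OF v] by (simp only: neq0_conv)
  have "(0 :: int \<times> int) = (int n * int (fst v), int n * int (snd v))"
    using 0 unfolding n ray_embed_nth[OF v0] by (auto split: if_splits)
  then have "n = 0" using v0 by (auto simp: zero_prod_def deg_def)
  then show False using k n by simp
qed

lemma finite_deg [simp]: "finite {w. deg w = k}"
  by (rule finite_subset[where B = "{..k} \<times> {..k}"]) (auto simp: deg_def)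

text \<open>
  The image of the monomial with exponent \<open>u\<close> under the kernel at \<open>q = 1\<close>, where a shift of degree \<open>N\<close> carries
  \<open>(-t)\<^sup>N\<close>. The sign turns \<open>1 - z\<close> into \<open>1 + t x\<close> and \<open>1 + t y\<close>. Restricting the kernel to the multiples of \<open>m\<close>
  makes the shifts match those of ordinary monomials and replaces each series by its \<open>m\<close>-th power.
\<close>

definition realize :: "nat \<Rightarrow> rat kernel \<Rightarrow> int \<times> int \<Rightarrow> laurent fps" where
  "realize m K u = Abs_fps (\<lambda>N. \<Sum>w | deg w = N. single (shift 1 u w) ((- 1) ^ N * K (times_vec m u) w))"

lemma realize_nth:
  "realize m K u $ N = (\<Sum>w | deg w = N. single (shift 1 u w) ((- 1) ^ N * K (times_vec m u) w))"
  by (simp add: realize_def)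

lemma realize_id: "realize m id_kernel u = fps_const (single u 1)"
proof (rule fps_ext)
  fix N
  have "realize m id_kernel u $ N = (\<Sum>w | deg w = N. if w = 0 then single u 1 else 0)"
    unfolding realize_nth by (rule sum.cong) (auto simp: id_kernel_def)
  then show "realize m id_kernel u $ N = fps_const (single u 1) $ N"
    by simp
qed

lemma fps_cong_realize: "agree N A B \<Longrightarrow> fps_cong N (realize m A u) (realize m B u)"
  unfolding fps_cong_def realize_nth by (auto intro!: sum.cong simp: agreeD)

lemma ray_embed_unit_powi_nth:
  assumes v: "primitive v" and g: "g $ 0 = 1"
  shows "ray_embed ((- 1) ^ deg v) v (unit_powi g (pairing v y)) $ k =
    (\<Sum>r | deg r = k. single (int (fst r), int (snd r)) ((- 1) ^ k * slope_kernel (\<lambda>_. 1) m v g y r))"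
proof -
  have v0: "deg v \<noteq> 0" using primitive_deg[OF v] by (simp only: neq0_conv)
  let ?t = "\<lambda>r. single (int (fst r), int (snd r)) ((- 1) ^ k * slope_kernel (\<lambda>_. 1) m v g y r)"
  show ?thesis
  proof (cases "deg v dvd k")
    case False
    have "?t r = 0" if "deg r = k" for r
    proof -
      have "r \<noteq> ray n v" for n using that False by auto
      then show ?thesis by (simp add: slope_kernel_not_ray)
    qed
    then show ?thesis using False by (simp add: ray_embed_nth_not_dvd)
  next
    case True
    then obtain n where n: "k = deg v * n" ..
    have "(\<Sum>r | deg r = k. ?t r) = (\<Sum>r\<in>{ray n v}. ?t r)"
    proof (rule sum.mono_neutral_right)
      show "\<forall>r\<in>{r. deg r = k} - {ray n v}. ?t r = 0"
      proof
        fix r assume r: "r \<in> {r. deg r = k} - {ray n v}"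
        have "r \<noteq> ray l v" for l
        proof
          assume l: "r = ray l v"
          then have "l * deg v = deg v * n" using r n by simp
          then have "l = n" using v0 by simp
          then show False using r l by simp
        qed
        then show "?t r = 0" by (simp add: slope_kernel_not_ray)
      qed
    qed (simp_all add: n)
    also have "\<dots> = single (int n * int (fst v), int n * int (snd v))
        ((- 1) ^ k * unit_powi g (pairing v y) $ n)"
      by (simp add: slope_kernel_ray[OF v] cocycle_trivial[OF g]) (simp add: ray_def)
    finally show ?thesis unfolding n ray_embed_nth[OF v0] power_mult by simp
  qed
qed

lemma slope_op_realize:
  assumes v: "primitive v" and g: "g $ 0 = 1"
  shows "slope_op (int (fst v)) (int (snd v)) (ray_embed ((- 1) ^ deg v) v (g ^ m)) (realize m K u) =
    realize m (kcomp m (slope_kernel (\<lambda>_. 1) m v g) K) u"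
proof (rule fps_ext)
  fix N
  have v0: "deg v \<noteq> 0" using primitive_deg[OF v] by (simp only: neq0_conv)
  let ?c = "(- 1) ^ deg v :: rat"
  let ?h = "ray_embed ?c v (g ^ m)" and ?A = "slope_kernel (\<lambda>_. 1) m v g"
  let ?w = "\<lambda>r. (int (fst r), int (snd r))"
  note hom = ring_hom_ray_embed[OF v0, of ?c]
  have gm: "(g ^ m) $ 0 = 1" using unit_powi_nth_0[OF g, of "int m"] by simp
  have h: "?h dvd 1" using v0 by (intro fps_unit) (simp add: ray_embed_nth_0 gm)
  note lhom = ring_hom_slope_subst[OF ring_hom_fps_const h, of "int (fst v)" "int (snd v)"]
  have powi: "unit_powi ?h (pairing v y) = ray_embed ?c v (unit_powi g (pairing v (times_vec m y)))" for y
  proof -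
    have "unit_powi ?h (pairing v y) = ray_embed ?c v (unit_powi (g ^ m) (pairing v y))"
      by (rule unit_powi_hom[symmetric, OF fps_unit[OF gm] hom_1[OF hom] hom_mult[OF hom]])
    also have "unit_powi (g ^ m) (pairing v y) = unit_powi g (int m * pairing v y)"
      using unit_powi_mult[OF fps_unit[OF g], of "int m"] by simp
    also have "int m * pairing v y = pairing v (times_vec m y)"
      by (simp add: pairing_def times_vec_def algebra_simps)
    finally show ?thesis .
  qed
  have slope_subst_monomial: "slope_subst fps_const (int (fst v)) (int (snd v)) ?h (single (shift 1 u w) c) $ k =
    (\<Sum>r | deg r = k. single (shift 1 u (w + r)) (c * ((- 1) ^ k * ?A (shift m (times_vec m u) w) r)))"
    for w c k
  proof -
    have "slope_subst fps_const (int (fst v)) (int (snd v)) ?h (single (shift 1 u w) c) $ k =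
      single (shift 1 u w) c * unit_powi ?h (pairing v (shift 1 u w)) $ k"
      by (simp add: slope_subst_single[OF ring_hom_fps_const] pairing_def)
    also have "unit_powi ?h (pairing v (shift 1 u w)) $ k =
      (\<Sum>r | deg r = k. single (?w r) ((- 1) ^ k * ?A (shift m (times_vec m u) w) r))"
    proof -
      have "times_vec m (shift 1 u w) = shift m (times_vec m u) w" by (simp add: times_vec_def shift_def algebra_simps)
      then show ?thesis unfolding powi by (simp only: ray_embed_unit_powi_nth[OF v g, of _ k m])
    qed
    also have "single (shift 1 u w) c * \<dots> = (\<Sum>r | deg r = k.
        single (shift 1 u (w + r)) (c * ((- 1) ^ k * ?A (shift m (times_vec m u) w) r)))"
      unfolding sum_distrib_left mult_single
    proof (rule sum.cong[OF refl])
      fix r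
      have "shift 1 u w + ?w r = shift 1 u (w + r)" by (simp add: shift_def)
      then show "single (shift 1 u w + ?w r) (c * ((- 1) ^ k * ?A (shift m (times_vec m u) w) r)) =
        single (shift 1 u (w + r)) (c * ((- 1) ^ k * ?A (shift m (times_vec m u) w) r))" by simp
    qed
    finally show ?thesis .
  qed
  have "slope_op (int (fst v)) (int (snd v)) ?h (realize m K u) $ N =
    (\<Sum>i=0..N. \<Sum>w | deg w = i. \<Sum>r | deg r = N - i. single (shift 1 u (w + r))
      ((- 1) ^ i * K (times_vec m u) w * ((- 1) ^ (N - i) * ?A (shift m (times_vec m u) w) r)))"
    unfolding slope_op_def fps_extend_nth realize_nth hom_sum[OF lhom] fps_sum_nth slope_subst_monomial ..
  also have "\<dots> = (\<Sum>i=0..N. \<Sum>w | deg w = i. \<Sum>r | deg r = N - i. single (shift 1 u (w + r))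
      ((- 1) ^ N * (K (times_vec m u) w * ?A (shift m (times_vec m u) w) r)))"
  proof (intro sum.cong refl)
    fix i w r assume "i \<in> {0..N}"
    then have "(- 1 :: rat) ^ N = (- 1) ^ i * (- 1) ^ (N - i)" by (simp flip: power_add)
    then show "single (shift 1 u (w + r))
        ((- 1) ^ i * K (times_vec m u) w * ((- 1) ^ (N - i) * ?A (shift m (times_vec m u) w) r)) =
      single (shift 1 u (w + r)) ((- 1) ^ N * (K (times_vec m u) w * ?A (shift m (times_vec m u) w) r))"
      by (simp add: mult_ac)
  qed
  also have "\<dots> = (\<Sum>s | deg s = N. \<Sum>(w, r)\<in>splits s. single (shift 1 u (w + r))
      ((- 1) ^ N * (K (times_vec m u) w * ?A (shift m (times_vec m u) w) r)))"
    by (rule sum_splits_by_degree[OF finite_splits_vector finite_deg deg_add, symmetric])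
  also have "\<dots> = realize m (kcomp m ?A K) u $ N"
    unfolding realize_nth
  proof (rule sum.cong[OF refl])
    fix s
    have "(\<Sum>(w, r)\<in>splits s. single (shift 1 u (w + r)) ((- 1) ^ N * (K (times_vec m u) w * ?A (shift m (times_vec m u) w) r))) =
      (\<Sum>(w, r)\<in>splits s. single (shift 1 u s) ((- 1) ^ N * (K (times_vec m u) w * ?A (shift m (times_vec m u) w) r)))"
      by (rule sum_splits_cong) simp
    also have "\<dots> = single (shift 1 u s) ((- 1) ^ N * kcomp m ?A K (times_vec m u) s)"
      by (simp add: kcomp_def sum_distrib_left single_sum case_prod_unfold)
    finally show "(\<Sum>(w, r)\<in>splits s. single (shift 1 u (w + r)) ((- 1) ^ N * (K (times_vec m u) w * ?A (shift m (times_vec m u) w) r))) =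
      single (shift 1 u s) ((- 1) ^ N * kcomp m ?A K (times_vec m u) s)" .
  qed
  finally show "slope_op (int (fst v)) (int (snd v)) ?h (realize m K u) $ N = realize m (kcomp m ?A K) u $ N" .
qed

lemma slope_ops_realize:
  assumes "\<forall>v\<in>set ps. primitive v" "\<forall>v. g v $ 0 = 1"
  shows "slope_ops (\<lambda>v. ray_embed ((- 1) ^ deg v) v (g v ^ m)) ps (fps_const (single u 1)) =
    realize m (ordered_prod (\<lambda>_. 1) m g ps) u"
  using assms(1)
  by (induction ps) (simp_all add: realize_id slope_op_realize assms(2))

lemma comp_id_right: "kcomp m A id_kernel = A"
proof (intro ext)
  fix u w
  have "kcomp m A id_kernel u w = (\<Sum>(p, r)\<in>splits w. if p = 0 then A u r else 0)"
    unfolding kcomp_def by (rule sum_splits_cong) (simp add: id_kernel_def)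
  then show "kcomp m A id_kernel u w = A u w" by (simp only: sum_splits_delta_left finite_splits_vector)
qed

lemma unit_powi_minus_1: "unit_powi (- 1 :: 'a::comm_ring_1) e = (if even e then 1 else - 1)"
proof (rule unit_powi_unique[where B = "\<lambda>e. if even e then 1 else - 1 :: 'a" and k = e, symmetric])
  show "(- 1 :: 'a) dvd 1" by (rule dvdI[of _ _ "- 1"]) simp
qed auto

lemma fps_scale_1: "fps_scale c 1 = 1"
  by (rule fps_ext) simp

lemma fps_scale_power: "fps_scale c (f ^ n) = fps_scale c f ^ n"
  by (induction n) (simp_all add: fps_scale_1 fps_scale_mult)

lemma ray_embed_linear:
  assumes v: "deg v \<noteq> 0"
  shows "ray_embed c v (1 - fps_X) =
    1 - fps_const (single 0 c) * (fps_X * fps_const lx) ^ fst v * (fps_X * fps_const ly) ^ snd v"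
  using hom_add[OF ring_hom_ray_embed[OF v], of c 1 "- fps_X"]
  by (simp add: hom_1[OF ring_hom_ray_embed[OF v]] hom_minus[OF ring_hom_ray_embed[OF v]] ray_embed_X[OF v])

lemma realize_base_kernel:
  "realize m (base_kernel (\<lambda>_. 1) m) u =
    slope_op 1 0 ((1 + fps_X * fps_const lx) ^ m)
      (slope_op 0 1 ((1 + fps_X * fps_const ly) ^ m) (fps_const (single u 1)))"
proof -
  have minus: "fps_const (single 0 (- 1)) = (- 1 :: laurent fps)"
    by (simp add: single_uminus flip: fps_const_neg)
  have deg: "deg (1, 0) \<noteq> 0" "deg (0, 1) \<noteq> 0" by (simp_all add: deg_def del: deg_eq_0_iff)
  have X0: "(1 - fps_X :: rat fps) $ 0 = 1" by simp
  have x: "ray_embed ((- 1) ^ deg (1, 0)) (1, 0) ((1 - fps_X) ^ m) = (1 + fps_X * fps_const lx) ^ m"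
    unfolding hom_power[OF ring_hom_ray_embed[OF deg(1)]] ray_embed_linear[OF deg(1)]
    using minus by (simp add: deg_def)
  have y: "ray_embed ((- 1) ^ deg (0, 1)) (0, 1) ((1 - fps_X) ^ m) = (1 + fps_X * fps_const ly) ^ m"
    unfolding hom_power[OF ring_hom_ray_embed[OF deg(2)]] ray_embed_linear[OF deg(2)]
    using minus by (simp add: deg_def)
  have "realize m (base_kernel (\<lambda>_. 1) m) u = realize m (kcomp m (slope_kernel (\<lambda>_. 1) m (1, 0) (1 - fps_X))
      (kcomp m (slope_kernel (\<lambda>_. 1) m (0, 1) (1 - fps_X)) id_kernel)) u"
    by (simp only: base_kernel_def comp_id_right)
  also have "\<dots> = slope_op (int (fst (1::nat, 0::nat))) (int (snd (1::nat, 0::nat)))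
      (ray_embed ((- 1) ^ deg (1, 0)) (1, 0) ((1 - fps_X) ^ m))
      (slope_op (int (fst (0::nat, 1::nat))) (int (snd (0::nat, 1::nat)))
        (ray_embed ((- 1) ^ deg (0, 1)) (0, 1) ((1 - fps_X) ^ m)) (realize m id_kernel u))"
    unfolding slope_op_realize[OF primitive_axes(1) X0] slope_op_realize[OF primitive_axes(2) X0] ..
  finally show ?thesis unfolding x y realize_id by simp
qed

lemma slope_series_diagonal:
  fixes f :: "'m::finite B"
  assumes f: "f \<in> slope_series (int (fst v)) (int (snd v))" and v: "primitive v"
  shows "mps_diagonal f $ 0 = 1" "supported v (mps_diagonal f)"
    "n \<noteq> 0 \<Longrightarrow> 0 \<notin> keys (mps_diagonal f $ n)"
proof -
  let ?C = "{(int k * int (fst v), int k * int (snd v)) |k. k \<ge> 1}"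
  have f0: "mps_coeff f 0 = 1" and
    keys: "\<And>p. p \<noteq> 0 \<Longrightarrow> keys (mps_coeff f p) \<subseteq> ?C"
    using f by (simp_all add: slope_series_def)
  show one: "mps_diagonal f $ 0 = 1"
    by (simp only: mps_diagonal_nth total_degree_0_set) (simp add: f0)
  have diag: "keys (mps_diagonal f $ n) \<subseteq> ?C" if n: "n \<noteq> 0" for n
    unfolding mps_diagonal_nth
  proof (rule keys_sum_subset)
    fix p :: "'m + 'm \<Rightarrow>\<^sub>0 nat" assume "p \<in> {p. total_degree p = n}"
    then have "p \<noteq> 0" using n by (auto simp: total_degree_def)
    then show "keys (mps_coeff f p) \<subseteq> ?C" by (rule keys)
  qed
  show "supported v (mps_diagonal f)"
    unfolding supported_def
  proof
    fix n
    show "keys (mps_diagonal f $ n) \<subseteq> range (\<lambda>k. (int k * int (fst v), int k * int (snd v)))"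
    proof (cases "n = 0")
      case True
      then show ?thesis
        using supported_1[of v, unfolded supported_def, THEN spec, of 0] by (simp only: one fps_one_nth simp_thms if_True)
    next
      case False
      then show ?thesis using diag[OF False] by blast
    qed
  qed
  show "0 \<notin> keys (mps_diagonal f $ n)" if n: "n \<noteq> 0"
  proof
    assume "0 \<in> keys (mps_diagonal f $ n)"
    then obtain k where "(0 :: int \<times> int) = (int k * int (fst v), int k * int (snd v))" "k \<ge> 1"
      using diag[OF n] by blast
    then have "deg v = 0" by (auto simp: zero_prod_def deg_def)
    then show False using primitive_deg[OF v] by simp
  qed
qed

lemma ring_hom_of_int: "ring_hom (of_int :: int \<Rightarrow> 'a::comm_ring_1)"
  by (simp add: ring_hom_def)

text \<open>
  The factorization of kernels provides factors for the same product, so uniqueness identifies the two. In particular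
  the specialized series are homogeneous.
\<close>

lemma diagonal_eq:
  fixes f :: "nat \<Rightarrow> nat \<Rightarrow> 'm::finite B" and g :: "nat \<times> nat \<Rightarrow> rat fps"
  assumes fact: "slope_factorization
      (T 1 0 (\<Prod>k\<in>UNIV. 1 + svar k * Bx) \<circ> T 0 1 (\<Prod>l\<in>UNIV. 1 + tvar l * By)) f"
    and g: "\<forall>v. g v $ 0 = 1"
    and g_fact: "\<And>N. agree (Suc N) (ordered_prod (\<lambda>_. 1) CARD('m) g (dir_list N)) (base_kernel (\<lambda>_. 1) CARD('m))"
    and v: "primitive v"
  shows "mps_diagonal (f (fst v) (snd v)) = ray_embed ((- 1) ^ deg v) v (g v ^ CARD('m))"
proof -
  let ?h = "\<lambda>v. mps_diagonal (f (fst v) (snd v))" and ?h' = "\<lambda>v. ray_embed ((- 1) ^ deg v) v (g v ^ CARD('m))"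
  have slope: "f (fst v) (snd v) \<in> slope_series (int (fst v)) (int (snd v))" if "primitive v" for v
    using fact that by (simp add: slope_factorization_def primitive_def)
  have "fps_cong N (?h v) (?h' v)" for N
  proof -
    obtain M where M: "max (deg v) N \<le> M" and cong: "\<And>u. fps_cong N
        (slope_ops ?h (dir_list M) (fps_const (single u 1)))
        (slope_op 1 0 ((1 + fps_X * fps_const lx) ^ CARD('m))
          (slope_op 0 1 ((1 + fps_X * fps_const ly) ^ CARD('m)) (fps_const (single u 1))))"
      using diagonal_factorization[OF fact] by blast
    have "fps_cong N (slope_ops ?h (dir_list M) (fps_const (single u 1)))
        (slope_ops ?h' (dir_list M) (fps_const (single u 1)))" for u
    proof -
      have "fps_cong (Suc M) (slope_ops ?h' (dir_list M) (fps_const (single u 1)))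
          (realize CARD('m) (base_kernel (\<lambda>_. 1) CARD('m)) u)"
        unfolding slope_ops_realize[OF primitive_dir_list g] by (rule fps_cong_realize[OF g_fact])
      then have "fps_cong N (slope_ops ?h' (dir_list M) (fps_const (single u 1)))
          (realize CARD('m) (base_kernel (\<lambda>_. 1) CARD('m)) u)"
        using M by (elim fps_cong_mono) simp
      then show ?thesis using cong[of u] unfolding realize_base_kernel by (simp add: fps_cong_def)
    qed
    moreover have "?h' w $ 0 = 1" if "primitive w" for w
    proof -
      have "deg w \<noteq> 0" using primitive_deg[OF that] by (simp only: neq0_conv)
      moreover have "(g w ^ CARD('m)) $ 0 = 1" using unit_powi_nth_0[of "g w" "int CARD('m)"] g by simp
      ultimately show ?thesis by (simp add: ray_embed_nth_0)
    qed
    ultimately have "\<forall>w\<in>set (dir_list M). fps_cong N (?h w) (?h' w)"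
      using primitive_dir_list[of M]
      by (intro slope_ops_unique distinct_dir_list primitive_dir_list)
        (auto simp: supported_ray_embed ray_embed_pos slope_series_diagonal[OF slope])
    moreover have "v \<in> set (dir_list M)" using v M by (simp add: dir_list dirs_def)
    ultimately show ?thesis by blast
  qed
  then show ?thesis by (intro fps_ext) (auto simp: fps_cong_def)
qed

section \<open>The product formula\<close>

theorem corollary12p2:
  fixes f :: "nat \<Rightarrow> nat \<Rightarrow> 'm::finite B" and a b :: nat
  assumes "slope_factorization
      (T 1 0 (\<Prod>k\<in>UNIV. 1 + svar k * Bx) \<circ> T 0 1 (\<Prod>l\<in>UNIV. 1 + tvar l * By)) f"
    and "coprime a b"
  shows "\<exists>d :: nat \<Rightarrow> int.
    (\<lambda>K. \<Prod>k=1..K. unit_powi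
        (1 - (unit_powi (- 1) (int CARD('m) * int a * int b - (int a)\<^sup>2 - (int b)\<^sup>2) *
              (fps_X * fps_const lx) ^ a * (fps_X * fps_const ly) ^ b) ^ k)
        (- (int k * d k)))
    \<longlonglongrightarrow> mps_diagonal (f a b)"
proof -
  let ?m = "CARD('m)" and ?v = "(a, b)"
  let ?s = "(- 1) ^ (?m * a * b)"
  have v: "primitive ?v" using assms(2) by (simp add: primitive_def)
  then have v0: "deg ?v \<noteq> 0" using primitive_deg by blast
  note hQ = ring_hom_of_int[where 'a = rat]
  obtain F :: "nat \<times> nat \<Rightarrow> int fps" where F: "\<forall>v. F v $ 0 = 1"
    and F_fact: "\<And>N. agree (Suc N) (ordered_prod (\<lambda>_. 1) ?m F (dir_list N)) (base_kernel (\<lambda>_. 1) ?m)"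
    and F_prod: "\<And>v. primitive v \<Longrightarrow> \<exists>c :: nat \<Rightarrow> int. \<forall>K. fps_cong (Suc K)
       (fps_scale ((- 1) ^ (?m * fst v * snd v)) (F v)) (\<Prod>k=1..K. unit_powi (1 - fps_X ^ k) (int k * c k))"
    by (rule classical_factorization[of ?m]) (rule that)
  obtain c :: "nat \<Rightarrow> int" where c: "\<And>K. fps_cong (Suc K) (fps_scale ?s (F ?v))
      (\<Prod>k=1..K. unit_powi (1 - fps_X ^ k) (int k * c k))"
    using F_prod[OF v] by auto
  define G :: "nat \<times> nat \<Rightarrow> rat fps" where "G = (\<lambda>v. map_fps of_int (F v))"
  have G: "\<forall>v. G v $ 0 = 1" using F by (simp add: G_def)
  have triv: "character (\<lambda>_. 1 :: int)" by (simp add: character_def)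
  have "agree (Suc N) (ordered_prod (\<lambda>_. 1) ?m G (dir_list N)) (base_kernel (\<lambda>_. 1) ?m)" for N
  proof -
    have "agree (Suc N) (\<lambda>u w. of_int (ordered_prod (\<lambda>_. 1) ?m F (dir_list N) u w) :: rat)
        (\<lambda>u w. of_int (base_kernel (\<lambda>_. 1) ?m u w))"
      using F_fact[of N] by (simp add: agree_def)
    then show ?thesis
      by (simp add: hom_ordered_prod[OF hQ triv F] hom_base_kernel[OF hQ triv] G_def)
  qed
  then have diag: "mps_diagonal (f a b) = ray_embed ((- 1) ^ deg ?v) ?v (G ?v ^ ?m)"
    using diagonal_eq[OF assms(1) G _ v] by simp
  \<comment> \<open>The argument of \<open>F\<close> is \<open>(-1)\<^bsup>a+b\<^esup>\<close> times \<open>(tx)\<^sup>a(ty)\<^sup>b\<close>, and the product expansion of \<open>F\<close>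
    carries the sign \<open>(-1)\<^bsup>mab\<^esup>\<close>; together they are the sign in the statement.\<close>
  define C :: rat where "C = (- 1) ^ deg ?v * ?s"
  let ?\<epsilon> = "ray_embed C ?v"
  note h\<epsilon> = ring_hom_ray_embed[OF v0, of C]
  have "fps_scale ?s (fps_scale ?s H) = H" for H :: "rat fps"
    by (rule fps_ext) (simp flip: mult.assoc power_mult_distrib)
  then have diag': "mps_diagonal (f a b) = ?\<epsilon> (fps_scale ?s (G ?v) ^ ?m)"
    unfolding diag C_def by (metis ray_embed_scale fps_scale_power)
  let ?Y = "unit_powi (- 1) (int ?m * int a * int b - (int a)\<^sup>2 - (int b)\<^sup>2) *
              (fps_X * fps_const lx) ^ a * (fps_X * fps_const ly) ^ b"
  have "C = (if even (int ?m * int a * int b - (int a)\<^sup>2 - (int b)\<^sup>2) then 1 else - 1)"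
    by (auto simp: C_def deg_def uminus_power_if)
  then have "fps_const (single 0 C) =
      (unit_powi (- 1) (int ?m * int a * int b - (int a)\<^sup>2 - (int b)\<^sup>2) :: laurent fps)"
    by (simp add: unit_powi_minus_1 single_uminus flip: fps_const_neg)
  then have \<epsilon>X: "?\<epsilon> fps_X = ?Y" unfolding ray_embed_X[OF v0] by simp
  have factor: "?\<epsilon> (unit_powi (1 - fps_X ^ k) j) = unit_powi (1 - ?Y ^ k) j" if "k \<noteq> 0" for k j
  proof -
    have "?\<epsilon> (1 + (- (fps_X ^ k))) = 1 + (- ((?\<epsilon> fps_X) ^ k))"
      by (simp only: hom_add[OF h\<epsilon>] hom_1[OF h\<epsilon>] hom_minus[OF h\<epsilon>] hom_power[OF h\<epsilon>])
    then have "?\<epsilon> (1 - fps_X ^ k) = 1 - ?Y ^ k" unfolding \<epsilon>X by simp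
    moreover have "(1 - fps_X ^ k :: rat fps) $ 0 = 1" using that by simp
    ultimately show ?thesis
      using unit_powi_hom[OF fps_unit hom_1[OF h\<epsilon>] hom_mult[OF h\<epsilon>]] by metis
  qed
  \<comment> \<open>The factor \<open>m\<close> comes from the \<open>m\<close>-th power, the sign from the convention for the exponents.\<close>
  define d where "d k = - (int ?m * c k)" for k
  let ?P = "\<lambda>K. \<Prod>k=1..K. unit_powi (1 - ?Y ^ k) (- (int k * d k))"
  have "fps_cong (Suc K) (mps_diagonal (f a b)) (?P K)" for K
  proof -
    let ?b = "\<lambda>k. 1 - fps_X ^ k :: int fps" and ?q = "\<lambda>k. 1 - fps_X ^ k :: rat fps"
    have b: "?b k $ 0 = 1" if "k \<in> {1..K}" for k using that by simp
    have "fps_cong (Suc K) (map_fps of_int (fps_scale ?s (F ?v)) :: rat fps)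
        (map_fps of_int (\<Prod>k=1..K. unit_powi (?b k) (int k * c k)))"
      using c[of K] by (simp add: fps_cong_def)
    also have "map_fps of_int (fps_scale ?s (F ?v)) = fps_scale ?s (G ?v)"
      by (simp add: map_fps_scale[OF hQ] G_def)
    also have "map_fps of_int (\<Prod>k=1..K. unit_powi (?b k) (int k * c k)) =
        (\<Prod>k=1..K. unit_powi (?q k) (int k * c k))"
    proof -
      note hm = ring_hom_map_fps[OF hQ]
      have "map_fps of_int (unit_powi (?b k) j) = unit_powi (?q k) j" if "k \<in> {1..K}" for k j
      proof -
        have "map_fps of_int (?b k) = ?q k" by (rule fps_ext) simp
        then show ?thesis
          using unit_powi_hom[OF fps_unit[OF b[OF that]] hom_1[OF hm] hom_mult[OF hm]] by simp
      qed
      then show ?thesis unfolding hom_prod[OF hm] by (intro prod.cong) simp_all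
    qed
    finally have "fps_cong (Suc K) (fps_scale ?s (G ?v) ^ ?m) ((\<Prod>k=1..K. unit_powi (?q k) (int k * c k)) ^ ?m)"
      by (rule fps_cong_power)
    then have "fps_cong (Suc K) (mps_diagonal (f a b)) (?\<epsilon> ((\<Prod>k=1..K. unit_powi (?q k) (int k * c k)) ^ ?m))"
      unfolding diag' by (rule fps_cong_ray_embed[OF v0])
    also have "(\<Prod>k=1..K. unit_powi (?q k) (int k * c k)) ^ ?m = (\<Prod>k=1..K. unit_powi (?q k) (- (int k * d k)))"
      unfolding prod_power_distrib
    proof (rule prod.cong[OF refl])
      fix k assume "k \<in> {1..K}"
      then have "?q k dvd 1" by (intro fps_unit) simp
      from unit_powi_mult[OF this, of "int k * c k" "int ?m"]
      show "unit_powi (?q k) (int k * c k) ^ ?m = unit_powi (?q k) (- (int k * d k))"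
        by (simp add: d_def mult_ac)
    qed
    also have "?\<epsilon> (\<Prod>k=1..K. unit_powi (?q k) (- (int k * d k))) = ?P K"
      unfolding hom_prod[OF h\<epsilon>] by (intro prod.cong refl factor) simp
    finally show ?thesis .
  qed
  then have "?P K $ n = mps_diagonal (f a b) $ n" if "n \<le> K" for n K
    using that by (simp add: fps_cong_def less_Suc_eq_le)
  then have "eventually (\<lambda>K. ?P K $ n = mps_diagonal (f a b) $ n) sequentially" for n
    by (rule eventually_sequentiallyI)
  then have "?P \<longlonglongrightarrow> mps_diagonal (f a b)" by (rule tendsto_fpsI)
  then show ?thesis by blast
qed

end
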